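(* Let $(X,\pi)$ be a totally connected weighted $(d+1)$-partite complex, let $\gamma_2$ denote the largest second eigenvalue $\lambda_2(P_\tau)$ over all faces $\tau$ of co-dimension $2$, and let $\Delta=\Delta_{(X,\pi)}$. Suppose that for some $0<\delta<1$, $$\gamma_2\le \frac{\delta^2}{10(1+\ln\Delta)}\qquad\text{and}\qquad \gamma_2\le\frac{1-\delta}{\Delta+\ln\Delta}.$$ Then there is a constant $c\le 2$ (depending on $\delta$) such that for every face $\tau$ of co-dimension $k$ (with $k\ge 2$), the link of $\tau$ is a $\lambda$-spectral expander with $$\lambda=\begin{cases}\dfrac{c(1-\delta)}{k\delta} & \text{if } k\ge\Delta,\\[2mm] \dfrac{c(1-\delta)\frac{k+\ln k}{\Delta+\ln\Delta}}{k\delta} & \text{if } k<\Delta.\end{cases}$$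
   Context: A simplicial complex $X$ on a finite ground set is a downward closed family of sets (faces); maximal faces are facets; $\dim\tau=|\tau|-1$; $X$ is pure $d$-dimensional if all facets have dimension $d$; the co-dimension of $\tau$ is $d-\dim\tau$. The link of $\tau$ is $X_\tau=\{\sigma\setminus\tau:\sigma\in X,\sigma\supseteq\tau\}$. Write $[d]=\{0,1,\dots,d\}$. $X$ is $(d+1)$-partite if it is pure $d$-dimensional and its vertex set is partitioned into $T_0,\dots,T_d$ with every facet meeting each $T_i$ in exactly one vertex; the type of a face $\tau$ is $\{i\in[d]:|\tau\cap T_i|=1\}$. A weighted complex $(X,\pi)$ has a probability distribution $\pi$ on facets, positive on every facet. For a face $\tau$, $\pi_\tau(\sigma)=\pi(\sigma\cup\tau)/\sum_{\sigma'}\pi(\sigma'\cup\tau)$ over facets $\sigma,\sigma'$ of $X_\tau$. For $\tau$ of co-dimension $\ge 2$, the 1-skeleton of $(X_\tau,\pi_\tau)$ is the weighted graph on vertices of $X_\tau$ with edges the 2-element faces $\{x,y\}$ of $X_\tau$, weighted by $\Pr_{\sigma\sim\pi_\tau}[\{x,y\}\subseteq\sigma]$; $P_\tau$ is the transition matrix of the simple random walk on it ($P(x,y)=w(xy)/\sum_z w(xz)$), and $\lambda_2(P_\tau)$ is its second largest eigenvalue. The link of $\tau$ is a $\lambda$-spectral expander if $\lambda_2(P_\tau)\le\lambda$. $X$ is totally connected if the 1-skeleton of the link of every face of co-dimension at least $2$ (including the empty face) is connected. For $i\in[d]$, $\Delta_{(X,\pi)}(i)$ is the number of $j\in[d]\setminus\{i\}$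 for which there exists a face $\tau$ of type $[d]\setminus\{i,j\}$ with $\lambda_2(P_\tau)>0$, and $\Delta_{(X,\pi)}=\max_i\Delta_{(X,\pi)}(i)$. *)

theory Defs
  imports
    "HOL-Library.Disjoint_Sets"
    "HOL-Library.Multiset"
    "HOL-Computational_Algebra.Polynomial"
    "Jordan_Normal_Form.Char_Poly"
begin

text \<open>A complex is represented by its set of faces; a finite ground set exists iff the
  union of the faces is finite.\<close>

definition simplicial_complex :: "'v set set \<Rightarrow> bool" where
  "simplicial_complex X \<longleftrightarrow> finite (\<Union>X) \<and> (\<forall>\<sigma>\<in>X. \<forall>\<tau>. \<tau> \<subseteq> \<sigma> \<longrightarrow> \<tau> \<in> X)"

definition vertices :: "'v set set \<Rightarrow> 'v set" where
  "vertices X = {v. {v} \<in> X}"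

definition facets :: "'v set set \<Rightarrow> 'v set set" where
  "facets X = {\<sigma>\<in>X. \<forall>\<sigma>'\<in>X. \<sigma> \<subseteq> \<sigma>' \<longrightarrow> \<sigma>' = \<sigma>}"

definition pure_complex :: "nat \<Rightarrow> 'v set set \<Rightarrow> bool" where
  "pure_complex d X \<longleftrightarrow> simplicial_complex X \<and> (\<forall>\<sigma>\<in>facets X. card \<sigma> = d + 1)"

text \<open>The co-dimension \<open>d - (card \<tau> - 1)\<close>. The subtraction does not truncate on faces of a pure
  \<open>d\<close>-dimensional complex.\<close>

definition codim :: "nat \<Rightarrow> 'v set \<Rightarrow> nat" where
  "codim d \<tau> = d + 1 - card \<tau>"

definition link :: "'v set set \<Rightarrow> 'v set \<Rightarrow> 'v set set" where
  "link X \<tau> = {\<sigma> - \<tau> |\<sigma>. \<sigma> \<in> X \<and> \<tau> \<subseteq> \<sigma>}"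

text \<open>The index set \<open>[d] = {0, 1, \<dots>, d}\<close> is \<open>{..d}\<close>; only \<open>T 0, \<dots>, T d\<close> are relevant.\<close>

definition partite_complex :: "nat \<Rightarrow> (nat \<Rightarrow> 'v set) \<Rightarrow> 'v set set \<Rightarrow> bool" where
  "partite_complex d T X \<longleftrightarrow>
     pure_complex d X \<and>
     (\<Union>i\<le>d. T i) = vertices X \<and> disjoint_family_on T {..d} \<and>
     (\<forall>\<sigma>\<in>facets X. \<forall>i\<le>d. card (\<sigma> \<inter> T i) = 1)"

definition face_type :: "nat \<Rightarrow> (nat \<Rightarrow> 'v set) \<Rightarrow> 'v set \<Rightarrow> nat set" where
  "face_type d T \<tau> = {i\<in>{..d}. card (\<tau> \<inter> T i) = 1}"

text \<open>Only the values of \<open>w\<close> on facets matter. The total weight 1 excludes a complex without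
  facets.\<close>

definition facet_distribution :: "'v set set \<Rightarrow> ('v set \<Rightarrow> real) \<Rightarrow> bool" where
  "facet_distribution X w \<longleftrightarrow> (\<forall>\<sigma>\<in>facets X. w \<sigma> > 0) \<and> (\<Sum>\<sigma>\<in>facets X. w \<sigma>) = 1"

definition weighted_partite_complex ::
  "nat \<Rightarrow> (nat \<Rightarrow> 'v set) \<Rightarrow> 'v set set \<Rightarrow> ('v set \<Rightarrow> real) \<Rightarrow> bool" where
  "weighted_partite_complex d T X w \<longleftrightarrow> partite_complex d T X \<and> facet_distribution X w"

definition link_weight ::
  "'v set set \<Rightarrow> ('v set \<Rightarrow> real) \<Rightarrow> 'v set \<Rightarrow> 'v set \<Rightarrow> real" where
  "link_weight X w \<tau> \<sigma> = w (\<sigma> \<union> \<tau>) / (\<Sum>\<sigma>'\<in>facets (link X \<tau>). w (\<sigma>' \<union> \<tau>))"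

definition skeleton_edge :: "'v set set \<Rightarrow> 'v \<Rightarrow> 'v \<Rightarrow> bool" where
  "skeleton_edge Y x y \<longleftrightarrow> x \<noteq> y \<and> {x, y} \<in> Y"

definition edge_weight :: "'v set set \<Rightarrow> ('v set \<Rightarrow> real) \<Rightarrow> 'v \<Rightarrow> 'v \<Rightarrow> real" where
  "edge_weight Y w x y =
     (if skeleton_edge Y x y then (\<Sum>\<sigma>\<in>{\<sigma>\<in>facets Y. {x, y} \<subseteq> \<sigma>}. w \<sigma>) else 0)"

definition walk :: "'v set set \<Rightarrow> ('v set \<Rightarrow> real) \<Rightarrow> 'v \<Rightarrow> 'v \<Rightarrow> real" where
  "walk Y w x y = edge_weight Y w x y / (\<Sum>z\<in>vertices Y. edge_weight Y w x z)"

text \<open>The matrix of \<open>P\<close> with respect to some enumeration of the finite set \<open>V\<close>; its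
  characteristic polynomial does not depend on the enumeration.\<close>

definition matrix_on :: "'v set \<Rightarrow> ('v \<Rightarrow> 'v \<Rightarrow> real) \<Rightarrow> real mat" where
  "matrix_on V P =
     (let vs = (SOME vs. distinct vs \<and> set vs = V)
      in mat (card V) (card V) (\<lambda>(i, j). P (vs ! i) (vs ! j)))"

text \<open>The real eigenvalues, with multiplicity, in decreasing order. A random walk on a weighted
  graph is reversible, so for the matrices considered here all eigenvalues are real.\<close>

definition eigenvalue_list :: "real mat \<Rightarrow> real list" where
  "eigenvalue_list A = rev (sorted_list_of_multiset (proots (char_poly A)))"

text \<open>\<open>\<lambda>\<^sub>2(P\<^sub>\<tau>)\<close>. For \<open>\<tau>\<close> of co-dimension at least 2 the link has at least two vertices, so the
  second entry exists.\<close>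

definition lambda2 :: "'v set set \<Rightarrow> ('v set \<Rightarrow> real) \<Rightarrow> 'v set \<Rightarrow> real" where
  "lambda2 X w \<tau> =
     eigenvalue_list (matrix_on (vertices (link X \<tau>)) (walk (link X \<tau>) (link_weight X w \<tau>))) ! 1"

definition link_spectral_expander ::
  "'v set set \<Rightarrow> ('v set \<Rightarrow> real) \<Rightarrow> 'v set \<Rightarrow> real \<Rightarrow> bool" where
  "link_spectral_expander X w \<tau> l \<longleftrightarrow> lambda2 X w \<tau> \<le> l"

definition skeleton_connected :: "'v set set \<Rightarrow> bool" where
  "skeleton_connected Y \<longleftrightarrow>
     (\<forall>x\<in>vertices Y. \<forall>y\<in>vertices Y. (skeleton_edge Y)\<^sup>*\<^sup>* x y)"

definition totally_connected :: "nat \<Rightarrow> 'v set set \<Rightarrow> bool" where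
  "totally_connected d X \<longleftrightarrow> (\<forall>\<tau>\<in>X. codim d \<tau> \<ge> 2 \<longrightarrow> skeleton_connected (link X \<tau>))"

definition Delta_at ::
  "nat \<Rightarrow> (nat \<Rightarrow> 'v set) \<Rightarrow> 'v set set \<Rightarrow> ('v set \<Rightarrow> real) \<Rightarrow> nat \<Rightarrow> nat" where
  "Delta_at d T X w i =
     card {j\<in>{..d} - {i}. \<exists>\<tau>\<in>X. face_type d T \<tau> = {..d} - {i, j} \<and> lambda2 X w \<tau> > 0}"

definition Delta ::
  "nat \<Rightarrow> (nat \<Rightarrow> 'v set) \<Rightarrow> 'v set set \<Rightarrow> ('v set \<Rightarrow> real) \<Rightarrow> nat" where
  "Delta d T X w = Max (Delta_at d T X w ` {..d})"

text \<open>There is a face of co-dimension 2 as soon as \<open>d \<ge> 1\<close>; for \<open>d = 0\<close> the maximum is over the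
  empty set, and there is no face of co-dimension at least 2 either.\<close>

definition gamma2 :: "nat \<Rightarrow> 'v set set \<Rightarrow> ('v set \<Rightarrow> real) \<Rightarrow> real" where
  "gamma2 d X w = Max (lambda2 X w ` {\<tau>\<in>X. codim d \<tau> = 2})"

text \<open>The bound on the expansion of a link of co-dimension \<open>k\<close>, where \<open>D\<close> stands for \<open>\<Delta>\<close>.\<close>

definition expansion_bound :: "real \<Rightarrow> real \<Rightarrow> nat \<Rightarrow> nat \<Rightarrow> real" where
  "expansion_bound c \<delta> D k =
     (if k \<ge> D then c * (1 - \<delta>) / (real k * \<delta>)
      else c * (1 - \<delta>) * ((real k + ln (real k)) / (real D + ln (real D))) / (real k * \<delta>))"

end

theory Submission
  imports Defs
begin

text \<open>Let \<open>S\<close> be the set of the \<open>k\<close> types missing in a face \<open>\<tau>\<close>, and for functions \<open>\<phi>\<^sub>i\<close> on the vertices of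
  type \<open>i \<in> S\<close> put \<open>F = (\<Sum>i\<in>S. \<phi>\<^sub>i)\<close>, a random variable on the facets above \<open>\<tau>\<close>. Expansion of the link of
  \<open>\<tau>\<close> is a bound \<open>Var F \<le> (\<Sum>i\<in>S. (1 + g\<^sub>i) Var \<phi>\<^sub>i)\<close>, and \<open>\<lambda>\<^sub>2(P\<^sub>\<tau>) \<le> max g / (k - 1)\<close>.
  Averaging the law of total variance over the \<open>k\<close> ways of fixing one more vertex, for an \<open>F\<close> built from a top
  eigenfunction, the bounds \<open>g\<^bsub>S - l\<^esub>\<close> for the links of larger faces yield the bound \<open>g\<^bsub>S\<^esub>\<close> as soon as
  \<open>(\<Sum>l\<in>S - {i}. g\<^bsub>S - l\<^esub>(i)) \<le> (k - 2) g\<^bsub>S\<^esub>(i) - g\<^bsub>S\<^esub>(i)\<^sup>2\<close>.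

  Join two types if some face of co-dimension 2 missing exactly these types has positive \<open>\<lambda>\<^sub>2\<close>; the graph has
  maximal degree \<open>\<Delta>\<close>. The choice of \<open>g\<^bsub>S\<^esub>(i)\<close> depends only on the degree of \<open>i\<close> within \<open>S\<close> or, if \<open>i\<close> is a leaf,
  on the degree of its neighbour. The recursive inequality then fails only at an isolated edge of \<open>S\<close>, where
  instead the two types are independent of all others and nothing is lost in passing to \<open>\<tau>\<close>.\<close>

section \<open>Reversible kernels\<close>

text \<open>The square in the recursion is the variance of the conditional expectation of
  \<open>F\<close> given the fixed vertex, which for an eigenfunction is a multiple of the
  eigenfunction itself. It forces a strict gain in \<open>g\<close> at every step, and the gain can
  be paid only by types whose removal lowers the weight of \<open>i\<close>. For a leaf, removing
  the neighbour gives 0 and leaves \<open>k - 2\<close> terms, so a weight that saw only the degree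
  of the leaf would have no slack: this is why the degree of the neighbour enters. At an isolated
  edge nothing can pay, and iterating the recursion would let the bound grow with \<open>k\<close>
  instead of \<Delta>. Averaging yields only a quadratic inequality for the top eigenvalue, which
  large values satisfy as well. Connectedness excludes them, through a crude a priori bound.\<close>

lemma real_symmetric_eigenvalue_real:
  fixes S :: "real mat"
  assumes S: "S \<in> carrier_mat n n" and sym: "transpose_mat S = S"
    and ev: "eigenvalue (map_mat complex_of_real S) z"
  shows "Im z = 0"
proof -
  let ?S = "map_mat complex_of_real S"
  have S': "?S \<in> carrier_mat n n" using S by simp
  obtain v where v: "v \<in> carrier_vec n" "v \<noteq> 0\<^sub>v n" and eq: "?S *\<^sub>v v = z \<cdot>\<^sub>v v"
    using ev S unfolding eigenvalue_def eigenvector_def by auto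
  have row: "(\<Sum>j<n. complex_of_real (S $$ (i, j)) * v $ j) = z * v $ i" if "i < n" for i
    using arg_cong[OF eq, of "\<lambda>u. u $ i"] that S v
    by (simp add: scalar_prod_def lessThan_atLeast0 row_def)
  have symi: "S $$ (i, j) = S $$ (j, i)" if "i < n" "j < n" for i j
    using arg_cong[OF sym, of "\<lambda>A. A $$ (i, j)"] that S by simp
  let ?N = "\<Sum>i<n. cnj (v $ i) * v $ i"
  have 1: "(\<Sum>i<n. \<Sum>j<n. cnj (v $ i) * complex_of_real (S $$ (i, j)) * v $ j) = z * ?N"
  proof -
    have "(\<Sum>i<n. \<Sum>j<n. cnj (v $ i) * complex_of_real (S $$ (i, j)) * v $ j)
        = (\<Sum>i<n. cnj (v $ i) * (\<Sum>j<n. complex_of_real (S $$ (i, j)) * v $ j))"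
      by (simp add: sum_distrib_left mult.assoc)
    also have "\<dots> = (\<Sum>i<n. cnj (v $ i) * (z * v $ i))" using row by simp
    finally show ?thesis by (simp add: sum_distrib_left algebra_simps)
  qed
  \<comment> \<open>Conjugation exchanges the two summation indices, so symmetry makes the quadratic
    form real.\<close>
  have 2: "cnj (\<Sum>i<n. \<Sum>j<n. cnj (v $ i) * complex_of_real (S $$ (i, j)) * v $ j)
     = (\<Sum>i<n. \<Sum>j<n. cnj (v $ i) * complex_of_real (S $$ (i, j)) * v $ j)"
  proof -
    have "cnj (\<Sum>i<n. \<Sum>j<n. cnj (v $ i) * complex_of_real (S $$ (i, j)) * v $ j)
      = (\<Sum>i<n. \<Sum>j<n. v $ i * complex_of_real (S $$ (i, j)) * cnj (v $ j))"
      by simp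
    also have "\<dots> = (\<Sum>j<n. \<Sum>i<n. v $ i * complex_of_real (S $$ (i, j)) * cnj (v $ j))"
      by (rule sum.swap)
    also have "\<dots> = (\<Sum>i<n. \<Sum>j<n. cnj (v $ i) * complex_of_real (S $$ (i, j)) * v $ j)"
      by (intro sum.cong refl) (simp add: symi algebra_simps)
    finally show ?thesis .
  qed
  have N: "?N = complex_of_real (\<Sum>i<n. (cmod (v $ i))\<^sup>2)"
    by (simp add: complex_norm_square mult.commute del: of_real_power)
  have "\<exists>i<n. v $ i \<noteq> 0" using v by (metis eq_vecI carrier_vecD index_zero_vec)
  then have "(\<Sum>i<n. (cmod (v $ i))\<^sup>2) > 0"
    by (auto intro!: sum_pos2)
  then obtain r where r: "?N = complex_of_real r" "r > 0" using N by blast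
  have "cnj z * r = z * r" using 2 unfolding 1 r(1) by simp
  then have "cnj z = z" using r(2) by simp
  then show ?thesis by (simp add: complex_eq_iff)
qed

lemma real_symmetric_char_poly_splits:
  fixes S :: "real mat"
  assumes S: "S \<in> carrier_mat n n" and sym: "transpose_mat S = S"
  obtains es where "char_poly S = (\<Prod>e\<leftarrow>es. [:- e, 1:])" "length es = n"
proof -
  interpret of_real_poly_hom: map_poly_inj_idom_hom complex_of_real ..
  let ?S = "map_mat complex_of_real S"
  have S': "?S \<in> carrier_mat n n" using S by simp
  obtain as where as: "char_poly ?S = (\<Prod>a\<leftarrow>as. [:- a, 1:])" "length as = n"
    using char_poly_factorized[OF S'] by blast
  have real: "complex_of_real (Re a) = a" if "a \<in> set as" for a
  proof -
    have "poly (char_poly ?S) a = 0"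
      unfolding as(1) poly_prod_list using that by (auto simp: prod_list_zero_iff)
    then have "eigenvalue ?S a" using eigenvalue_root_char_poly[OF S'] by simp
    then show ?thesis using real_symmetric_eigenvalue_real[OF S sym] by (simp add: complex_eq_iff)
  qed
  have "map_poly complex_of_real (char_poly S) = char_poly ?S"
    by (rule of_real_hom.char_poly_hom[OF S, symmetric])
  also have "\<dots> = (\<Prod>a\<leftarrow>as. map_poly complex_of_real [:- Re a, 1:])"
    unfolding as by (rule arg_cong[of _ _ prod_list], rule map_cong[OF refl])
      (simp add: real map_poly_pCons)
  also have "\<dots> = map_poly complex_of_real (\<Prod>a\<leftarrow>map Re as. [:- a, 1:])"
    by (simp only: of_real_poly_hom.hom_prod_list map_map o_def)
  finally have "char_poly S = (\<Prod>a\<leftarrow>map Re as. [:- a, 1:])"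
    using of_real_poly_hom.injectivity by blast
  with as(2) that show ?thesis by (metis length_map)
qed

text \<open>The reflection exchanging \<open>v\<close> with the first unit vector. As it is
  symmetric and an involution, conjugating by it keeps a matrix symmetric, and if \<open>v\<close>
  is an eigenvector it makes the first column a multiple of the unit vector.\<close>

lemma householder_reflection:
  fixes v :: "real vec"
  assumes v: "v \<in> carrier_vec n" and unit: "v \<bullet> v = 1" and n: "0 < n"
  obtains W where "W \<in> carrier_mat n n" "transpose_mat W = W" "W * W = 1\<^sub>m n" "col W 0 = v"
proof -
  define u where "u i = v $ i - (if i = 0 then 1 else 0)" for i
  \<comment> \<open>This is 2 divided by the squared length of \<open>u\<close>, which equals
    \<open>2 - 2 * v $ 0\<close>. If \<open>v $ 0 = 1\<close>, then \<open>v\<close> already is the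
    unit vector, \<open>u\<close> vanishes, and \<open>W\<close> is the identity.\<close>
  define c where "c = (if v $ 0 = 1 then 0 else 1 / (1 - v $ 0))"
  define W where "W = mat n n (\<lambda>(i, j). (if i = j then 1 else 0) - c * u i * u j)"
  have vv: "(\<Sum>i<n. v $ i * v $ i) = 1"
    using unit v by (simp add: scalar_prod_def lessThan_atLeast0)
  have uu: "(\<Sum>i<n. u i * u i) = 2 - 2 * v $ 0"
  proof -
    have "(\<Sum>i<n. u i * u i)
        = (\<Sum>i<n. v $ i * v $ i + (if i = 0 then 1 - 2 * v $ i else 0))"
      by (intro sum.cong) (auto simp: u_def algebra_simps)
    also have "\<dots> = 2 - 2 * v $ 0"
      using n by (simp add: sum.distrib vv)
    finally show ?thesis .
  qed
  have cc: "c * c * (\<Sum>i<n. u i * u i) = 2 * c"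
  proof (cases "v $ 0 = 1")
    case False
    then have "c * (1 - v $ 0) = 1" by (simp add: c_def)
    moreover have "c * c * (2 - 2 * v $ 0) = 2 * c * (c * (1 - v $ 0))"
      by (simp add: algebra_simps)
    ultimately show ?thesis unfolding uu by simp
  qed (simp add: c_def)
  have W: "W \<in> carrier_mat n n" by (simp add: W_def)
  have 1: "transpose_mat W = W" by (rule eq_matI) (auto simp: W_def)
  have 2: "W * W = 1\<^sub>m n"
  proof (rule eq_matI)
    fix i j assume ij: "i < dim_row (1\<^sub>m n)" "j < dim_col (1\<^sub>m n)"
    then have ij: "i < n" "j < n" by auto
    have "(W * W) $$ (i, j) = (\<Sum>k<n. W $$ (i, k) * W $$ (k, j))"
      using ij W by (simp add: scalar_prod_def lessThan_atLeast0)
    also have "\<dots> = (\<Sum>k<n. (if k = i then (if k = j then 1 else 0) - c * u k * u j else 0)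
        - (if k = j then c * u i * u k else 0) + c * c * u i * u j * (u k * u k))"
      using ij by (intro sum.cong) (auto simp: W_def algebra_simps)
    also have "\<dots> = (if i = j then 1 else 0) - c * u i * u j - c * u i * u j
        + u i * u j * (c * c * (\<Sum>k<n. u k * u k))"
      using ij by (simp add: sum.distrib sum_subtractf sum_distrib_left algebra_simps)
    also have "\<dots> = (if i = j then 1 else 0)" unfolding cc by (simp add: algebra_simps)
    finally show "(W * W) $$ (i, j) = 1\<^sub>m n $$ (i, j)" using ij by simp
  qed (use W in auto)
  have 3: "col W 0 = v"
  proof (rule eq_vecI)
    fix i assume "i < dim_vec v"
    then have i: "i < n" using v by simp
    have v1: "v $ i = 0" if "v $ 0 = 1" "i \<noteq> 0"
    proof -
      have "(\<Sum>i<n. v $ i * v $ i) = v $ 0 * v $ 0 + (\<Sum>i\<in>{..<n}-{0}. v $ i * v $ i)"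
        using n by (subst sum.remove[of _ 0]) auto
      then have "(\<Sum>i\<in>{..<n}-{0}. v $ i * v $ i) = 0" using vv that by simp
      then have "\<forall>i\<in>{..<n}-{0}. v $ i * v $ i = 0" by (subst (asm) sum_nonneg_eq_0_iff) auto
      then show ?thesis using that i by auto
    qed
    have "col W 0 $ i = (if i = 0 then 1 else 0) - c * u i * u 0"
      using i n by (simp add: W_def)
    also have "\<dots> = v $ i"
      using v1 by (auto simp: u_def c_def field_simps)
    finally show "col W 0 $ i = v $ i" .
  qed (use W v in auto)
  from that[OF W 1 2 3] show ?thesis .
qed

text \<open>Deflation: the reflection of a unit eigenvector for the head of \<open>es\<close> leaves
  a symmetric block of size \<open>n - 1\<close>. The diagonal follows whatever order
  \<open>es\<close> has, so that a decreasing order can be prescribed later.\<close>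

lemma real_symmetric_diagonalization:
  fixes S :: "real mat"
  assumes "S \<in> carrier_mat n n" "transpose_mat S = S"
    and "char_poly S = (\<Prod>e\<leftarrow>es. [:- e, 1:])"
  shows "\<exists>U\<in>carrier_mat n n. transpose_mat U * U = 1\<^sub>m n \<and>
    transpose_mat U * S * U = mat_diag n (\<lambda>i. es ! i)"
  using assms
proof (induct es arbitrary: n S)
  case Nil
  with degree_monic_char_poly[of S n] have "n = 0" by auto
  with Nil show ?case by (intro bexI[of _ "1\<^sub>m 0"]) (auto intro!: eq_matI simp: mat_diag_def)
next
  case (Cons e es n S)
  note S = Cons(2) and sym = Cons(3)
  define m where "m = n - 1"
  have cp: "char_poly S = [:- e, 1:] * (\<Prod>e\<leftarrow>es. [:- e, 1:])" using Cons(4) by simp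
  have mon: "monic (\<Prod>e\<leftarrow>es. [:- e, 1:])" by (rule monic_prod_list) auto
  have "degree (char_poly S) = Suc (degree (\<Prod>e\<leftarrow>es. [:- e, 1:]))"
    unfolding cp by (subst degree_mult_eq) (use mon in auto)
  with degree_monic_char_poly[OF S] have n: "n = 1 + m" "0 < n" by (auto simp: m_def)
  have "eigenvalue S e" unfolding eigenvalue_root_char_poly[OF S] cp by simp
  then obtain v0 where v0: "v0 \<in> carrier_vec n" "v0 \<noteq> 0\<^sub>v n" "S *\<^sub>v v0 = e \<cdot>\<^sub>v v0"
    using S unfolding eigenvalue_def eigenvector_def by auto
  have pos: "v0 \<bullet> v0 > 0"
    using conjugate_square_greater_0_vec[OF v0(1)] v0(2) by simp
  define v where "v = (1 / sqrt (v0 \<bullet> v0)) \<cdot>\<^sub>v v0"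
  have v: "v \<in> carrier_vec n" using v0 by (simp add: v_def)
  have "v \<bullet> v = 1" unfolding v_def using v0(1) pos
    by (simp add: field_simps)
  then obtain W where W: "W \<in> carrier_mat n n" "transpose_mat W = W" "W * W = 1\<^sub>m n" "col W 0 = v"
    using householder_reflection[OF v _ n(2)] by blast
  have Sv: "S *\<^sub>v v = e \<cdot>\<^sub>v v"
    unfolding v_def using S v0 by (simp add: mult_mat_vec smult_smult_assoc mult.commute)
  define A where "A = W * S * W"
  have A: "A \<in> carrier_mat n n" using W S by (simp add: A_def)
  have Asym: "transpose_mat A = A"
  proof -
    have "transpose_mat A = transpose_mat W * (transpose_mat S * transpose_mat W)"
      unfolding A_def using W(1) S by (simp add: transpose_mult[of _ n n _ n])
    then show ?thesis unfolding A_def W sym using W(1) S by (simp add: assoc_mult_mat[of _ n n _ n _ n])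
  qed
  have col0: "col A 0 = e \<cdot>\<^sub>v unit_vec n 0"
  proof -
    have "col A 0 = (W * S) *\<^sub>v col W 0"
      unfolding A_def using W S n by (intro col_mult2[of _ n n _ n]) auto
    also have "\<dots> = W *\<^sub>v (S *\<^sub>v v)" unfolding W(4) using W(1) S v by (simp add: assoc_mult_mat_vec[of _ n n _ n])
    also have "\<dots> = e \<cdot>\<^sub>v (W *\<^sub>v col W 0)" unfolding Sv W(4) using W(1) v by (simp add: mult_mat_vec)
    also have "W *\<^sub>v col W 0 = col (W * W) 0"
      using W n by (intro col_mult2[symmetric, of _ n n _ n]) auto
    also have "\<dots> = unit_vec n 0" unfolding W(3) using n by simp
    finally show ?thesis .
  qed
  have A0: "A $$ (i, 0) = (if i = 0 then e else 0)" if "i < n" for i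
    using arg_cong[OF col0, of "\<lambda>u. u $ i"] that A n by (simp add: unit_vec_def)
  have A0': "A $$ (0, i) = (if i = 0 then e else 0)" if "i < n" for i
    using A0[OF that] arg_cong[OF Asym, of "\<lambda>M. M $$ (0, i)"] that A n by simp
  define B where "B = mat m m (\<lambda>(i, j). A $$ (Suc i, Suc j))"
  define E where "E = mat 1 1 (\<lambda>_. e)"
  have B: "B \<in> carrier_mat m m" by (simp add: B_def)
  have E: "E \<in> carrier_mat 1 1" by (simp add: E_def)
  have Ablock: "A = four_block_mat E (0\<^sub>m 1 m) (0\<^sub>m m 1) B"
    by (rule eq_matI) (use A n A0 A0' in \<open>auto simp: B_def E_def\<close>)
  have Bsym: "transpose_mat B = B"
  proof (rule eq_matI)
    fix i j assume "i < dim_row B" "j < dim_col B"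
    then show "transpose_mat B $$ (i, j) = B $$ (i, j)"
      using arg_cong[OF Asym, of "\<lambda>M. M $$ (Suc i, Suc j)"] A n by (simp add: B_def)
  qed (auto simp: B_def)
  have "similar_mat A S"
    by (rule similar_matI[of _ _ W W n]) (use W S A in \<open>auto simp: A_def\<close>)
  then have "char_poly A = char_poly S" by (rule char_poly_similar)
  moreover have "char_poly A = char_poly E * char_poly B"
    unfolding Ablock by (rule char_poly_four_block_zeros_col[OF E _ B]) simp
  moreover have "char_poly E = [:- e, 1:]"
    by (simp add: E_def char_poly_defs det_def sign_def)
  ultimately have "char_poly B = (\<Prod>e\<leftarrow>es. [:- e, 1:])" using cp
    by (metis mult_cancel_left pCons_eq_0_iff zero_neq_one)
  from Cons(1)[OF B Bsym this] obtain U where U: "U \<in> carrier_mat m m"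
    and UU: "transpose_mat U * U = 1\<^sub>m m" and D: "transpose_mat U * B * U = mat_diag m (\<lambda>i. es ! i)"
    by blast
  define Q where "Q = four_block_mat (1\<^sub>m 1) (0\<^sub>m 1 m) (0\<^sub>m m 1) U"
  have Q: "Q \<in> carrier_mat n n" unfolding Q_def n by (rule four_block_carrier_mat) (use U in auto)
  have Qt: "transpose_mat Q = four_block_mat (1\<^sub>m 1) (0\<^sub>m 1 m) (0\<^sub>m m 1) (transpose_mat U)"
    unfolding Q_def using U by (subst transpose_four_block_mat[of _ 1 1 _ m _ m]) auto
  have Qt': "transpose_mat Q \<in> carrier_mat n n" using Q by simp
  have QQ: "transpose_mat Q * Q = 1\<^sub>m n"
    unfolding Qt unfolding Q_def
    by (subst mult_four_block_mat[of _ 1 1 _ m _ m _ _ 1 _ m]) (use U UU n in auto)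
  have QA: "transpose_mat Q * A = four_block_mat E (0\<^sub>m 1 m) (0\<^sub>m m 1) (transpose_mat U * B)"
    unfolding Qt Ablock
    by (subst mult_four_block_mat[of _ 1 1 _ m _ m _ _ 1 _ m]) (use U B E in auto)
  have QAQ: "transpose_mat Q * A * Q = four_block_mat E (0\<^sub>m 1 m) (0\<^sub>m m 1) (mat_diag m (\<lambda>i. es ! i))"
    unfolding QA unfolding Q_def
    by (subst mult_four_block_mat[of _ 1 1 _ m _ m _ _ 1 _ m]) (use U B E D in auto)
  have diag: "\<dots> = mat_diag n (\<lambda>i. (e # es) ! i)"
    by (rule eq_matI) (auto simp: n mat_diag_def E_def nth_Cons')
  have WQ: "transpose_mat (W * Q) = transpose_mat Q * W"
    using transpose_mult[OF W(1) Q] W(2) by simp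
  show ?case
  proof (intro bexI[of _ "W * Q"] conjI)
    show "W * Q \<in> carrier_mat n n" using W Q by simp
    have "transpose_mat Q * W * (W * Q) = transpose_mat Q * (W * W) * Q"
      using W(1) Q Qt' by (simp add: assoc_mult_mat[of _ n n _ n _ n])
    also have "\<dots> = 1\<^sub>m n" unfolding W(3) using Q Qt' QQ by simp
    finally show "transpose_mat (W * Q) * (W * Q) = 1\<^sub>m n" unfolding WQ .
    have "transpose_mat Q * W * S * (W * Q) = transpose_mat Q * A * Q"
      unfolding A_def using W(1) Q Qt' S by (simp add: assoc_mult_mat[of _ n n _ n _ n])
    then show "transpose_mat (W * Q) * S * (W * Q) = mat_diag n (\<lambda>i. (e # es) ! i)"
      unfolding WQ QAQ diag by simp
  qed
qed

section \<open>Self-adjoint kernels in an orthonormal eigenbasis\<close>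

text \<open>Only symmetry of \<open>m x * B x y\<close> is asked, since the locale serves both the
  walk of a link and the covariance operator of \<open>top_eigenfunction\<close>, whose entries may
  be negative.\<close>

locale reversible_kernel =
  fixes V :: "'v set" and m :: "'v \<Rightarrow> real" and B :: "'v \<Rightarrow> 'v \<Rightarrow> real"
  assumes fin: "finite V" and m: "\<And>x. x \<in> V \<Longrightarrow> m x > 0"
    and rev: "\<And>x y. x \<in> V \<Longrightarrow> y \<in> V \<Longrightarrow> m x * B x y = m y * B y x"
begin

definition es :: "real list" where
  "es = eigenvalue_list (matrix_on V B)"

definition eigenbasis :: "(nat \<Rightarrow> 'v \<Rightarrow> real) \<Rightarrow> bool" where
  "eigenbasis u \<longleftrightarrow>
    (\<forall>i<card V. \<forall>x\<in>V. (\<Sum>y\<in>V. B x y * u i y) = es ! i * u i x) \<and>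
    (\<forall>i<card V. \<forall>j<card V. (\<Sum>x\<in>V. m x * u i x * u j x) = (if i = j then 1 else 0)) \<and>
    (\<forall>x\<in>V. \<forall>y\<in>V. (\<Sum>i<card V. u i x * u i y * m y) = (if x = y then 1 else 0))"

text \<open>Conjugation by the diagonal matrix of \<open>sqrt (m x)\<close> makes the kernel
  symmetric and keeps its characteristic polynomial. Dividing row \<open>x\<close> of the
  diagonalizing orthogonal matrix by \<open>sqrt (m x)\<close> gives a basis orthonormal for the
  weights \<open>m\<close>.\<close>

lemma es_eigenbasis:
  shows length_es: "length es = card V" and sorted_es: "sorted_wrt (\<ge>) es"
    and ex_eigenbasis: "\<exists>u. eigenbasis u"
proof -
  define n where "n = card V"
  define vs where "vs = (SOME vs. distinct vs \<and> set vs = V)"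
  have vs: "distinct vs" "set vs = V"
    using someI_ex[of "\<lambda>vs. distinct vs \<and> set vs = V"] finite_distinct_list[OF fin]
    unfolding vs_def by auto
  have len: "length vs = n" using distinct_card[OF vs(1)] vs(2) by (simp add: n_def)
  have inV: "vs ! k \<in> V" if "k < n" for k using that vs(2) len nth_mem by metis
  have sumV: "(\<Sum>x\<in>V. f x) = (\<Sum>k<n. f (vs ! k))" for f :: "'v \<Rightarrow> real"
    using sum.reindex_bij_betw[OF bij_betw_nth[OF vs(1) refl refl], of f] vs(2) len
    by (simp add: lessThan_atLeast0)
  define A where "A = matrix_on V B"
  have A_eq: "A = mat n n (\<lambda>(i, j). B (vs ! i) (vs ! j))"
    unfolding A_def matrix_on_def vs_def[symmetric] Let_def n_def ..
  define r where "r k = sqrt (m (vs ! k))" for k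
  have r: "r k > 0" "r k * r k = m (vs ! k)" if "k < n" for k
    using m[OF inV[OF that]] by (auto simp: r_def)
  define S where "S = mat n n (\<lambda>(i, j). r i * B (vs ! i) (vs ! j) / r j)"
  have S: "S \<in> carrier_mat n n" and A: "A \<in> carrier_mat n n" by (simp_all add: S_def A_eq)
  have Ssym: "transpose_mat S = S"
  proof (rule eq_matI)
    fix i j assume "i < dim_row S" "j < dim_col S"
    then have ij: "i < n" "j < n" by (auto simp: S_def)
    have "r j * r j * B (vs ! j) (vs ! i) = r i * r i * B (vs ! i) (vs ! j)"
      using rev[OF inV inV, of j i] ij by (simp add: r(2))
    then show "transpose_mat S $$ (i, j) = S $$ (i, j)"
      using ij r(1)[of i] r(1)[of j] by (simp add: S_def field_simps)
  qed (auto simp: S_def)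
  have "similar_mat S A"
  proof (rule similar_matI[of _ _ "mat_diag n r" "mat_diag n (\<lambda>k. 1 / r k)" n])
    show "{S, A, mat_diag n r, mat_diag n (\<lambda>k. 1 / r k)} \<subseteq> carrier_mat n n" using S A by auto
    have nz: "r k \<noteq> 0" if "k < n" for k using r(1)[OF that] by simp
    show "mat_diag n r * mat_diag n (\<lambda>k. 1 / r k) = 1\<^sub>m n"
      "mat_diag n (\<lambda>k. 1 / r k) * mat_diag n r = 1\<^sub>m n"
      by (subst mat_diag_mult_left[of _ _ n]; (rule eq_matI)?; use nz in \<open>auto simp: mat_diag_def\<close>)+
    show "S = mat_diag n r * A * mat_diag n (\<lambda>k. 1 / r k)"
      using A by (subst mat_diag_mult_left[OF A], subst mat_diag_mult_right[of _ n])
        (auto intro!: eq_matI simp: S_def A_eq)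
  qed
  then have cpSA: "char_poly S = char_poly A" by (rule char_poly_similar)
  obtain es0 where es0: "char_poly S = (\<Prod>e\<leftarrow>es0. [:- e, 1:])" "length es0 = n"
    using real_symmetric_char_poly_splits[OF S Ssym] .
  have "proots (char_poly A) = mset es0"
  proof -
    have "proots (\<Prod>e\<leftarrow>es0. [:- e, 1:]) = mset es0"
    proof (induct es0)
      case (Cons a es0)
      have nz: "(\<Prod>e\<leftarrow>es0. [:- e, 1:]) \<noteq> 0" by (auto simp: prod_list_zero_iff)
      show ?case using proots_mult[OF _ nz, of "[:- a, 1:]"] Cons
        by (simp add: proots_linear_factor del: mult_pCons_left)
    qed simp
    then show ?thesis using es0 cpSA by simp
  qed
  then have mset_es: "mset es = mset es0"
    unfolding es_def eigenvalue_list_def A_def by simp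
  have sorted: "sorted_wrt (\<ge>) es"
    unfolding es_def eigenvalue_list_def by (simp add: sorted_wrt_rev)
  have les: "length es = n" using mset_eq_length[OF mset_es] es0 by simp
  \<comment> \<open>The product depends only on the multiset of roots, so the sorted list may
    replace \<open>es0\<close>.\<close>
  have "(\<Prod>e\<leftarrow>es. [:- e, 1:]) = (\<Prod>e\<leftarrow>es0. [:- e, 1:])"
    by (simp only: prod_mset_prod_list[symmetric] mset_map mset_es)
  then have "char_poly S = (\<Prod>e\<leftarrow>es. [:- e, 1:])" using es0 by simp
  from real_symmetric_diagonalization[OF S Ssym this] obtain U where
    U: "U \<in> carrier_mat n n" and UU: "transpose_mat U * U = 1\<^sub>m n"
    and D: "transpose_mat U * S * U = mat_diag n (\<lambda>i. es ! i)" by blast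
  have Ut: "transpose_mat U \<in> carrier_mat n n" using U by simp
  have UU': "U * transpose_mat U = 1\<^sub>m n" by (rule mat_mult_left_right_inverse[OF Ut U UU])
  have SU: "S * U = U * mat_diag n (\<lambda>i. es ! i)"
  proof -
    have "U * (transpose_mat U * S * U) = (U * transpose_mat U) * (S * U)"
      using U Ut S by (simp add: assoc_mult_mat[of _ n n _ n _ n])
    then show ?thesis unfolding D UU' using S U by simp
  qed
  define idx where "idx = inv_into {..<n} ((!) vs)"
  have idx: "idx (vs ! k) = k" if "k < n" for k
    unfolding idx_def using that vs(1) len
    by (intro inv_into_f_f) (auto simp: inj_on_def nth_eq_iff_index_eq)
  have Vn: "\<exists>k<n. x = vs ! k" if "x \<in> V" for x
    using that vs(2) len by (metis in_set_conv_nth)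
  define u where "u i x = U $$ (idx x, i) / sqrt (m x)" for i x
  have uk: "u i (vs ! k) = U $$ (k, i) / r k" if "k < n" for i k
    using idx[OF that] by (simp add: u_def r_def)
  show "length es = card V" "sorted_wrt (\<ge>) es" using les sorted by (simp_all add: n_def)
  have "eigenbasis u" unfolding eigenbasis_def
  proof (intro conjI allI impI ballI)
    fix i x assume "i < card V" "x \<in> V"
    then obtain k where k: "k < n" "x = vs ! k" and i: "i < n" using Vn n_def by metis
    have "(\<Sum>y\<in>V. B x y * u i y) = (\<Sum>l<n. B (vs ! k) (vs ! l) * U $$ (l, i) / r l)"
      unfolding sumV k(2) by (intro sum.cong) (simp_all add: uk)
    also have "\<dots> = (\<Sum>l<n. S $$ (k, l) * U $$ (l, i)) / r k"
      unfolding sum_divide_distrib using k r(1)[OF k(1)] by (intro sum.cong) (auto simp: S_def)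
    also have "(\<Sum>l<n. S $$ (k, l) * U $$ (l, i)) = (S * U) $$ (k, i)"
      using S U k i by (simp add: scalar_prod_def lessThan_atLeast0)
    also have "\<dots> = U $$ (k, i) * es ! i"
      unfolding SU using U k i by (simp add: mat_diag_mult_right[OF U])
    finally show "(\<Sum>y\<in>V. B x y * u i y) = es ! i * u i x" using k by (simp add: uk)
  next
    fix i j assume "i < card V" "j < card V"
    then have ij: "i < n" "j < n" by (simp_all add: n_def)
    have "(\<Sum>x\<in>V. m x * u i x * u j x) = (\<Sum>k<n. U $$ (k, i) * U $$ (k, j))"
      unfolding sumV
    proof (intro sum.cong refl)
      fix k assume "k \<in> {..<n}"
      then have k: "k < n" by simp
      show "m (vs ! k) * u i (vs ! k) * u j (vs ! k) = U $$ (k, i) * U $$ (k, j)"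
        using r(1)[OF k] by (simp add: uk[OF k] r(2)[OF k, symmetric])
    qed
    also have "\<dots> = (transpose_mat U * U) $$ (i, j)"
      using U ij by (simp add: scalar_prod_def lessThan_atLeast0)
    finally show "(\<Sum>x\<in>V. m x * u i x * u j x) = (if i = j then 1 else 0)"
      unfolding UU using ij by simp
  next
    fix x y assume "x \<in> V" "y \<in> V"
    then obtain k l where k: "k < n" "x = vs ! k" and l: "l < n" "y = vs ! l" using Vn by metis
    have "(\<Sum>i<card V. u i x * u i y * m y) = (\<Sum>i<n. U $$ (k, i) * U $$ (l, i) * (r l / r k))"
      unfolding n_def[symmetric] using k l r(1)[OF l(1)]
      by (intro sum.cong) (auto simp: uk r(2)[symmetric])
    also have "\<dots> = (U * transpose_mat U) $$ (k, l) * (r l / r k)"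
      using U k l by (simp add: scalar_prod_def lessThan_atLeast0 sum_distrib_right sum_divide_distrib)
    also have "\<dots> = (if x = y then 1 else 0)"
      unfolding UU' using k l r(1)[OF k(1)] vs(1) len by (auto simp: nth_eq_iff_index_eq)
    finally show "(\<Sum>i<card V. u i x * u i y * m y) = (if x = y then 1 else 0)" .
  qed
  then show "\<exists>u. eigenbasis u" by blast
qed

definition u :: "nat \<Rightarrow> 'v \<Rightarrow> real" where
  "u = (SOME u. eigenbasis u)"

definition coord :: "('v \<Rightarrow> real) \<Rightarrow> nat \<Rightarrow> real" where
  "coord \<psi> i = (\<Sum>x\<in>V. m x * \<psi> x * u i x)"

lemma eigenbasis_u: "eigenbasis u"
  unfolding u_def using ex_eigenbasis by (rule someI_ex)

lemma eigenvector_u: "i < card V \<Longrightarrow> x \<in> V \<Longrightarrow> (\<Sum>y\<in>V. B x y * u i y) = es ! i * u i x"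
  using eigenbasis_u unfolding eigenbasis_def by blast

lemma coord_u: "i < card V \<Longrightarrow> j < card V \<Longrightarrow> coord (u i) j = (if i = j then 1 else 0)"
  using eigenbasis_u unfolding eigenbasis_def coord_def by blast

lemma complete_u: "x \<in> V \<Longrightarrow> y \<in> V \<Longrightarrow> (\<Sum>i<card V. u i x * u i y * m y) = (if x = y then 1 else 0)"
  using eigenbasis_u unfolding eigenbasis_def by blast

lemma expansion:
  assumes "x \<in> V"
  shows "\<psi> x = (\<Sum>i<card V. coord \<psi> i * u i x)"
proof -
  have "(\<Sum>i<card V. coord \<psi> i * u i x) = (\<Sum>i<card V. \<Sum>y\<in>V. \<psi> y * (u i x * u i y * m y))"
    unfolding coord_def sum_distrib_right by (intro sum.cong refl) (simp add: algebra_simps)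
  also have "\<dots> = (\<Sum>y\<in>V. \<psi> y * (\<Sum>i<card V. u i x * u i y * m y))"
    by (subst sum.swap) (simp add: sum_distrib_left)
  also have "\<dots> = (\<Sum>y\<in>V. if y = x then \<psi> y else 0)"
    using assms by (intro sum.cong refl) (auto simp: complete_u)
  also have "\<dots> = \<psi> x" using assms fin by simp
  finally show ?thesis ..
qed

lemma inner_expansion:
  assumes f: "\<And>x. x \<in> V \<Longrightarrow> f x = (\<Sum>i<card V. a i * u i x)"
  shows "(\<Sum>x\<in>V. m x * \<psi> x * f x) = (\<Sum>i<card V. coord \<psi> i * a i)"
proof -
  have "(\<Sum>x\<in>V. m x * \<psi> x * f x) = (\<Sum>x\<in>V. \<Sum>i<card V. m x * \<psi> x * u i x * a i)"
    using f by (intro sum.cong refl) (simp add: sum_distrib_left algebra_simps)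
  also have "\<dots> = (\<Sum>i<card V. coord \<psi> i * a i)"
    unfolding coord_def sum_distrib_right by (rule sum.swap)
  finally show ?thesis .
qed

lemma parseval: "(\<Sum>x\<in>V. m x * \<psi> x * \<theta> x) = (\<Sum>i<card V. coord \<psi> i * coord \<theta> i)"
  by (rule inner_expansion) (rule expansion)

lemma parseval_square: "(\<Sum>x\<in>V. m x * (\<psi> x)\<^sup>2) = (\<Sum>i<card V. (coord \<psi> i)\<^sup>2)"
  using parseval[of \<psi> \<psi>] by (simp add: power2_eq_square algebra_simps)

lemma apply_expansion:
  assumes "x \<in> V"
  shows "(\<Sum>y\<in>V. B x y * \<psi> y) = (\<Sum>i<card V. es ! i * coord \<psi> i * u i x)"
proof -
  have "(\<Sum>y\<in>V. B x y * \<psi> y) = (\<Sum>y\<in>V. \<Sum>i<card V. coord \<psi> i * (B x y * u i y))"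
    by (intro sum.cong refl, subst expansion[of _ \<psi>]) (auto simp: sum_distrib_left algebra_simps)
  also have "\<dots> = (\<Sum>i<card V. coord \<psi> i * (\<Sum>y\<in>V. B x y * u i y))"
    by (subst sum.swap) (simp add: sum_distrib_left)
  also have "\<dots> = (\<Sum>i<card V. es ! i * coord \<psi> i * u i x)"
    using assms by (intro sum.cong refl) (simp add: eigenvector_u)
  finally show ?thesis .
qed

lemma form_expansion:
  "(\<Sum>x\<in>V. m x * \<psi> x * (\<Sum>y\<in>V. B x y * \<psi> y)) = (\<Sum>i<card V. es ! i * (coord \<psi> i)\<^sup>2)"
  by (subst inner_expansion[OF apply_expansion]) (auto simp: power2_eq_square algebra_simps)

lemma es_antimono: "i \<le> j \<Longrightarrow> j < card V \<Longrightarrow> es ! j \<le> es ! i"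
  using length_es sorted_es by (cases "i = j") (auto simp: sorted_wrt_iff_nth_less)

lemma top_eigenpair:
  assumes "V \<noteq> {}"
  shows "\<exists>\<mu> \<phi>. (\<exists>x\<in>V. \<phi> x \<noteq> 0) \<and> (\<forall>x\<in>V. (\<Sum>y\<in>V. B x y * \<phi> y) = \<mu> * \<phi> x) \<and>
    (\<forall>\<psi>. (\<Sum>x\<in>V. m x * \<psi> x * (\<Sum>y\<in>V. B x y * \<psi> y)) \<le> \<mu> * (\<Sum>x\<in>V. m x * (\<psi> x)\<^sup>2))"
proof -
  have n: "0 < card V" using fin assms by (simp add: card_gt_0_iff)
  show ?thesis
  proof (intro exI[of _ "es ! 0"] exI[of _ "u 0"] conjI ballI allI)
    show "\<exists>x\<in>V. u 0 x \<noteq> 0"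
    proof (rule ccontr)
      assume "\<not> (\<exists>x\<in>V. u 0 x \<noteq> 0)"
      then have "coord (u 0) 0 = 0" unfolding coord_def by simp
      then show False using coord_u[OF n n] by simp
    qed
    show "(\<Sum>y\<in>V. B x y * u 0 y) = es ! 0 * u 0 x" if "x \<in> V" for x using eigenvector_u[OF n that] .
    show "(\<Sum>x\<in>V. m x * \<psi> x * (\<Sum>y\<in>V. B x y * \<psi> y)) \<le> es ! 0 * (\<Sum>x\<in>V. m x * (\<psi> x)\<^sup>2)" for \<psi>
      unfolding form_expansion parseval_square
      by (auto simp: sum_distrib_left intro!: sum_mono mult_right_mono es_antimono)
  qed
qed

text \<open>Courant-Fischer: the span of the first two eigenvectors contains a nonzero vector
  orthogonal to the constants, and there the form is at least the second eigenvalue times the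
  squared norm.\<close>

lemma second_eigenvalue_le:
  assumes card: "2 \<le> card V"
    and bound: "\<And>\<psi>. (\<Sum>x\<in>V. m x * \<psi> x) = 0 \<Longrightarrow>
      (\<Sum>x\<in>V. m x * \<psi> x * (\<Sum>y\<in>V. B x y * \<psi> y)) \<le> \<mu> * (\<Sum>x\<in>V. m x * (\<psi> x)\<^sup>2)"
  shows "eigenvalue_list (matrix_on V B) ! 1 \<le> \<mu>"
proof -
  define a where "a i = coord (\<lambda>_. 1) i" for i
  \<comment> \<open>A solution of \<open>\<alpha> * a 0 + \<beta> * a 1 = 0\<close>; the case
    distinction keeps it nonzero.\<close>
  define \<alpha> \<beta> where "\<alpha> = (if a 0 = 0 then 1 else a 1)" and "\<beta> = (if a 0 = 0 then 0 else - a 0)"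
  then have ab: "\<alpha> * a 0 + \<beta> * a 1 = 0" "\<alpha> \<noteq> 0 \<or> \<beta> \<noteq> 0" by auto
  define \<psi> where "\<psi> x = \<alpha> * u 0 x + \<beta> * u 1 x" for x
  have c\<psi>: "coord \<psi> i = \<alpha> * coord (u 0) i + \<beta> * coord (u 1) i" for i
    unfolding coord_def \<psi>_def by (simp add: sum.distrib sum_distrib_left algebra_simps)
  have c\<psi>': "coord \<psi> i = (if i = 0 then \<alpha> else if i = 1 then \<beta> else 0)" if "i < card V" for i
    unfolding c\<psi> using that card coord_u[of 0 i] coord_u[of 1 i] by auto
  have sum2: "(\<Sum>i<card V. f i) = f 0 + f 1" if "\<And>i. i < card V \<Longrightarrow> i \<noteq> 0 \<Longrightarrow> i \<noteq> 1 \<Longrightarrow> f i = 0"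
    for f :: "nat \<Rightarrow> real"
  proof -
    have "(\<Sum>i<card V. f i) = (\<Sum>i\<in>{0, 1}. f i)"
      by (rule sum.mono_neutral_right) (use card that in auto)
    then show ?thesis by simp
  qed
  have c01: "coord \<psi> 0 = \<alpha>" "coord \<psi> (Suc 0) = \<beta>" using c\<psi>'[of 0] c\<psi>'[of 1] card by auto
  have "(\<Sum>x\<in>V. m x * \<psi> x * 1) = (\<Sum>i<card V. coord \<psi> i * a i)"
    unfolding a_def by (rule parseval)
  also have "\<dots> = 0" using ab(1) by (subst sum2) (auto simp: c\<psi>' c01)
  finally have "(\<Sum>x\<in>V. m x * \<psi> x * (\<Sum>y\<in>V. B x y * \<psi> y)) \<le> \<mu> * (\<Sum>x\<in>V. m x * (\<psi> x)\<^sup>2)"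
    using bound by simp
  moreover have "(\<Sum>x\<in>V. m x * (\<psi> x)\<^sup>2) = \<alpha>\<^sup>2 + \<beta>\<^sup>2"
    unfolding parseval_square by (subst sum2) (auto simp: c\<psi>' c01)
  moreover have "(\<Sum>x\<in>V. m x * \<psi> x * (\<Sum>y\<in>V. B x y * \<psi> y)) = es ! 0 * \<alpha>\<^sup>2 + es ! 1 * \<beta>\<^sup>2"
    unfolding form_expansion by (subst sum2) (auto simp: c\<psi>' c01)
  moreover have "es ! 1 * \<alpha>\<^sup>2 \<le> es ! 0 * \<alpha>\<^sup>2"
    using card by (intro mult_right_mono es_antimono) auto
  ultimately have "es ! 1 * (\<alpha>\<^sup>2 + \<beta>\<^sup>2) \<le> \<mu> * (\<alpha>\<^sup>2 + \<beta>\<^sup>2)" by (simp add: algebra_simps)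
  moreover have "\<alpha>\<^sup>2 + \<beta>\<^sup>2 > 0" using ab(2) by (simp add: sum_power2_gt_zero_iff)
  ultimately show ?thesis unfolding es_def by (simp add: mult_le_cancel_right)
qed

text \<open>Constants have eigenvalue 1, while \<open>\<mu> < 1\<close> keeps all eigenvalues after
  the first below 1. Hence constants are orthogonal to every later eigenvector and are multiples of
  \<open>u 0\<close>, so a mean-zero \<psi> has no component along \<open>u 0\<close>.\<close>

lemma rayleigh_le_second_eigenvalue:
  assumes card: "2 \<le> card V"
    and stoch: "\<And>x. x \<in> V \<Longrightarrow> (\<Sum>y\<in>V. B x y) = 1"
    and le: "eigenvalue_list (matrix_on V B) ! 1 \<le> \<mu>" and "\<mu> < 1"
    and \<psi>: "(\<Sum>x\<in>V. m x * \<psi> x) = 0"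
  shows "(\<Sum>x\<in>V. m x * \<psi> x * (\<Sum>y\<in>V. B x y * \<psi> y)) \<le> \<mu> * (\<Sum>x\<in>V. m x * (\<psi> x)\<^sup>2)"
proof -
  define a where "a i = coord (\<lambda>_. 1) i" for i
  have es_le: "es ! i \<le> \<mu>" if "1 \<le> i" "i < card V" for i
  proof -
    have "es ! i \<le> es ! 1" using that by (intro es_antimono) auto
    then show ?thesis using le by (simp add: es_def)
  qed
  have a0: "a i = 0" if i: "1 \<le> i" "i < card V" for i
  proof -
    have "(\<Sum>x\<in>V. m x * (\<Sum>y\<in>V. B x y * u i y)) = es ! i * a i"
      unfolding a_def coord_def sum_distrib_left
      by (intro sum.cong refl) (simp add: eigenvector_u[OF i(2)] sum_distrib_left[symmetric] algebra_simps)
    moreover have "(\<Sum>x\<in>V. m x * (\<Sum>y\<in>V. B x y * u i y)) = a i"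
    proof -
      have "(\<Sum>x\<in>V. m x * (\<Sum>y\<in>V. B x y * u i y)) = (\<Sum>x\<in>V. \<Sum>y\<in>V. m y * B y x * u i y)"
        unfolding sum_distrib_left by (intro sum.cong refl) (simp add: rev mult.assoc[symmetric])
      also have "\<dots> = (\<Sum>y\<in>V. \<Sum>x\<in>V. m y * B y x * u i y)" by (rule sum.swap)
      also have "\<dots> = (\<Sum>y\<in>V. m y * (\<Sum>x\<in>V. B y x) * u i y)"
        by (simp add: sum_distrib_left sum_distrib_right)
      finally show ?thesis unfolding a_def coord_def by (simp add: stoch)
    qed
    ultimately have "(es ! i - 1) * a i = 0" by (simp add: algebra_simps)
    then show ?thesis using es_le[OF i] \<open>\<mu> < 1\<close> by auto
  qed
  have split: "(\<Sum>i<card V. f i) = f 0 + (\<Sum>i\<in>{1..<card V}. f i)" for f :: "nat \<Rightarrow> real"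
    using card by (simp add: lessThan_atLeast0 sum.atLeast_Suc_lessThan)
  have "(\<Sum>x\<in>V. m x * 1 * 1) = (\<Sum>i<card V. a i * a i)" unfolding a_def by (rule parseval)
  also have "\<dots> = a 0 * a 0" unfolding split by (simp add: a0)
  finally have "a 0 * a 0 = (\<Sum>x\<in>V. m x)" by simp
  moreover have "V \<noteq> {}" using card by auto
  ultimately have "a 0 \<noteq> 0" using sum_pos[OF fin _ m] by force
  moreover have "(\<Sum>x\<in>V. m x * \<psi> x * 1) = (\<Sum>i<card V. coord \<psi> i * a i)" unfolding a_def by (rule parseval)
  then have "coord \<psi> 0 * a 0 = 0" unfolding split using \<psi> by (simp add: a0)
  ultimately have c0: "coord \<psi> 0 = 0" by simp
  show ?thesis unfolding form_expansion parseval_square split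
    by (auto simp: c0 sum_distrib_left intro!: sum_mono mult_right_mono es_le)
qed

end

section \<open>Weights determined by degrees\<close>

definition harm_sum :: "nat \<Rightarrow> real" where
  "harm_sum n = (\<Sum>j=1..n. 1 / real j)"

lemma harm_sum_0 [simp]: "harm_sum 0 = 0"
  and harm_sum_Suc: "harm_sum (Suc n) = harm_sum n + 1 / real (Suc n)"
  unfolding harm_sum_def by auto

lemma harm_sum_nonneg: "0 \<le> harm_sum n"
  unfolding harm_sum_def by (intro sum_nonneg) auto

lemma harm_sum_le: "1 \<le> n \<Longrightarrow> harm_sum n \<le> 1 + ln (real n)"
proof (induct n rule: nat_induct_at_least)
  case (Suc n)
  have "ln (real n / real (Suc n)) \<le> real n / real (Suc n) - 1"
    using Suc by (intro ln_le_minus_one) auto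
  then have "1 / real (Suc n) \<le> ln (real (Suc n)) - ln (real n)"
    using Suc by (simp add: ln_div field_simps)
  then show ?case using Suc by (simp add: harm_sum_Suc)
qed (simp add: harm_sum_def)

locale degree_bound =
  fixes \<delta> \<gamma> :: real and D :: nat and V :: "nat set" and adj :: "nat \<Rightarrow> nat \<Rightarrow> bool"
  assumes \<delta>: "0 < \<delta>" "\<delta> < 1" and \<gamma>: "0 < \<gamma>" and D: "1 \<le> D"
    and \<gamma>_log: "\<gamma> \<le> \<delta>\<^sup>2 / (10 * (1 + ln (real D)))"
    and \<gamma>_lin: "\<gamma> \<le> (1 - \<delta>) / (real D + ln (real D))"
    and finite_V: "finite V" and adj_sym: "adj i j \<Longrightarrow> adj j i" and adj_irrefl: "\<not> adj i i"
    and degree: "i \<in> V \<Longrightarrow> card {j \<in> V. adj i j} \<le> D"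
begin

lemma lnD: "0 \<le> ln (real D)"
  using D by simp

lemma \<gamma>_log': "\<gamma> * (1 + ln (real D)) \<le> \<delta>\<^sup>2 / 10"
  using \<gamma>_log lnD by (simp add: pos_le_divide_eq field_simps)

lemma \<gamma>_lin': "\<gamma> * (real D + ln (real D)) \<le> 1 - \<delta>"
  using \<gamma>_lin lnD D by (simp add: pos_le_divide_eq)

lemma \<delta>_square: "\<delta>\<^sup>2 \<le> \<delta>"
  using \<delta> by (simp add: power2_eq_square)

lemma \<gamma>_le: "\<gamma> \<le> \<delta> / 10"
proof -
  have "\<gamma> * 1 \<le> \<gamma> * (1 + ln (real D))" using \<gamma> lnD by (intro mult_left_mono) auto
  then show ?thesis using \<gamma>_log' \<delta>_square by linarith
qed

lemma harm_sum_le_D: "m \<le> D \<Longrightarrow> harm_sum (m - 1) \<le> 1 + ln (real D)"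
proof (cases "2 \<le> m")
  case True
  assume "m \<le> D"
  then have "ln (real (m - 1)) \<le> ln (real D)" using True by simp
  then show ?thesis using harm_sum_le[of "m - 1"] True by linarith
next
  case False
  then have "m - 1 = 0" by simp
  then show ?thesis using lnD by simp
qed

text \<open>With \<open>L = leaf\<close>, the recursion at a leaf whose neighbour has degree \<open>m\<close> is
  \<open>(m - 1) (L m - L (m - 1)) \<ge> (L m)\<^sup>2\<close>. It forces a harmonic sum, hence the logarithm of the maximal degree.\<close>

definition leaf :: "nat \<Rightarrow> real" where
  "leaf m = \<gamma> * (1 + 13 / 10 * \<gamma> * harm_sum (m - 1))"

text \<open>Dominates \<open>leaf m\<close> for all \<open>m \<le> D\<close>, because
  \<open>\<gamma> * harm_sum (m - 1)\<close> is at most \<open>\<delta>\<^sup>2 / 10\<close>; it is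
  also the value from which \<open>inner\<close> starts.\<close>

definition \<gamma>1 :: real where
  "\<gamma>1 = \<gamma> * (1 + 13 / 100 * \<delta>\<^sup>2)"

lemma leaf_ge: "\<gamma> \<le> leaf m"
  using \<gamma> harm_sum_nonneg[of "m - 1"] by (simp add: leaf_def)

lemma leaf_1: "m \<le> 1 \<Longrightarrow> leaf m = \<gamma>"
  by (simp add: leaf_def)

lemma leaf_le: "m \<le> D \<Longrightarrow> leaf m \<le> \<gamma>1"
proof -
  assume "m \<le> D"
  then have "\<gamma> * harm_sum (m - 1) \<le> \<gamma> * (1 + ln (real D))"
    using \<gamma> harm_sum_le_D by (intro mult_left_mono) auto
  then have "13 / 10 * \<gamma> * harm_sum (m - 1) \<le> 13 / 100 * \<delta>\<^sup>2" using \<gamma>_log' by simp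
  then show ?thesis unfolding leaf_def \<gamma>1_def using \<gamma> by (intro mult_left_mono) auto
qed

lemma \<gamma>1: "0 < \<gamma>1" "\<gamma>1 \<le> 113 / 100 * \<gamma>" "\<gamma> \<le> \<gamma>1"
proof -
  have "\<gamma> * (1 + 13 / 100 * \<delta>\<^sup>2) \<le> \<gamma> * (113 / 100)"
    using \<gamma> \<delta> \<delta>_square by (intro mult_left_mono) auto
  then show "\<gamma>1 \<le> 113 / 100 * \<gamma>" by (simp add: \<gamma>1_def)
  show "0 < \<gamma>1" unfolding \<gamma>1_def using \<gamma> by (intro mult_pos_pos add_pos_nonneg) auto
  show "\<gamma> \<le> \<gamma>1" unfolding \<gamma>1_def using \<gamma> by simp
qed

text \<open>One step of the harmonic sum makes the right-hand side exactly
  \<open>13 / 10 * \<gamma>\<^sup>2\<close>. The constant is self-consistent: it keeps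
  \<open>leaf m\<close> below 1.13 \<gamma>, and 1.13 squared is below 1.3.\<close>

lemma leaf_rec:
  assumes "2 \<le> m" "m \<le> D"
  shows "(leaf m)\<^sup>2 \<le> (real m - 1) * (leaf m - leaf (m - 1))"
proof -
  obtain n where n: "m = Suc (Suc n)" using assms(1) by (metis Suc_le_D numeral_2_eq_2 Suc_le_mono)
  have "0 \<le> leaf m" using leaf_ge[of m] \<gamma> by simp
  then have "(leaf m)\<^sup>2 \<le> (113 / 100 * \<gamma>)\<^sup>2"
    using leaf_le[OF assms(2)] \<gamma>1(2) by (intro power_mono) auto
  also have "\<dots> \<le> 13 / 10 * \<gamma>\<^sup>2" by (simp add: power2_eq_square)
  also have "\<dots> = (real m - 1) * (leaf m - leaf (m - 1))"
    unfolding leaf_def n by (simp add: harm_sum_Suc power2_eq_square field_simps)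
  finally show ?thesis .
qed

text \<open>With \<open>inner m = m / u\<^sub>m\<close>, the recursion at a vertex of degree \<open>m \<ge> 2\<close> becomes
  \<open>u\<^bsub>m - 1\<^esub> (u\<^sub>m - r) \<ge> u\<^sub>m\<^sup>2\<close> for \<open>r = m / (m - 1)\<close>. A decrement \<open>u\<^bsub>m - 1\<^esub> - u\<^sub>m\<close> slightly above \<open>r\<close> suffices because
  \<open>\<delta> u\<^sub>m \<ge> 10\<close>. The start \<open>u\<^sub>1 = 1 / \<gamma>1\<close> dominates every leaf.\<close>

definition recip :: "nat \<Rightarrow> real" where
  "recip m = 1 / \<gamma>1 - (1 + \<delta> / 4) * (real m - 1 + harm_sum (m - 1))"

definition inner :: "nat \<Rightarrow> real" where
  "inner m = real m / recip m"

text \<open>The second hypothesis on \<gamma> has its shape from here: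
  \<open>m - 1 + harm_sum (m - 1)\<close> is at most \<open>D + ln D\<close>, which leaves a margin
  \<delta>. A quarter of the margin pays for the factor \<open>1 + \<delta> / 4\<close>; the
  quadratic terms more than cover the loss from \<gamma> to \<open>\<gamma>1\<close>.\<close>

lemma recip_ge:
  assumes "1 \<le> m" "m \<le> D"
  shows "3 / 4 * \<delta> \<le> \<gamma> * recip m"
proof -
  have "real m - 1 + harm_sum (m - 1) \<le> real D + ln (real D)"
    using harm_sum_le_D[OF assms(2)] assms by linarith
  then have "\<gamma> * (real m - 1 + harm_sum (m - 1)) \<le> 1 - \<delta>"
    using mult_left_mono[of _ _ \<gamma>] \<gamma> \<gamma>_lin' by (meson less_imp_le order_trans)
  then have "(1 + \<delta> / 4) * (\<gamma> * (real m - 1 + harm_sum (m - 1))) \<le> (1 + \<delta> / 4) * (1 - \<delta>)"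
    using \<delta> by (intro mult_left_mono) auto
  moreover have "1 - 13 / 100 * \<delta>\<^sup>2 \<le> \<gamma> / \<gamma>1"
  proof -
    have "(1 - a) * (1 + a) \<le> 1" for a :: real
      using zero_le_square[of a] by (simp add: algebra_simps)
    moreover have "0 < 1 + 13 / 100 * \<delta>\<^sup>2" by (rule add_pos_nonneg) auto
    ultimately have "1 - 13 / 100 * \<delta>\<^sup>2 \<le> 1 / (1 + 13 / 100 * \<delta>\<^sup>2)"
      by (simp add: pos_le_divide_eq)
    then show ?thesis unfolding \<gamma>1_def using \<gamma> by simp
  qed
  ultimately have "1 - 13 / 100 * \<delta>\<^sup>2 - (1 + \<delta> / 4) * (1 - \<delta>) \<le> \<gamma> * recip m"
    unfolding recip_def by (simp add: algebra_simps)
  moreover have "3 / 4 * \<delta> \<le> 1 - 13 / 100 * \<delta>\<^sup>2 - (1 + \<delta> / 4) * (1 - \<delta>)"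
    using zero_le_square[of \<delta>] by (simp add: power2_eq_square field_simps)
  ultimately show ?thesis by linarith
qed

lemma recip_pos: "1 \<le> m \<Longrightarrow> m \<le> D \<Longrightarrow> 0 < recip m"
proof -
  assume "1 \<le> m" "m \<le> D"
  then have "0 < \<gamma> * recip m" using recip_ge[of m] \<delta> by linarith
  then show ?thesis using \<gamma> by (simp add: zero_less_mult_iff)
qed

lemma inner_1: "inner 1 = \<gamma>1"
  using \<gamma>1 by (simp add: inner_def recip_def)

lemma inner_le:
  assumes "1 \<le> m" "m \<le> D"
  shows "inner m \<le> real m * (4 / 3 * (\<gamma> / \<delta>))"
proof -
  have "1 / recip m \<le> 4 / 3 * (\<gamma> / \<delta>)"
    using recip_ge[OF assms] recip_pos[OF assms] \<delta> by (simp add: field_simps)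
  then have "real m * (1 / recip m) \<le> real m * (4 / 3 * (\<gamma> / \<delta>))" by (intro mult_left_mono) auto
  then show ?thesis by (simp only: inner_def times_divide_eq_right mult_1_right)
qed

lemma inner_nonneg: "1 \<le> m \<Longrightarrow> m \<le> D \<Longrightarrow> 0 \<le> inner m"
  unfolding inner_def using recip_pos[of m] by simp

lemma recip_large:
  assumes "2 \<le> m" "m \<le> D"
  shows "10 \<le> \<delta> * recip m"
proof -
  \<comment> \<open>Since \<open>D \<ge> 2\<close>, the factor \<open>1 + ln D\<close> is at least
    4/3, which cancels the 3/4 of \<open>recip_ge\<close>. The constant 10 of the first hypothesis
    on \<gamma> then reappears unchanged.\<close>
  have "ln (1 / 2 :: real) \<le> 1 / 2 - 1" by (rule ln_le_minus_one) simp
  moreover have "ln 2 \<le> ln (real D)" using assms by simp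
  ultimately have "4 / 3 \<le> 1 + ln (real D)" by (simp add: ln_div)
  then have "\<gamma> * (4 / 3) \<le> \<gamma> * (1 + ln (real D))" using \<gamma> by (intro mult_left_mono) auto
  then have "\<gamma> * 10 \<le> 3 / 4 * \<delta>\<^sup>2" using \<gamma>_log' by linarith
  also have "\<dots> = \<delta> * (3 / 4 * \<delta>)" by (simp add: power2_eq_square)
  also have "\<dots> \<le> \<delta> * (\<gamma> * recip m)" using recip_ge[of m] assms \<delta> by (intro mult_left_mono) auto
  finally show ?thesis using \<gamma> by (simp add: mult.left_commute)
qed

lemma inner_rec:
  assumes "2 \<le> m" "m \<le> D"
  shows "real m * inner (m - 1) + (inner m)\<^sup>2 \<le> (real m - 1) * inner m"
proof -
  define u r where "u = recip m" and "r = real m / (real m - 1)"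
  define u1 where "u1 = recip (m - 1)"
  obtain n where n: "m = Suc (Suc n)" using assms(1) by (metis Suc_le_D numeral_2_eq_2 Suc_le_mono)
  have u1: "u1 = u + (1 + \<delta> / 4) * r"
  proof -
    have "r = 1 + 1 / real (Suc n)" by (simp add: r_def n field_simps)
    then show ?thesis
      unfolding u1_def u_def recip_def n by (simp add: harm_sum_Suc algebra_simps)
  qed
  have r: "0 < r" "r \<le> 2" "r * (real m - 1) = real m" using assms by (auto simp: r_def field_simps)
  have u: "10 \<le> \<delta> * u" unfolding u_def by (rule recip_large[OF assms])
  have u0: "0 < u" "0 < u1" unfolding u_def u1_def using recip_pos assms by auto
  \<comment> \<open>As \<open>r \<le> 2\<close> and \<open>\<delta> < 1\<close>, the left side is at
    most 5/2, a quarter of the lower bound 10 for \<open>\<delta> * u\<close>.\<close>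
  have "(1 + \<delta> / 4) * r \<le> (1 + \<delta> / 4) * 2" using r \<delta> by (intro mult_left_mono) auto
  then have "(1 + \<delta> / 4) * r \<le> \<delta> / 4 * u" using u \<delta> by simp
  then have "r * ((1 + \<delta> / 4) * r) \<le> r * (\<delta> / 4 * u)" using r by (intro mult_left_mono) auto
  then have *: "u\<^sup>2 \<le> u1 * (u - r)" unfolding u1 by (simp add: power2_eq_square algebra_simps)
  have "1 / u1 \<le> (u - r) / u\<^sup>2" using * u0 by (simp add: field_simps)
  also have "\<dots> = 1 / u - r / u\<^sup>2" using u0 by (simp add: power2_eq_square field_simps)
  finally have "real m * (real m - 1) * (1 / u1) \<le> real m * (real m - 1) * (1 / u - r / u\<^sup>2)"
    using assms by (intro mult_left_mono) auto
  also have "\<dots> = (real m - 1) * (real m / u) - real m * (r * (real m - 1)) / u\<^sup>2"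
    by (simp add: right_diff_distrib mult.assoc mult.left_commute mult.commute diff_divide_distrib)
  also have "\<dots> = (real m - 1) * inner m - (inner m)\<^sup>2"
    unfolding r(3) inner_def u_def by (simp add: power2_eq_square)
  finally show ?thesis unfolding inner_def[of "m - 1"] u1_def[symmetric] using assms by (simp add: of_nat_diff)
qed

section \<open>The weights of the types in a set and their recursion\<close>

definition nbs :: "nat set \<Rightarrow> nat \<Rightarrow> nat set" where
  "nbs S i = {j \<in> S. adj i j}"

definition weight :: "nat set \<Rightarrow> nat \<Rightarrow> real" where
  "weight S i =
    (if card (nbs S i) = 0 then 0
     else if card (nbs S i) = 1 then leaf (card (nbs S (the_elem (nbs S i))))
     else inner (card (nbs S i)))"

lemma nbs_subset: "nbs S i \<subseteq> S"
  unfolding nbs_def by auto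

lemma finite_nbs: "S \<subseteq> V \<Longrightarrow> finite (nbs S i)"
  using finite_subset[OF _ finite_V] nbs_subset by (meson finite_subset)

lemma card_nbs_le_D: "S \<subseteq> V \<Longrightarrow> i \<in> S \<Longrightarrow> card (nbs S i) \<le> D"
proof -
  assume "S \<subseteq> V" "i \<in> S"
  then have "card (nbs S i) \<le> card {j \<in> V. adj i j}"
    using finite_V by (intro card_mono) (auto simp: nbs_def)
  also have "\<dots> \<le> D" using degree \<open>S \<subseteq> V\<close> \<open>i \<in> S\<close> by blast
  finally show ?thesis .
qed

lemma card_nbs_le: "S \<subseteq> V \<Longrightarrow> i \<in> S \<Longrightarrow> card (nbs S i) \<le> card S - 1"
proof -
  assume S: "S \<subseteq> V" "i \<in> S"
  then have fin: "finite S" using finite_V finite_subset by blast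
  have "card (nbs S i) \<le> card (S - {i})"
    using fin adj_irrefl by (intro card_mono) (auto simp: nbs_def)
  then show ?thesis using S fin by simp
qed

lemma nbs_remove: "nbs (S - {l}) i = nbs S i - {l}"
  unfolding nbs_def by auto

lemma nbs_remove_other: "\<not> adj i l \<Longrightarrow> nbs (S - {l}) i = nbs S i"
  unfolding nbs_def by auto

lemma weight_le_\<gamma>1:
  assumes "S \<subseteq> V" "i \<in> S" "card (nbs S i) = 1"
  shows "\<gamma> \<le> weight S i" "weight S i \<le> \<gamma>1"
proof -
  obtain l where l: "nbs S i = {l}" using assms(3) card_1_singletonE by blast
  then have "l \<in> S" using nbs_subset by blast
  then show "weight S i \<le> \<gamma>1" "\<gamma> \<le> weight S i"
    unfolding weight_def using assms l leaf_le card_nbs_le_D leaf_ge by auto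
qed

lemma weight_le_inner:
  assumes "S \<subseteq> V" "i \<in> S" "1 \<le> card (nbs S i)"
  shows "weight S i \<le> inner (card (nbs S i))"
  using weight_le_\<gamma>1(2)[OF assms(1,2)] inner_1 assms(3) by (cases "card (nbs S i) = 1") (auto simp: weight_def)

lemma weight_nonneg: "S \<subseteq> V \<Longrightarrow> i \<in> S \<Longrightarrow> 0 \<le> weight S i"
  using weight_le_\<gamma>1(1)[of S i] \<gamma> inner_nonneg[of "card (nbs S i)"] card_nbs_le_D[of S i]
  by (cases "card (nbs S i) = 0 \<or> card (nbs S i) = 1") (auto simp: weight_def)

text \<open>The two entries of the minimum serve the two cases of
  \<open>expansion_bound\<close>.\<close>

lemma weight_le:
  assumes "S \<subseteq> V" "i \<in> S"
  shows "weight S i \<le> real (min D (card S - 1)) * (4 / 3 * (\<gamma> / \<delta>))"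
proof (cases "card (nbs S i) = 0")
  case True
  then show ?thesis using \<gamma> \<delta> by (simp add: weight_def)
next
  case False
  then have "weight S i \<le> inner (card (nbs S i))" using weight_le_inner[OF assms] by simp
  also have "\<dots> \<le> real (card (nbs S i)) * (4 / 3 * (\<gamma> / \<delta>))"
    using False card_nbs_le_D[OF assms] by (intro inner_le) auto
  also have "\<dots> \<le> real (min D (card S - 1)) * (4 / 3 * (\<gamma> / \<delta>))"
    using card_nbs_le_D[OF assms] card_nbs_le[OF assms] \<gamma> \<delta> by (intro mult_right_mono) auto
  finally show ?thesis .
qed

text \<open>Since \<gamma> is at most \<delta>/10, the factor in \<open>weight_le\<close> is at most
  2/15. The fraction 1/5 is the range in which \<open>trickle_down\<close> can exclude the large
  solutions.\<close>

lemma weight_range: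
  assumes "S \<subseteq> V" "i \<in> S" "2 \<le> card S"
  shows "0 \<le> weight S i \<and> weight S i \<le> (real (card S) - 1) / 5"
proof -
  have "\<gamma> / \<delta> \<le> 1 / 10" using \<gamma>_le \<delta> by (simp add: field_simps)
  then have "real (min D (card S - 1)) * (4 / 3 * (\<gamma> / \<delta>)) \<le> (real (card S) - 1) * (1 / 5)"
    using assms(3) \<gamma> \<delta> by (intro mult_mono) (auto simp: of_nat_diff)
  then show ?thesis using weight_le[OF assms(1,2)] weight_nonneg[OF assms(1,2)] by simp
qed

text \<open>In a pair a neighbour has degree 1, so no harmonic term occurs. For \<open>k = 2\<close>
  the general estimate \<open>weight_le\<close> is too weak for the constant 2.\<close>

lemma weight_pair_le:
  assumes "S \<subseteq> V" "i \<in> S" "card S = 2"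
  shows "weight S i \<le> \<gamma>"
proof -
  have "card (nbs S j) \<le> 1" if "j \<in> S" for j using card_nbs_le[OF assms(1) that] assms(3) by simp
  moreover have "the_elem (nbs S i) \<in> S" if "card (nbs S i) = 1"
    using that nbs_subset[of S i] by (metis card_1_singletonE insert_subset the_elem_eq)
  ultimately show ?thesis using assms(2) leaf_1 \<gamma> unfolding weight_def
    by (smt (verit, ccfv_SIG) le_neq_implies_less less_one)
qed

lemma weight_edge: "i \<noteq> j \<Longrightarrow> adj i j \<Longrightarrow> weight {i, j} i = \<gamma>"
proof -
  assume "i \<noteq> j" "adj i j"
  then have "nbs {i, j} i = {j}" "nbs {i, j} j = {i}" using adj_sym adj_irrefl by (auto simp: nbs_def)
  then show ?thesis by (simp add: weight_def leaf_1)
qed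

text \<open>A weight sees only the neighbours of \<open>i\<close> and, at a leaf, the neighbours of
  the neighbour.\<close>

lemma weight_remove_far:
  assumes "\<not> adj i l" "\<And>j. j \<in> nbs S i \<Longrightarrow> \<not> adj j l"
  shows "weight (S - {l}) i = weight S i"
proof -
  have eq: "nbs (S - {l}) i = nbs S i" by (rule nbs_remove_other[OF assms(1)])
  have "nbs (S - {l}) (the_elem (nbs S i)) = nbs S (the_elem (nbs S i))" if "card (nbs S i) = 1"
  proof (rule nbs_remove_other, rule assms(2))
    show "the_elem (nbs S i) \<in> nbs S i" using that by (metis card_1_singletonE insertI1 the_elem_eq)
  qed
  then show ?thesis unfolding weight_def eq by simp
qed

lemma weight_rec:
  assumes S: "S \<subseteq> V" and card_S: "3 \<le> card S" and i: "i \<in> S"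
    and no_iso: "\<And>l. l \<in> S \<Longrightarrow> nbs S i = {l} \<Longrightarrow> nbs S l \<noteq> {i}"
  shows "(\<Sum>l\<in>S - {i}. weight (S - {l}) i) \<le> (real (card S) - 2) * weight S i - (weight S i)\<^sup>2"
proof -
  define k where "k = real (card S)"
  have fin: "finite S" using S finite_V finite_subset by blast
  have card_Si: "real (card (S - {i})) = k - 1" using i fin card_S by (simp add: k_def of_nat_diff)
  define m where "m = card (nbs S i)"
  have mD: "m \<le> D" unfolding m_def by (rule card_nbs_le_D[OF S i])
  have sub: "nbs S i \<subseteq> S - {i}" using adj_irrefl by (auto simp: nbs_def)
  have fin_nbs: "finite (nbs S j)" for j by (rule finite_nbs[OF S])
  consider "m = 0" | "m = 1" | "2 \<le> m" by linarith
  then show ?thesis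
  proof cases
    case 1
    then have "nbs S i = {}" using fin_nbs by (simp add: m_def)
    then have "weight (S - {l}) i = 0" for l by (simp add: weight_def nbs_remove)
    then show ?thesis using 1 by (simp add: weight_def m_def)
  next
    case 2
    then obtain l0 where l0: "nbs S i = {l0}" unfolding m_def using card_1_singletonE by blast
    then have l0': "l0 \<in> S" "adj i l0" "l0 \<noteq> i" using sub by (auto simp: nbs_def)
    define m' where "m' = card (nbs S l0)"
    have i_nb: "i \<in> nbs S l0" using adj_sym[OF l0'(2)] i by (simp add: nbs_def)
    \<comment> \<open>Degree 1 on both sides would be an isolated edge, where no removal creates
      slack.\<close>
    have "m' \<noteq> 1"
    proof
      assume "m' = 1"
      then obtain z where "nbs S l0 = {z}" unfolding m'_def using card_1_singletonE by blast
      then show False using no_iso[OF l0'(1) l0] i_nb by auto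
    qed
    moreover have "m' \<noteq> 0" using i_nb fin_nbs[of l0] by (auto simp: m'_def)
    ultimately have m': "2 \<le> m'" by simp
    have m'D: "m' \<le> D" unfolding m'_def by (rule card_nbs_le_D[OF S l0'(1)])
    have w: "weight S i = leaf m'" using 2 l0 by (simp add: weight_def m_def m'_def)
    have w_l: "weight (S - {l}) i
        = leaf m' - (if l \<in> nbs S l0 - {i} then leaf m' - leaf (m' - 1) else 0)"
      if l: "l \<in> S - {i} - {l0}" for l
    proof -
      have "nbs (S - {l}) i = {l0}" unfolding nbs_remove l0 using l by auto
      moreover have "card (nbs (S - {l}) l0) = (if l \<in> nbs S l0 then m' - 1 else m')"
        unfolding nbs_remove m'_def using fin_nbs by simp
      ultimately show ?thesis using l by (simp add: weight_def)
    qed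
    \<comment> \<open>Without its neighbour \<open>i\<close> is isolated, which leaves
      \<open>k - 2\<close> terms. Each of the \<open>m' - 1\<close> other neighbours of
      \<open>l0\<close> saves the difference \<open>leaf m' - leaf (m' - 1)\<close>.\<close>
    have "weight (S - {l0}) i = 0" by (simp add: weight_def nbs_remove l0)
    then have "(\<Sum>l\<in>S - {i}. weight (S - {l}) i) = (\<Sum>l\<in>S - {i} - {l0}. weight (S - {l}) i)"
      using l0' fin by (subst sum.remove[of _ l0]) auto
    also have "\<dots> = (\<Sum>l\<in>S - {i} - {l0}. leaf m')
        - (\<Sum>l\<in>S - {i} - {l0}. if l \<in> nbs S l0 - {i} then leaf m' - leaf (m' - 1) else 0)"
      unfolding sum_subtractf[symmetric] using w_l by (intro sum.cong refl) auto
    also have "(\<Sum>l\<in>S - {i} - {l0}. if l \<in> nbs S l0 - {i} then leaf m' - leaf (m' - 1) else 0)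
        = (\<Sum>l\<in>nbs S l0 - {i}. leaf m' - leaf (m' - 1))"
      using fin adj_irrefl by (intro sum.mono_neutral_cong_right) (auto simp: nbs_def)
    also have "\<dots> = (real m' - 1) * (leaf m' - leaf (m' - 1))"
      using i_nb fin_nbs m' by (simp add: m'_def of_nat_diff)
    also have "(\<Sum>l\<in>S - {i} - {l0}. leaf m') = (k - 2) * leaf m'"
      using l0' i fin card_S by (simp add: k_def of_nat_diff card_Diff_singleton)
    finally show ?thesis unfolding w k_def[symmetric] using leaf_rec[OF m' m'D] by linarith
  next
    case 3
    have w: "weight S i = inner m" using 3 by (simp add: weight_def m_def)
    \<comment> \<open>Only an inequality: for \<open>m = 2\<close> the removal of a neighbour turns
      \<open>i\<close> into a leaf, whose weight is at most \<open>inner 1\<close>.\<close>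
    have w_l: "weight (S - {l}) i \<le> inner m - (if l \<in> nbs S i then inner m - inner (m - 1) else 0)"
      if l: "l \<in> S - {i}" for l
    proof (cases "l \<in> nbs S i")
      case True
      then have "card (nbs (S - {l}) i) = m - 1" unfolding nbs_remove m_def using fin_nbs by simp
      moreover have "S - {l} \<subseteq> V" "i \<in> S - {l}" "1 \<le> m - 1" using S i l 3 by auto
      ultimately show ?thesis using weight_le_inner[of "S - {l}" i] True by simp
    next
      case False
      then have "nbs (S - {l}) i = nbs S i" unfolding nbs_remove by simp
      then show ?thesis using False 3 by (simp add: weight_def m_def)
    qed
    have "(\<Sum>l\<in>S - {i}. weight (S - {l}) i)
        \<le> (\<Sum>l\<in>S - {i}. inner m - (if l \<in> nbs S i then inner m - inner (m - 1) else 0))"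
      by (rule sum_mono) (rule w_l)
    also have "\<dots> = (k - 1) * inner m - (\<Sum>l\<in>S - {i}. if l \<in> nbs S i then inner m - inner (m - 1) else 0)"
      unfolding sum_subtractf using card_Si by simp
    also have "(\<Sum>l\<in>S - {i}. if l \<in> nbs S i then inner m - inner (m - 1) else 0)
        = (\<Sum>l\<in>nbs S i. inner m - inner (m - 1))"
      using fin sub by (intro sum.mono_neutral_cong_right) auto
    also have "\<dots> = real m * (inner m - inner (m - 1))" by (simp add: m_def)
    finally show ?thesis unfolding w k_def[symmetric] using inner_rec[OF 3 mD]
      by (simp add: algebra_simps)
  qed
qed

lemma weight_le_expansion_bound:
  assumes S: "S \<subseteq> V" and i: "i \<in> S" and card_S: "2 \<le> card S"
  shows "weight S i \<le> (real (card S) - 1) * expansion_bound 2 \<delta> D (card S)"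
proof -
  define k where "k = real (card S)"
  have k: "2 \<le> k" using card_S by (simp add: k_def)
  have "1 \<le> real D" using D by simp
  then have pos: "0 < real D + ln (real D)" using lnD by linarith
  show ?thesis
  proof (cases "D \<le> card S")
    case True
    have B: "(real (card S) - 1) * expansion_bound 2 \<delta> D (card S) = (2 * (k - 1) / k) * ((1 - \<delta>) / \<delta>)"
      using True unfolding expansion_bound_def k_def by simp (simp add: algebra_simps)
    have D\<gamma>: "real D * \<gamma> \<le> 1 - \<delta>"
      using \<gamma>_lin' lnD \<gamma> by (simp add: algebra_simps) (smt (verit) mult_nonneg_nonneg)
    show ?thesis
    proof (cases "card S = 2")
      case True
      have "1 * \<gamma> \<le> real D * \<gamma>" using D \<gamma> by (intro mult_right_mono) auto
      then have "\<gamma> \<le> (1 - \<delta>) / 1" using D\<gamma> by simp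
      also have "\<dots> \<le> (1 - \<delta>) / \<delta>" using \<delta> by (intro divide_left_mono) auto
      finally show ?thesis unfolding B using weight_pair_le[OF S i True] True by (simp add: k_def)
    next
      case False
      then have k3: "3 \<le> k" using card_S by (simp add: k_def)
      have "weight S i \<le> real (min D (card S - 1)) * (4 / 3 * (\<gamma> / \<delta>))" by (rule weight_le[OF S i])
      also have "\<dots> \<le> real D * (4 / 3 * (\<gamma> / \<delta>))" using \<gamma> \<delta> by (intro mult_right_mono) auto
      also have "\<dots> = 4 / 3 * ((real D * \<gamma>) / \<delta>)" by simp
      also have "\<dots> \<le> 4 / 3 * ((1 - \<delta>) / \<delta>)"
        using D\<gamma> \<delta> by (intro mult_left_mono divide_right_mono) auto
      \<comment> \<open>Equality at \<open>k = 3\<close>: here the constant 2 is used up.\<close>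
      also have "\<dots> \<le> (2 * (k - 1) / k) * ((1 - \<delta>) / \<delta>)"
        using k3 \<delta> by (intro mult_right_mono) (auto simp: field_simps)
      finally show ?thesis unfolding B .
    qed
  next
    case False
    have B: "(real (card S) - 1) * expansion_bound 2 \<delta> D (card S)
        = (k - 1) * (2 * ((1 - \<delta>) / (real D + ln (real D))) * ((k + ln k) / k) / \<delta>)"
      using False unfolding expansion_bound_def k_def by simp
    have "weight S i \<le> real (min D (card S - 1)) * (4 / 3 * (\<gamma> / \<delta>))" by (rule weight_le[OF S i])
    also have "\<dots> \<le> (k - 1) * (4 / 3 * (\<gamma> / \<delta>))"
      using \<gamma> \<delta> card_S by (intro mult_right_mono) (auto simp: k_def of_nat_diff)
    also have "\<dots> \<le> (k - 1) * (2 * ((1 - \<delta>) / (real D + ln (real D))) * ((k + ln k) / k) / \<delta>)"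
    proof (rule mult_left_mono)
      have "1 \<le> (k + ln k) / k" using k by (simp add: field_simps)
      then have "(4 / 3 * \<gamma>) * 1 \<le> (2 * ((1 - \<delta>) / (real D + ln (real D)))) * ((k + ln k) / k)"
        using \<gamma>_lin \<gamma> pos \<delta> by (intro mult_mono) auto
      then have "(4 / 3 * \<gamma>) / \<delta> \<le> 2 * ((1 - \<delta>) / (real D + ln (real D))) * ((k + ln k) / k) / \<delta>"
        using \<delta> by (intro divide_right_mono) auto
      then show "4 / 3 * (\<gamma> / \<delta>) \<le> 2 * ((1 - \<delta>) / (real D + ln (real D))) * ((k + ln k) / k) / \<delta>" by simp
    qed (use k in simp)
    finally show ?thesis unfolding B .
  qed
qed

end

section \<open>Conditional expectations on a partite complex\<close>

locale weighted_partite =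
  fixes d :: nat and T :: "nat \<Rightarrow> 'v set" and X :: "'v set set" and w :: "'v set \<Rightarrow> real"
  assumes weighted: "weighted_partite_complex d T X w"
begin

lemma partite: "partite_complex d T X"
  using weighted unfolding weighted_partite_complex_def by blast

lemma simplicial: "simplicial_complex X"
  using partite unfolding partite_complex_def pure_complex_def by blast

lemma down_closed: "\<sigma> \<in> X \<Longrightarrow> \<tau> \<subseteq> \<sigma> \<Longrightarrow> \<tau> \<in> X"
  using simplicial unfolding simplicial_complex_def by blast

lemma finite_complex: "finite X"
proof -
  have "X \<subseteq> Pow (\<Union>X)" by blast
  moreover have "finite (\<Union>X)" using simplicial unfolding simplicial_complex_def by blast
  ultimately show ?thesis using finite_subset by blast
qed

lemma finite_face: "\<tau> \<in> X \<Longrightarrow> finite \<tau>"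
  using simplicial unfolding simplicial_complex_def by (meson Union_upper finite_subset)

lemma finite_facets: "finite (facets X)"
  using finite_complex unfolding facets_def by simp

lemma facet_face: "\<sigma> \<in> facets X \<Longrightarrow> \<sigma> \<in> X"
  unfolding facets_def by blast

lemma card_facet: "\<sigma> \<in> facets X \<Longrightarrow> card \<sigma> = d + 1"
  using partite unfolding partite_complex_def pure_complex_def by blast

lemma face_in_facet:
  assumes "\<tau> \<in> X"
  shows "\<exists>\<sigma>\<in>facets X. \<tau> \<subseteq> \<sigma>"
proof -
  obtain \<sigma> where "\<sigma> \<in> X" "\<tau> \<subseteq> \<sigma>" "\<forall>\<sigma>'\<in>X. \<sigma> \<subseteq> \<sigma>' \<longrightarrow> \<sigma> = \<sigma>'"
    using finite_has_maximal2[OF finite_complex assms] by blast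
  then have "\<sigma> \<in> facets X" by (auto simp: facets_def)
  then show ?thesis using \<open>\<tau> \<subseteq> \<sigma>\<close> by blast
qed

lemma weight_pos: "\<sigma> \<in> facets X \<Longrightarrow> w \<sigma> > 0"
  using weighted unfolding weighted_partite_complex_def facet_distribution_def by blast

lemma types_disjoint: "i \<le> d \<Longrightarrow> j \<le> d \<Longrightarrow> x \<in> T i \<Longrightarrow> x \<in> T j \<Longrightarrow> i = j"
  using partite unfolding partite_complex_def disjoint_family_on_def by blast

lemma types_cover: "(\<Union>i\<le>d. T i) = vertices X"
  using partite unfolding partite_complex_def by blast

lemma finite_type: "i \<le> d \<Longrightarrow> finite (T i)"
proof -
  assume "i \<le> d"
  then have "T i \<subseteq> vertices X" using types_cover by blast
  moreover have "vertices X \<subseteq> \<Union>X" unfolding vertices_def by blast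
  moreover have "finite (\<Union>X)" using simplicial unfolding simplicial_complex_def by blast
  ultimately show ?thesis by (meson finite_subset)
qed

section \<open>Facets as points of a product of the types\<close>

definition crd :: "nat \<Rightarrow> 'v set \<Rightarrow> 'v" where
  "crd i \<sigma> = the_elem (\<sigma> \<inter> T i)"

lemma facet_inter_type: "\<sigma> \<in> facets X \<Longrightarrow> i \<le> d \<Longrightarrow> \<sigma> \<inter> T i = {crd i \<sigma>}"
  using partite unfolding partite_complex_def crd_def
  by (metis card_1_singletonE the_elem_eq)

lemma crd_mem: "\<sigma> \<in> facets X \<Longrightarrow> i \<le> d \<Longrightarrow> crd i \<sigma> \<in> \<sigma>"
  and crd_type: "\<sigma> \<in> facets X \<Longrightarrow> i \<le> d \<Longrightarrow> crd i \<sigma> \<in> T i"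
  by (drule (1) facet_inter_type, blast)+

lemma crd_eqI: "\<sigma> \<in> facets X \<Longrightarrow> i \<le> d \<Longrightarrow> x \<in> \<sigma> \<Longrightarrow> x \<in> T i \<Longrightarrow> crd i \<sigma> = x"
  by (metis IntI facet_inter_type singletonD)

lemma face_vertex_type: "\<tau> \<in> X \<Longrightarrow> x \<in> \<tau> \<Longrightarrow> \<exists>i\<le>d. x \<in> T i"
proof -
  assume "\<tau> \<in> X" "x \<in> \<tau>"
  then have "{x} \<in> X" using down_closed by blast
  then have "x \<in> vertices X" by (simp add: vertices_def)
  then show ?thesis using types_cover by blast
qed

definition ev :: "'v set \<Rightarrow> 'v set set" where
  "ev \<tau> = {\<sigma> \<in> facets X. \<tau> \<subseteq> \<sigma>}"

text \<open>The probability that a random facet contains \<tau>. It is 0 unless \<tau> is a face, so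
  sums may run over all vertices of a type with no side condition.\<close>

definition W :: "'v set \<Rightarrow> real" where
  "W \<tau> = (\<Sum>\<sigma>\<in>ev \<tau>. w \<sigma>)"

lemma finite_ev: "finite (ev \<tau>)"
  unfolding ev_def using finite_facets by simp

lemma ev_facet: "\<sigma> \<in> ev \<tau> \<Longrightarrow> \<sigma> \<in> facets X" and ev_subset: "\<sigma> \<in> ev \<tau> \<Longrightarrow> \<tau> \<subseteq> \<sigma>"
  unfolding ev_def by auto

lemma ev_nonempty: "\<tau> \<in> X \<longleftrightarrow> ev \<tau> \<noteq> {}"
proof
  assume "\<tau> \<in> X"
  then show "ev \<tau> \<noteq> {}" using face_in_facet[of \<tau>] by (auto simp: ev_def)
next
  assume "ev \<tau> \<noteq> {}"
  then show "\<tau> \<in> X" using facet_face down_closed by (auto simp: ev_def)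
qed

lemma W_pos: "\<tau> \<in> X \<Longrightarrow> W \<tau> > 0"
  unfolding W_def using ev_nonempty[of \<tau>] by (intro sum_pos finite_ev weight_pos) (auto simp: ev_def)

lemma W_zero: "\<tau> \<notin> X \<Longrightarrow> W \<tau> = 0"
  unfolding W_def using ev_nonempty[of \<tau>] by simp

lemma W_nonneg: "W \<tau> \<ge> 0"
  using W_pos W_zero by (cases "\<tau> \<in> X") (auto simp: less_imp_le)

lemma ev_insert: "x \<in> T i \<Longrightarrow> i \<le> d \<Longrightarrow> ev (insert x \<tau>) = {\<sigma> \<in> ev \<tau>. crd i \<sigma> = x}"
  unfolding ev_def using crd_mem crd_eqI by blast

lemma sum_ev_partition:
  assumes "i \<le> d"
  shows "(\<Sum>\<sigma>\<in>ev \<tau>. f \<sigma>) = (\<Sum>x\<in>T i. \<Sum>\<sigma>\<in>ev (insert x \<tau>). f \<sigma>)"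
proof -
  have "(\<Sum>x\<in>T i. \<Sum>\<sigma>\<in>{\<sigma> \<in> ev \<tau>. crd i \<sigma> = x}. f \<sigma>) = (\<Sum>\<sigma>\<in>ev \<tau>. f \<sigma>)"
    by (rule sum.group) (use finite_ev finite_type[OF assms] crd_type[OF ev_facet] assms in auto)
  then show ?thesis using assms by (simp add: ev_insert)
qed

section \<open>Conditional expectation and variance given a face\<close>

definition E :: "'v set \<Rightarrow> ('v set \<Rightarrow> real) \<Rightarrow> real" where
  "E \<tau> f = (\<Sum>\<sigma>\<in>ev \<tau>. w \<sigma> * f \<sigma>) / W \<tau>"

definition Var :: "'v set \<Rightarrow> ('v set \<Rightarrow> real) \<Rightarrow> real" where
  "Var \<tau> f = E \<tau> (\<lambda>\<sigma>. (f \<sigma>)\<^sup>2) - (E \<tau> f)\<^sup>2"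

lemma W_E: "W \<tau> * E \<tau> f = (\<Sum>\<sigma>\<in>ev \<tau>. w \<sigma> * f \<sigma>)"
  unfolding E_def using W_pos[of \<tau>] ev_nonempty[of \<tau>] by (cases "\<tau> \<in> X") auto

lemma E_cong: "(\<And>\<sigma>. \<sigma> \<in> ev \<tau> \<Longrightarrow> f \<sigma> = g \<sigma>) \<Longrightarrow> E \<tau> f = E \<tau> g"
  unfolding E_def by simp

lemma E_add: "E \<tau> (\<lambda>\<sigma>. f \<sigma> + g \<sigma>) = E \<tau> f + E \<tau> g"
  unfolding E_def by (simp add: algebra_simps sum.distrib add_divide_distrib)

lemma E_cmult: "E \<tau> (\<lambda>\<sigma>. c * f \<sigma>) = c * E \<tau> f"
  unfolding E_def by (simp add: sum_distrib_left algebra_simps)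

lemma E_diff: "E \<tau> (\<lambda>\<sigma>. f \<sigma> - g \<sigma>) = E \<tau> f - E \<tau> g"
  unfolding E_def by (simp add: algebra_simps sum_subtractf diff_divide_distrib)

lemma E_sum: "E \<tau> (\<lambda>\<sigma>. \<Sum>i\<in>A. f i \<sigma>) = (\<Sum>i\<in>A. E \<tau> (f i))"
  unfolding E_def by (simp add: sum_distrib_left sum.swap[of _ _ A] sum_divide_distrib)

lemma E_const: "\<tau> \<in> X \<Longrightarrow> E \<tau> (\<lambda>_. c) = c"
  unfolding E_def using W_pos[of \<tau>] by (simp add: W_def flip: sum_distrib_right)

lemma E_mono: "(\<And>\<sigma>. \<sigma> \<in> ev \<tau> \<Longrightarrow> f \<sigma> \<le> g \<sigma>) \<Longrightarrow> E \<tau> f \<le> E \<tau> g"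
  unfolding E_def using W_nonneg[of \<tau>] weight_pos[OF ev_facet]
  by (intro divide_right_mono sum_mono mult_left_mono) (auto simp: less_imp_le)

lemma E_nonneg: "(\<And>\<sigma>. \<sigma> \<in> ev \<tau> \<Longrightarrow> 0 \<le> f \<sigma>) \<Longrightarrow> 0 \<le> E \<tau> f"
  using E_mono[of \<tau> "\<lambda>_. 0" f] by (simp add: E_def)

lemma E_eq_0_D:
  assumes "\<And>\<sigma>. \<sigma> \<in> ev \<tau> \<Longrightarrow> 0 \<le> f \<sigma>" "E \<tau> f \<le> 0" "\<sigma> \<in> ev \<tau>"
  shows "f \<sigma> = 0"
proof -
  have nn: "0 \<le> w \<sigma> * f \<sigma>" if "\<sigma> \<in> ev \<tau>" for \<sigma>
    using assms(1)[OF that] weight_pos[OF ev_facet[OF that]] by simp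
  have "(\<Sum>\<sigma>\<in>ev \<tau>. w \<sigma> * f \<sigma>) \<le> 0"
    using assms(2) W_nonneg[of \<tau>] unfolding W_E[symmetric] by (simp add: mult_nonneg_nonpos)
  moreover have "0 \<le> (\<Sum>\<sigma>\<in>ev \<tau>. w \<sigma> * f \<sigma>)" by (rule sum_nonneg[OF nn])
  ultimately have "(\<Sum>\<sigma>\<in>ev \<tau>. w \<sigma> * f \<sigma>) = 0" by simp
  then have "w \<sigma> * f \<sigma> = 0"
    using sum_nonneg_0[of "ev \<tau>" "\<lambda>\<sigma>. w \<sigma> * f \<sigma>"] finite_ev nn assms(3) by blast
  then show ?thesis using weight_pos[OF ev_facet[OF assms(3)]] by simp
qed

lemma E_insert_mult:
  assumes "x \<in> T i" "i \<le> d"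
  shows "E (insert x \<tau>) (\<lambda>\<sigma>. h (crd i \<sigma>) * f \<sigma>) = h x * E (insert x \<tau>) f"
  unfolding E_cmult[symmetric] by (rule E_cong) (use ev_insert[OF assms] in auto)

lemma E_insert_crd:
  assumes "insert x \<tau> \<in> X" "x \<in> T i" "i \<le> d"
  shows "E (insert x \<tau>) (\<lambda>\<sigma>. h (crd i \<sigma>)) = h x"
  using E_insert_mult[OF assms(2,3), of \<tau> h "\<lambda>_. 1"] E_const[OF assms(1)] by simp

lemma tower_sum:
  assumes "i \<le> d"
  shows "W \<tau> * E \<tau> f = (\<Sum>x\<in>T i. W (insert x \<tau>) * E (insert x \<tau>) f)"
  unfolding W_E by (rule sum_ev_partition[OF assms])

lemma W_E_crd:
  assumes "i \<le> d"
  shows "W \<tau> * E \<tau> (\<lambda>\<sigma>. h (crd i \<sigma>)) = (\<Sum>x\<in>T i. W (insert x \<tau>) * h x)"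
  unfolding tower_sum[OF assms, of \<tau>]
proof (intro sum.cong refl)
  fix x assume "x \<in> T i"
  then show "W (insert x \<tau>) * E (insert x \<tau>) (\<lambda>\<sigma>. h (crd i \<sigma>)) = W (insert x \<tau>) * h x"
    using assms by (cases "insert x \<tau> \<in> X") (auto simp: W_zero E_insert_crd)
qed

lemma tower:
  assumes "i \<le> d"
  shows "E \<tau> f = E \<tau> (\<lambda>\<sigma>. E (insert (crd i \<sigma>) \<tau>) f)"
proof (cases "\<tau> \<in> X")
  case True
  have "W \<tau> * E \<tau> f = W \<tau> * E \<tau> (\<lambda>\<sigma>. E (insert (crd i \<sigma>) \<tau>) f)"
    unfolding W_E_crd[OF assms, of \<tau> "\<lambda>x. E (insert x \<tau>) f"] by (rule tower_sum[OF assms])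
  then show ?thesis using W_pos[OF True] by simp
qed (simp add: E_def W_zero)

lemma tower_mult:
  assumes "i \<le> d"
  shows "E \<tau> (\<lambda>\<sigma>. h (crd i \<sigma>) * f \<sigma>) = E \<tau> (\<lambda>\<sigma>. h (crd i \<sigma>) * E (insert (crd i \<sigma>) \<tau>) f)"
  unfolding tower[OF assms, of \<tau> "\<lambda>\<sigma>. h (crd i \<sigma>) * f \<sigma>"]
  by (rule E_cong) (use E_insert_mult[OF crd_type[OF ev_facet]] assms in auto)

lemma total_variance:
  assumes "i \<le> d"
  shows "Var \<tau> f = E \<tau> (\<lambda>\<sigma>. Var (insert (crd i \<sigma>) \<tau>) f) + Var \<tau> (\<lambda>\<sigma>. E (insert (crd i \<sigma>) \<tau>) f)"
  unfolding Var_def E_diff tower[OF assms, of \<tau> f, symmetric]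
    tower[OF assms, of \<tau> "\<lambda>\<sigma>. (f \<sigma>)\<^sup>2", symmetric] by simp

lemma insert_crd_face: "\<sigma> \<in> ev \<tau> \<Longrightarrow> i \<le> d \<Longrightarrow> insert (crd i \<sigma>) \<tau> \<in> X"
  using down_closed[of \<sigma> "insert (crd i \<sigma>) \<tau>"] facet_face crd_mem by (simp add: ev_def)

lemma Var_cong: "(\<And>\<sigma>. \<sigma> \<in> ev \<tau> \<Longrightarrow> f \<sigma> = g \<sigma>) \<Longrightarrow> Var \<tau> f = Var \<tau> g"
  unfolding Var_def using E_cong[of \<tau> f g] E_cong[of \<tau> "\<lambda>\<sigma>. (f \<sigma>)\<^sup>2" "\<lambda>\<sigma>. (g \<sigma>)\<^sup>2"] by simp

lemma Var_shift:
  assumes "\<tau> \<in> X"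
  shows "Var \<tau> (\<lambda>\<sigma>. f \<sigma> + c) = Var \<tau> f"
proof -
  have "E \<tau> (\<lambda>\<sigma>. (f \<sigma> + c)\<^sup>2) = E \<tau> (\<lambda>\<sigma>. (f \<sigma>)\<^sup>2 + (2 * c * f \<sigma> + c\<^sup>2))"
    by (rule E_cong) (simp add: power2_eq_square algebra_simps)
  then show ?thesis unfolding Var_def E_add E_cmult E_const[OF assms]
    by (simp add: power2_eq_square algebra_simps)
qed

lemma Var_alt:
  assumes "\<tau> \<in> X"
  shows "Var \<tau> f = E \<tau> (\<lambda>\<sigma>. (f \<sigma> - E \<tau> f)\<^sup>2)"
proof -
  have "Var \<tau> f = Var \<tau> (\<lambda>\<sigma>. f \<sigma> + (- E \<tau> f))" by (rule Var_shift[OF assms, symmetric])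
  moreover have "E \<tau> (\<lambda>\<sigma>. f \<sigma> + (- E \<tau> f)) = 0"
    unfolding E_add E_const[OF assms] by simp
  ultimately show ?thesis unfolding Var_def by simp
qed

lemma Var_nonneg: "\<tau> \<in> X \<Longrightarrow> 0 \<le> Var \<tau> f"
  unfolding Var_alt by (rule E_nonneg) simp

lemma Var_le_square: "Var \<tau> f \<le> E \<tau> (\<lambda>\<sigma>. (f \<sigma>)\<^sup>2)"
  unfolding Var_def by simp

section \<open>Missing types and the vertices of a link\<close>

definition missing :: "'v set \<Rightarrow> nat set" where
  "missing \<tau> = {i. i \<le> d \<and> \<tau> \<inter> T i = {}}"

lemma finite_missing: "finite (missing \<tau>)" and missing_le: "i \<in> missing \<tau> \<Longrightarrow> i \<le> d"
  unfolding missing_def by auto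

lemma face_inter_type:
  assumes "\<tau> \<in> X" "i \<le> d" "i \<notin> missing \<tau>"
  shows "card (\<tau> \<inter> T i) = 1"
proof -
  obtain \<sigma> where \<sigma>: "\<sigma> \<in> facets X" "\<tau> \<subseteq> \<sigma>" using face_in_facet assms(1) by blast
  then have "\<tau> \<inter> T i \<subseteq> {crd i \<sigma>}" using facet_inter_type assms(2) by blast
  moreover have "\<tau> \<inter> T i \<noteq> {}" using assms by (simp add: missing_def)
  ultimately have "\<tau> \<inter> T i = {crd i \<sigma>}" by blast
  then show ?thesis by simp
qed

lemma face_type_missing: "\<tau> \<in> X \<Longrightarrow> face_type d T \<tau> = {..d} - missing \<tau>"
  using face_inter_type unfolding face_type_def by (auto simp: missing_def)

lemma crd_inj: "\<sigma> \<in> facets X \<Longrightarrow> inj_on (\<lambda>i. crd i \<sigma>) {..d}"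
  using crd_type types_disjoint by (intro inj_onI) (metis atMost_iff)

lemma facet_minus_face:
  assumes "\<sigma> \<in> ev \<tau>"
  shows "\<sigma> - \<tau> = (\<lambda>i. crd i \<sigma>) ` missing \<tau>"
proof (intro subset_antisym subsetI)
  fix x assume x: "x \<in> \<sigma> - \<tau>"
  then obtain i where i: "i \<le> d" "x \<in> T i"
    using face_vertex_type[OF facet_face[OF ev_facet[OF assms]]] by blast
  then have "crd i \<sigma> = x" using crd_eqI[OF ev_facet[OF assms]] x by blast
  moreover have "i \<in> missing \<tau>"
  proof -
    have "\<tau> \<inter> T i \<subseteq> \<sigma> \<inter> T i" using ev_subset[OF assms] by blast
    then have "\<tau> \<inter> T i \<subseteq> {x}" using facet_inter_type[OF ev_facet[OF assms] i(1)] calculation by simp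
    then show ?thesis using x i(1) by (auto simp: missing_def)
  qed
  ultimately show "x \<in> (\<lambda>i. crd i \<sigma>) ` missing \<tau>" by blast
next
  fix x assume "x \<in> (\<lambda>i. crd i \<sigma>) ` missing \<tau>"
  then show "x \<in> \<sigma> - \<tau>" using crd_mem[OF ev_facet[OF assms]] crd_type[OF ev_facet[OF assms]]
    unfolding missing_def by blast
qed

lemma card_missing:
  assumes "\<tau> \<in> X"
  shows "card (missing \<tau>) = codim d \<tau>"
proof -
  obtain \<sigma> where \<sigma>: "\<sigma> \<in> ev \<tau>" using assms ev_nonempty by blast
  have "card (missing \<tau>) = card (\<sigma> - \<tau>)"
    unfolding facet_minus_face[OF \<sigma>]
    by (rule card_image[symmetric], rule inj_on_subset[OF crd_inj[OF ev_facet[OF \<sigma>]]])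
      (use missing_le in auto)
  also have "\<dots> = d + 1 - card \<tau>"
    using card_facet[OF ev_facet[OF \<sigma>]] ev_subset[OF \<sigma>] finite_face[OF assms]
    by (simp add: card_Diff_subset)
  finally show ?thesis unfolding codim_def .
qed

definition N :: "'v set \<Rightarrow> 'v set" where
  "N \<tau> = {x. x \<notin> \<tau> \<and> insert x \<tau> \<in> X}"

lemma finite_N: "finite (N \<tau>)"
proof -
  have "N \<tau> \<subseteq> \<Union>X" unfolding N_def by blast
  moreover have "finite (\<Union>X)" using simplicial unfolding simplicial_complex_def by blast
  ultimately show ?thesis using finite_subset by blast
qed

lemma N_face: "x \<in> N \<tau> \<Longrightarrow> insert x \<tau> \<in> X"
  unfolding N_def by blast

lemma N_type:
  assumes "x \<in> N \<tau>"
  obtains i where "i \<in> missing \<tau>" "i \<le> d" "x \<in> T i"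
proof -
  obtain \<sigma> where \<sigma>: "\<sigma> \<in> ev (insert x \<tau>)" using N_face[OF assms] ev_nonempty by blast
  then have "x \<in> \<sigma> - \<tau>" "\<sigma> \<in> ev \<tau>" using assms unfolding ev_def N_def by auto
  then obtain i where "i \<in> missing \<tau>" "x = crd i \<sigma>" using facet_minus_face by blast
  then show ?thesis using that crd_type[OF ev_facet[OF \<sigma>]] missing_le by blast
qed

lemma N_iff: "i \<in> missing \<tau> \<Longrightarrow> x \<in> T i \<Longrightarrow> x \<in> N \<tau> \<longleftrightarrow> insert x \<tau> \<in> X"
  unfolding N_def missing_def by blast

lemma crd_N: "\<sigma> \<in> ev \<tau> \<Longrightarrow> i \<in> missing \<tau> \<Longrightarrow> crd i \<sigma> \<in> N \<tau>"
  using N_iff crd_type[OF ev_facet] insert_crd_face missing_le by blast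

lemma missing_insert:
  assumes "i \<le> d" "x \<in> T i"
  shows "missing (insert x \<tau>) = missing \<tau> - {i}"
  using assms types_disjoint unfolding missing_def by blast

lemma sum_N:
  assumes "\<And>x. insert x \<tau> \<notin> X \<Longrightarrow> g x = 0"
  shows "(\<Sum>x\<in>N \<tau>. g x) = (\<Sum>i\<in>missing \<tau>. \<Sum>x\<in>T i. g x)"
proof -
  have "(\<Sum>x\<in>N \<tau>. g x) = (\<Sum>x\<in>(\<Union>i\<in>missing \<tau>. T i). g x)"
  proof (rule sum.mono_neutral_left)
    show "finite (\<Union>i\<in>missing \<tau>. T i)" using finite_missing finite_type missing_le by blast
    show "N \<tau> \<subseteq> (\<Union>i\<in>missing \<tau>. T i)" using N_type by blast
    show "\<forall>x\<in>(\<Union>i\<in>missing \<tau>. T i) - N \<tau>. g x = 0" using N_iff assms by blast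
  qed
  also have "\<dots> = (\<Sum>i\<in>missing \<tau>. \<Sum>x\<in>T i. g x)"
    by (rule sum.UNION_disjoint) (use finite_missing finite_type missing_le types_disjoint in blast)+
  finally show ?thesis .
qed

abbreviation site_sum :: "nat set \<Rightarrow> (nat \<Rightarrow> 'v \<Rightarrow> real) \<Rightarrow> 'v set \<Rightarrow> real" where
  "site_sum A \<phi> \<sigma> \<equiv> \<Sum>i\<in>A. \<phi> i (crd i \<sigma>)"

text \<open>The choice \<open>\<tau>' = \<tau>\<close> gives means over the vertices of the link;
  \<open>\<tau>' = insert x \<tau>\<close> gives the row of \<open>x\<close> in the walk, up to the
  diagonal.\<close>

lemma sum_N_W:
  assumes "\<tau> \<subseteq> \<tau>'"
  shows "(\<Sum>x\<in>N \<tau>. W (insert x \<tau>') * \<psi> x) = W \<tau>' * E \<tau>' (site_sum (missing \<tau>) (\<lambda>_. \<psi>))"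
proof -
  have "(\<Sum>x\<in>N \<tau>. W (insert x \<tau>') * \<psi> x) = (\<Sum>i\<in>missing \<tau>. \<Sum>x\<in>T i. W (insert x \<tau>') * \<psi> x)"
  proof (rule sum_N)
    fix x assume "insert x \<tau> \<notin> X"
    then have "insert x \<tau>' \<notin> X" using down_closed insert_mono[OF assms] by blast
    then show "W (insert x \<tau>') * \<psi> x = 0" by (simp add: W_zero)
  qed
  also have "\<dots> = (\<Sum>i\<in>missing \<tau>. W \<tau>' * E \<tau>' (\<lambda>\<sigma>. \<psi> (crd i \<sigma>)))"
    by (intro sum.cong refl W_E_crd[symmetric] missing_le)
  also have "\<dots> = W \<tau>' * E \<tau>' (site_sum (missing \<tau>) (\<lambda>_. \<psi>))"
    by (simp add: E_sum sum_distrib_left)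
  finally show ?thesis .
qed

lemma sum_N_square:
  "(\<Sum>x\<in>N \<tau>. W (insert x \<tau>) * (\<psi> x)\<^sup>2) = W \<tau> * (\<Sum>i\<in>missing \<tau>. E \<tau> (\<lambda>\<sigma>. (\<psi> (crd i \<sigma>))\<^sup>2))"
  using sum_N_W[of \<tau> \<tau> "\<lambda>x. (\<psi> x)\<^sup>2"] by (simp add: E_sum)

lemma sum_N_E:
  "(\<Sum>x\<in>N \<tau>. W (insert x \<tau>) * \<psi> x * E (insert x \<tau>) f)
    = W \<tau> * E \<tau> (\<lambda>\<sigma>. site_sum (missing \<tau>) (\<lambda>_. \<psi>) \<sigma> * f \<sigma>)"
proof -
  have "(\<Sum>x\<in>N \<tau>. W (insert x \<tau>) * (\<psi> x * E (insert x \<tau>) f))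
    = W \<tau> * (\<Sum>i\<in>missing \<tau>. E \<tau> (\<lambda>\<sigma>. \<psi> (crd i \<sigma>) * E (insert (crd i \<sigma>) \<tau>) f))"
    using sum_N_W[of \<tau> \<tau> "\<lambda>x. \<psi> x * E (insert x \<tau>) f"] by (simp add: E_sum)
  also have "\<dots> = W \<tau> * (\<Sum>i\<in>missing \<tau>. E \<tau> (\<lambda>\<sigma>. \<psi> (crd i \<sigma>) * f \<sigma>))"
    using tower_mult[symmetric, OF missing_le] by (intro arg_cong2[of _ _ _ _ times] refl sum.cong) auto
  also have "\<dots> = W \<tau> * E \<tau> (\<lambda>\<sigma>. site_sum (missing \<tau>) (\<lambda>_. \<psi>) \<sigma> * f \<sigma>)"
    by (simp add: sum_distrib_right E_sum)
  finally show ?thesis by (simp add: mult.assoc)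
qed


section \<open>Links and their walks\<close>

text \<open>Lets a family of functions, one for each type, be merged into one function on the
  vertices.\<close>

definition ty :: "'v \<Rightarrow> nat" where
  "ty x = (THE i. i \<le> d \<and> x \<in> T i)"

lemma ty_eq: "i \<le> d \<Longrightarrow> x \<in> T i \<Longrightarrow> ty x = i"
  unfolding ty_def using types_disjoint by (intro the_equality) blast+

lemma ty_crd: "\<sigma> \<in> facets X \<Longrightarrow> i \<le> d \<Longrightarrow> ty (crd i \<sigma>) = i"
  using ty_eq crd_type by blast

section \<open>Variance bounds for sums of functions of single vertices\<close>

text \<open>Uncorrelated types would contribute the factor 1, so \<open>g i\<close> measures the
  excess. On functions centred on each type it says that the covariance operator is at most the
  diagonal operator \<open>1 + g i\<close>. One value per type is what lets the bound follow the
  degrees.\<close>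

definition var_bound :: "'v set \<Rightarrow> (nat \<Rightarrow> real) \<Rightarrow> bool" where
  "var_bound \<tau> g \<longleftrightarrow> (\<forall>\<phi>. Var \<tau> (site_sum (missing \<tau>) \<phi>)
      \<le> (\<Sum>i\<in>missing \<tau>. (1 + g i) * Var \<tau> (\<lambda>\<sigma>. \<phi> i (crd i \<sigma>))))"

lemma var_boundD: "var_bound \<tau> g \<Longrightarrow> Var \<tau> (site_sum (missing \<tau>) \<phi>)
      \<le> (\<Sum>i\<in>missing \<tau>. (1 + g i) * Var \<tau> (\<lambda>\<sigma>. \<phi> i (crd i \<sigma>)))"
  unfolding var_bound_def by blast

lemma var_bound_mono:
  assumes "\<tau> \<in> X" "var_bound \<tau> g" "\<And>i. i \<in> missing \<tau> \<Longrightarrow> g i \<le> h i"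
  shows "var_bound \<tau> h"
  unfolding var_bound_def
proof
  fix \<phi>
  note var_boundD[OF assms(2), of \<phi>]
  also have "(\<Sum>i\<in>missing \<tau>. (1 + g i) * Var \<tau> (\<lambda>\<sigma>. \<phi> i (crd i \<sigma>)))
      \<le> (\<Sum>i\<in>missing \<tau>. (1 + h i) * Var \<tau> (\<lambda>\<sigma>. \<phi> i (crd i \<sigma>)))"
    using assms(3) Var_nonneg[OF assms(1)] by (intro sum_mono mult_right_mono) auto
  finally show "Var \<tau> (site_sum (missing \<tau>) \<phi>)
      \<le> (\<Sum>i\<in>missing \<tau>. (1 + h i) * Var \<tau> (\<lambda>\<sigma>. \<phi> i (crd i \<sigma>)))" .
qed

text \<open>Variances ignore constants, so each \<open>\<phi> i\<close> may be replaced by its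
  deviation from the mean; by \<open>ty\<close> the deviations form a single \<psi>.\<close>

lemma var_boundI_centred:
  assumes \<tau>: "\<tau> \<in> X"
    and *: "\<And>\<psi>. (\<And>i. i \<in> missing \<tau> \<Longrightarrow> E \<tau> (\<lambda>\<sigma>. \<psi> (crd i \<sigma>)) = 0) \<Longrightarrow>
      Var \<tau> (site_sum (missing \<tau>) (\<lambda>_. \<psi>))
        \<le> (\<Sum>i\<in>missing \<tau>. (1 + g i) * E \<tau> (\<lambda>\<sigma>. (\<psi> (crd i \<sigma>))\<^sup>2))"
  shows "var_bound \<tau> g"
  unfolding var_bound_def
proof
  fix \<phi> :: "nat \<Rightarrow> 'v \<Rightarrow> real"
  define c where "c i = E \<tau> (\<lambda>\<sigma>. \<phi> i (crd i \<sigma>))" for i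
  define \<psi> where "\<psi> x = \<phi> (ty x) x - c (ty x)" for x
  have \<psi>: "\<psi> (crd i \<sigma>) = \<phi> i (crd i \<sigma>) - c i" if "\<sigma> \<in> ev \<tau>" "i \<in> missing \<tau>" for i \<sigma>
    using ty_crd[OF ev_facet missing_le] that by (simp add: \<psi>_def)
  have centred: "E \<tau> (\<lambda>\<sigma>. \<psi> (crd i \<sigma>)) = 0" if "i \<in> missing \<tau>" for i
  proof -
    have "E \<tau> (\<lambda>\<sigma>. \<psi> (crd i \<sigma>)) = E \<tau> (\<lambda>\<sigma>. \<phi> i (crd i \<sigma>) - c i)"
      using \<psi> that by (intro E_cong) auto
    then show ?thesis unfolding E_diff E_const[OF \<tau>] by (simp add: c_def)
  qed
  have "Var \<tau> (site_sum (missing \<tau>) \<phi>)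
      = Var \<tau> (\<lambda>\<sigma>. site_sum (missing \<tau>) (\<lambda>_. \<psi>) \<sigma> + (\<Sum>i\<in>missing \<tau>. c i))"
    using \<psi> by (intro Var_cong) (simp add: sum.distrib[symmetric])
  also have "\<dots> = Var \<tau> (site_sum (missing \<tau>) (\<lambda>_. \<psi>))" by (rule Var_shift[OF \<tau>])
  also have "\<dots> \<le> (\<Sum>i\<in>missing \<tau>. (1 + g i) * E \<tau> (\<lambda>\<sigma>. (\<psi> (crd i \<sigma>))\<^sup>2))"
    by (rule *) (rule centred)
  also have "\<dots> = (\<Sum>i\<in>missing \<tau>. (1 + g i) * Var \<tau> (\<lambda>\<sigma>. \<phi> i (crd i \<sigma>)))"
  proof (intro sum.cong refl)
    fix i assume i: "i \<in> missing \<tau>"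
    have "E \<tau> (\<lambda>\<sigma>. (\<psi> (crd i \<sigma>))\<^sup>2) = Var \<tau> (\<lambda>\<sigma>. \<phi> i (crd i \<sigma>))"
      unfolding Var_alt[OF \<tau>] c_def[symmetric] using \<psi> i by (intro E_cong) auto
    then show "(1 + g i) * E \<tau> (\<lambda>\<sigma>. (\<psi> (crd i \<sigma>))\<^sup>2) = (1 + g i) * Var \<tau> (\<lambda>\<sigma>. \<phi> i (crd i \<sigma>))"
      by simp
  qed
  finally show "Var \<tau> (site_sum (missing \<tau>) \<phi>)
      \<le> (\<Sum>i\<in>missing \<tau>. (1 + g i) * Var \<tau> (\<lambda>\<sigma>. \<phi> i (crd i \<sigma>)))" .
qed

section \<open>The walk of a link through conditional expectations\<close>

lemma vertices_link: "vertices (link X \<tau>) = N \<tau>"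
proof -
  have "{v} \<in> link X \<tau> \<longleftrightarrow> v \<in> N \<tau>" for v
  proof
    assume "{v} \<in> link X \<tau>"
    then obtain \<sigma> where "\<sigma> \<in> X" "\<tau> \<subseteq> \<sigma>" "{v} = \<sigma> - \<tau>" unfolding link_def by blast
    moreover then have "\<sigma> = insert v \<tau>" by blast
    ultimately show "v \<in> N \<tau>" unfolding N_def by blast
  next
    assume "v \<in> N \<tau>"
    then have "insert v \<tau> \<in> X" "{v} = insert v \<tau> - \<tau>" unfolding N_def by auto
    then show "{v} \<in> link X \<tau>" unfolding link_def by blast
  qed
  then show ?thesis unfolding vertices_def by blast
qed

lemma facets_link: "facets (link X \<tau>) = (\<lambda>\<sigma>. \<sigma> - \<tau>) ` ev \<tau>"
proof (intro subset_antisym subsetI)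
  fix \<rho> assume "\<rho> \<in> facets (link X \<tau>)"
  then have \<rho>: "\<rho> \<in> link X \<tau>" "\<And>\<rho>'. \<rho>' \<in> link X \<tau> \<Longrightarrow> \<rho> \<subseteq> \<rho>' \<Longrightarrow> \<rho>' = \<rho>"
    unfolding facets_def by auto
  then obtain \<sigma> where \<sigma>: "\<sigma> \<in> X" "\<tau> \<subseteq> \<sigma>" "\<rho> = \<sigma> - \<tau>" unfolding link_def by blast
  obtain \<sigma>' where \<sigma>': "\<sigma>' \<in> facets X" "\<sigma> \<subseteq> \<sigma>'" using face_in_facet[OF \<sigma>(1)] by blast
  then have "\<sigma>' - \<tau> \<in> link X \<tau>" using facet_face \<sigma> unfolding link_def by blast
  then have "\<sigma>' - \<tau> = \<rho>" using \<rho>(2) \<sigma>' \<sigma> by blast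
  moreover have "\<sigma>' \<in> ev \<tau>" using \<sigma> \<sigma>' unfolding ev_def by blast
  ultimately show "\<rho> \<in> (\<lambda>\<sigma>. \<sigma> - \<tau>) ` ev \<tau>" by blast
next
  fix \<rho> assume "\<rho> \<in> (\<lambda>\<sigma>. \<sigma> - \<tau>) ` ev \<tau>"
  then obtain \<sigma> where \<sigma>: "\<sigma> \<in> facets X" "\<tau> \<subseteq> \<sigma>" "\<rho> = \<sigma> - \<tau>" unfolding ev_def by blast
  have "\<rho>' = \<rho>" if \<rho>': "\<rho>' \<in> link X \<tau>" "\<rho> \<subseteq> \<rho>'" for \<rho>'
  proof -
    obtain \<sigma>' where \<sigma>': "\<sigma>' \<in> X" "\<tau> \<subseteq> \<sigma>'" "\<rho>' = \<sigma>' - \<tau>"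
      using \<rho>'(1) unfolding link_def by blast
    then have "\<sigma> \<subseteq> \<sigma>'" using \<rho>'(2) \<sigma> by blast
    then have "\<sigma>' = \<sigma>" using \<sigma>(1) \<sigma>'(1) unfolding facets_def by blast
    then show ?thesis using \<sigma> \<sigma>' by blast
  qed
  moreover have "\<rho> \<in> link X \<tau>" using \<sigma> facet_face unfolding link_def by blast
  ultimately show "\<rho> \<in> facets (link X \<tau>)" unfolding facets_def by blast
qed

lemma inj_on_minus_ev: "inj_on (\<lambda>\<sigma>. \<sigma> - \<tau>) (ev \<tau>)"
  using ev_subset by (intro inj_onI) blast

lemma link_weight_minus: "\<sigma> \<in> ev \<tau> \<Longrightarrow> link_weight X w \<tau> (\<sigma> - \<tau>) = w \<sigma> / W \<tau>"
proof -
  have un: "\<sigma> \<union> \<tau> = \<sigma>" if "\<sigma> \<in> ev \<tau>" for \<sigma> using ev_subset[OF that] by blast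
  have "(\<Sum>\<sigma>'\<in>facets (link X \<tau>). w (\<sigma>' \<union> \<tau>)) = W \<tau>"
    unfolding facets_link W_def
    by (subst sum.reindex[OF inj_on_minus_ev]) (simp add: un)
  then show "\<sigma> \<in> ev \<tau> \<Longrightarrow> link_weight X w \<tau> (\<sigma> - \<tau>) = w \<sigma> / W \<tau>"
    unfolding link_weight_def by (simp add: un)
qed

lemma skeleton_edge_link:
  assumes "x \<in> N \<tau>" "y \<in> N \<tau>"
  shows "skeleton_edge (link X \<tau>) x y \<longleftrightarrow> x \<noteq> y \<and> insert y (insert x \<tau>) \<in> X"
proof -
  have "{x, y} \<in> link X \<tau> \<longleftrightarrow> insert y (insert x \<tau>) \<in> X"
  proof
    assume "{x, y} \<in> link X \<tau>"
    then obtain \<sigma> where "\<sigma> \<in> X" "\<tau> \<subseteq> \<sigma>" "{x, y} = \<sigma> - \<tau>" unfolding link_def by blast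
    moreover then have "\<sigma> = insert y (insert x \<tau>)" by blast
    ultimately show "insert y (insert x \<tau>) \<in> X" by blast
  next
    assume "insert y (insert x \<tau>) \<in> X"
    moreover have "{x, y} = insert y (insert x \<tau>) - \<tau>" using assms unfolding N_def by blast
    ultimately show "{x, y} \<in> link X \<tau>" unfolding link_def by blast
  qed
  then show ?thesis unfolding skeleton_edge_def by blast
qed

lemma edge_weight_link:
  assumes "x \<in> N \<tau>" "y \<in> N \<tau>"
  shows "edge_weight (link X \<tau>) (link_weight X w \<tau>) x y
    = (if x = y then 0 else W (insert y (insert x \<tau>))) / W \<tau>"
proof (cases "skeleton_edge (link X \<tau>) x y")
  case True
  let ?e = "insert y (insert x \<tau>)"
  have sub: "ev ?e \<subseteq> ev \<tau>" unfolding ev_def by blast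
  have "{\<rho> \<in> facets (link X \<tau>). {x, y} \<subseteq> \<rho>} = (\<lambda>\<sigma>. \<sigma> - \<tau>) ` ev ?e"
    unfolding facets_link using assms unfolding ev_def N_def by blast
  then have "edge_weight (link X \<tau>) (link_weight X w \<tau>) x y
      = (\<Sum>\<sigma>\<in>ev ?e. link_weight X w \<tau> (\<sigma> - \<tau>))"
    unfolding edge_weight_def using True
    by (simp add: sum.reindex[OF inj_on_subset[OF inj_on_minus_ev sub]])
  also have "\<dots> = W ?e / W \<tau>"
    unfolding W_def[of ?e] sum_divide_distrib using sub link_weight_minus by (intro sum.cong) auto
  finally show ?thesis using True skeleton_edge_link[OF assms] by simp
next
  case False
  then show ?thesis using skeleton_edge_link[OF assms] by (auto simp: edge_weight_def W_zero)
qed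

text \<open>The conditional expectation of the site sum also counts \<open>x\<close> itself, which
  the walk never keeps; hence the subtracted \<open>\<psi> x\<close>.\<close>

lemma sum_off_diagonal_W:
  assumes "x \<in> N \<tau>"
  shows "(\<Sum>y\<in>N \<tau>. (if x = y then 0 else W (insert y (insert x \<tau>))) * \<psi> y)
    = W (insert x \<tau>) * (E (insert x \<tau>) (site_sum (missing \<tau>) (\<lambda>_. \<psi>)) - \<psi> x)"
proof -
  have "(\<Sum>y\<in>N \<tau>. (if x = y then 0 else W (insert y (insert x \<tau>))) * \<psi> y)
      = (\<Sum>y\<in>N \<tau>. W (insert y (insert x \<tau>)) * \<psi> y - (if y = x then W (insert x \<tau>) * \<psi> x else 0))"
    by (intro sum.cong) auto
  also have "\<dots> = (\<Sum>y\<in>N \<tau>. W (insert y (insert x \<tau>)) * \<psi> y) - W (insert x \<tau>) * \<psi> x"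
    using assms finite_N by (simp add: sum_subtractf)
  also have "(\<Sum>y\<in>N \<tau>. W (insert y (insert x \<tau>)) * \<psi> y)
      = W (insert x \<tau>) * E (insert x \<tau>) (site_sum (missing \<tau>) (\<lambda>_. \<psi>))"
    by (rule sum_N_W) blast
  finally show ?thesis by (simp add: algebra_simps)
qed

text \<open>The normalising factors of the link cancel, and a facet containing \<open>x\<close> has \<open>k - 1\<close> further vertices
  outside \<open>\<tau>\<close>.\<close>

lemma walk_link:
  assumes "\<tau> \<in> X" "x \<in> N \<tau>" "y \<in> N \<tau>"
  shows "walk (link X \<tau>) (link_weight X w \<tau>) x y
    = (if x = y then 0 else W (insert y (insert x \<tau>))) / ((real (card (missing \<tau>)) - 1) * W (insert x \<tau>))"
proof -
  have x: "insert x \<tau> \<in> X" using N_face assms(2) .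
  have "(\<Sum>z\<in>N \<tau>. edge_weight (link X \<tau>) (link_weight X w \<tau>) x z)
      = (\<Sum>z\<in>N \<tau>. (if x = z then 0 else W (insert z (insert x \<tau>))) * 1) / W \<tau>"
    unfolding sum_divide_distrib by (intro sum.cong refl) (simp add: edge_weight_link assms)
  also have "\<dots> = (real (card (missing \<tau>)) - 1) * W (insert x \<tau>) / W \<tau>"
    unfolding sum_off_diagonal_W[OF assms(2)] using E_const[OF x] by simp
  finally show ?thesis
    unfolding walk_def vertices_link edge_weight_link[OF assms(2,3)]
    using W_pos[OF assms(1)] by simp
qed

lemma walk_apply:
  assumes "\<tau> \<in> X" "x \<in> N \<tau>"
  shows "(\<Sum>y\<in>N \<tau>. walk (link X \<tau>) (link_weight X w \<tau>) x y * \<psi> y)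
    = (E (insert x \<tau>) (site_sum (missing \<tau>) (\<lambda>_. \<psi>)) - \<psi> x) / (real (card (missing \<tau>)) - 1)"
proof -
  have "(\<Sum>y\<in>N \<tau>. walk (link X \<tau>) (link_weight X w \<tau>) x y * \<psi> y)
    = (\<Sum>y\<in>N \<tau>. (if x = y then 0 else W (insert y (insert x \<tau>))) * \<psi> y)
        / ((real (card (missing \<tau>)) - 1) * W (insert x \<tau>))"
    unfolding sum_divide_distrib by (intro sum.cong refl) (simp add: walk_link assms)
  then show ?thesis unfolding sum_off_diagonal_W[OF assms(2)] using W_pos[OF N_face[OF assms(2)]] by simp
qed

lemma walk_reversible:
  assumes "\<tau> \<in> X"
  shows "reversible_kernel (N \<tau>) (\<lambda>x. W (insert x \<tau>)) (walk (link X \<tau>) (link_weight X w \<tau>))"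
proof
  show "finite (N \<tau>)" by (rule finite_N)
  show pos: "0 < W (insert x \<tau>)" if "x \<in> N \<tau>" for x using W_pos[OF N_face[OF that]] .
  show "W (insert x \<tau>) * walk (link X \<tau>) (link_weight X w \<tau>) x y
      = W (insert y \<tau>) * walk (link X \<tau>) (link_weight X w \<tau>) y x"
    if "x \<in> N \<tau>" "y \<in> N \<tau>" for x y
    using pos[OF that(1)] pos[OF that(2)] walk_link[OF assms that] walk_link[OF assms that(2,1)]
    by (auto simp: insert_commute)
qed

text \<open>A step picks one of the other \<open>k - 1\<close> vertices of a random facet through
  \<open>x\<close>, so the form is the off-diagonal part of the second moment of the site sum,
  divided by \<open>k - 1\<close>.\<close>

lemma walk_form:
  assumes "\<tau> \<in> X"
  shows "(\<Sum>x\<in>N \<tau>. W (insert x \<tau>) * \<psi> x * (\<Sum>y\<in>N \<tau>. walk (link X \<tau>) (link_weight X w \<tau>) x y * \<psi> y))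
    = W \<tau> * (E \<tau> (\<lambda>\<sigma>. (site_sum (missing \<tau>) (\<lambda>_. \<psi>) \<sigma>)\<^sup>2)
        - (\<Sum>i\<in>missing \<tau>. E \<tau> (\<lambda>\<sigma>. (\<psi> (crd i \<sigma>))\<^sup>2))) / (real (card (missing \<tau>)) - 1)"
proof -
  let ?F = "site_sum (missing \<tau>) (\<lambda>_. \<psi>)"
  have "(\<Sum>x\<in>N \<tau>. W (insert x \<tau>) * \<psi> x * (\<Sum>y\<in>N \<tau>. walk (link X \<tau>) (link_weight X w \<tau>) x y * \<psi> y))
    = (\<Sum>x\<in>N \<tau>. W (insert x \<tau>) * \<psi> x * E (insert x \<tau>) ?F - W (insert x \<tau>) * (\<psi> x)\<^sup>2)
        / (real (card (missing \<tau>)) - 1)"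
    unfolding sum_divide_distrib
    by (intro sum.cong refl, subst walk_apply[OF assms])
      (auto simp: power2_eq_square algebra_simps)
  also have "\<dots> = (W \<tau> * E \<tau> (\<lambda>\<sigma>. ?F \<sigma> * ?F \<sigma>)
      - W \<tau> * (\<Sum>i\<in>missing \<tau>. E \<tau> (\<lambda>\<sigma>. (\<psi> (crd i \<sigma>))\<^sup>2))) / (real (card (missing \<tau>)) - 1)"
    unfolding sum_subtractf sum_N_square sum_N_E ..
  finally show ?thesis by (simp add: power2_eq_square algebra_simps)
qed

lemma card_N:
  assumes "\<tau> \<in> X"
  shows "card (missing \<tau>) \<le> card (N \<tau>)"
proof -
  obtain \<sigma> where \<sigma>: "\<sigma> \<in> ev \<tau>" using assms ev_nonempty by blast
  show ?thesis
  proof (rule card_inj_on_le[of "\<lambda>i. crd i \<sigma>"])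
    show "inj_on (\<lambda>i. crd i \<sigma>) (missing \<tau>)"
      by (rule inj_on_subset[OF crd_inj[OF ev_facet[OF \<sigma>]]]) (use missing_le in auto)
  qed (use crd_N[OF \<sigma>] finite_N in auto)
qed

section \<open>Second eigenvalues and variance bounds\<close>

text \<open>Orthogonality to constants centres only the whole site sum and not each type, so the
  variances of the single types are estimated by second moments.\<close>

lemma lambda2_le:
  assumes \<tau>: "\<tau> \<in> X" and k: "2 \<le> card (missing \<tau>)" and bound: "var_bound \<tau> (\<lambda>_. g)"
    and g: "0 \<le> g"
  shows "lambda2 X w \<tau> \<le> g / (real (card (missing \<tau>)) - 1)"
proof -
  interpret P: reversible_kernel "N \<tau>" "\<lambda>x. W (insert x \<tau>)" "walk (link X \<tau>) (link_weight X w \<tau>)"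
    by (rule walk_reversible[OF \<tau>])
  show ?thesis unfolding lambda2_def vertices_link
  proof (rule P.second_eigenvalue_le)
    show "2 \<le> card (N \<tau>)" using k card_N[OF \<tau>] by simp
    fix \<psi> assume "(\<Sum>x\<in>N \<tau>. W (insert x \<tau>) * \<psi> x) = 0"
    then have E0: "E \<tau> (site_sum (missing \<tau>) (\<lambda>_. \<psi>)) = 0"
      using sum_N_W[of \<tau> \<tau> \<psi>] W_pos[OF \<tau>] by simp
    let ?S = "\<Sum>i\<in>missing \<tau>. E \<tau> (\<lambda>\<sigma>. (\<psi> (crd i \<sigma>))\<^sup>2)"
    have main: "E \<tau> (\<lambda>\<sigma>. (site_sum (missing \<tau>) (\<lambda>_. \<psi>) \<sigma>)\<^sup>2) - ?S \<le> g * ?S"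
    proof -
      have "Var \<tau> (site_sum (missing \<tau>) (\<lambda>_. \<psi>)) \<le> (\<Sum>i\<in>missing \<tau>. (1 + g) * Var \<tau> (\<lambda>\<sigma>. \<psi> (crd i \<sigma>)))"
        by (rule var_boundD[OF bound])
      also have "\<dots> \<le> (\<Sum>i\<in>missing \<tau>. (1 + g) * E \<tau> (\<lambda>\<sigma>. (\<psi> (crd i \<sigma>))\<^sup>2))"
        using g by (intro sum_mono mult_left_mono Var_le_square) auto
      finally show ?thesis unfolding Var_def E0 by (simp add: sum_distrib_left sum.distrib algebra_simps)
    qed
    show "(\<Sum>x\<in>N \<tau>. W (insert x \<tau>) * \<psi> x * (\<Sum>y\<in>N \<tau>. walk (link X \<tau>) (link_weight X w \<tau>) x y * \<psi> y))
      \<le> g / (real (card (missing \<tau>)) - 1) * (\<Sum>x\<in>N \<tau>. W (insert x \<tau>) * (\<psi> x)\<^sup>2)"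
      unfolding walk_form[OF \<tau>] sum_N_square
      using mult_left_mono[OF main, of "W \<tau>"] W_nonneg[of \<tau>] k
      by (simp add: divide_right_mono algebra_simps)
  qed
qed

text \<open>For two missing types the factor \<open>k - 1\<close> is 1, and functions centred on
  each type are orthogonal to constants. The Rayleigh bound is then a variance bound.\<close>

lemma var_bound_of_lambda2:
  assumes \<tau>: "\<tau> \<in> X" and k: "card (missing \<tau>) = 2" and le: "lambda2 X w \<tau> \<le> g" and g: "g < 1"
  shows "var_bound \<tau> (\<lambda>_. g)"
proof (rule var_boundI_centred[OF \<tau>])
  interpret P: reversible_kernel "N \<tau>" "\<lambda>x. W (insert x \<tau>)" "walk (link X \<tau>) (link_weight X w \<tau>)"
    by (rule walk_reversible[OF \<tau>])
  fix \<psi> assume centred: "\<And>i. i \<in> missing \<tau> \<Longrightarrow> E \<tau> (\<lambda>\<sigma>. \<psi> (crd i \<sigma>)) = 0"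
  let ?F = "site_sum (missing \<tau>) (\<lambda>_. \<psi>)"
  let ?S = "\<Sum>i\<in>missing \<tau>. E \<tau> (\<lambda>\<sigma>. (\<psi> (crd i \<sigma>))\<^sup>2)"
  have "E \<tau> ?F = 0" using centred by (simp add: E_sum)
  then have zero: "(\<Sum>x\<in>N \<tau>. W (insert x \<tau>) * \<psi> x) = 0" using sum_N_W[of \<tau> \<tau> \<psi>] by simp
  have "(\<Sum>x\<in>N \<tau>. W (insert x \<tau>) * \<psi> x * (\<Sum>y\<in>N \<tau>. walk (link X \<tau>) (link_weight X w \<tau>) x y * \<psi> y))
      \<le> g * (\<Sum>x\<in>N \<tau>. W (insert x \<tau>) * (\<psi> x)\<^sup>2)"
  proof (rule P.rayleigh_le_second_eigenvalue[OF _ _ _ g zero])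
    show "2 \<le> card (N \<tau>)" using card_N[OF \<tau>] k by simp
    show "eigenvalue_list (matrix_on (N \<tau>) (walk (link X \<tau>) (link_weight X w \<tau>))) ! 1 \<le> g"
      using le unfolding lambda2_def vertices_link .
    fix x assume x: "x \<in> N \<tau>"
    show "(\<Sum>y\<in>N \<tau>. walk (link X \<tau>) (link_weight X w \<tau>) x y) = 1"
      using walk_apply[OF \<tau> x, of "\<lambda>_. 1"] k E_const[OF N_face[OF x], of 2] by simp
  qed
  then have "W \<tau> * (E \<tau> (\<lambda>\<sigma>. (?F \<sigma>)\<^sup>2) - ?S) \<le> W \<tau> * (g * ?S)"
    unfolding walk_form[OF \<tau>] sum_N_square k by (simp add: algebra_simps)
  then have "E \<tau> (\<lambda>\<sigma>. (?F \<sigma>)\<^sup>2) - ?S \<le> g * ?S"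
    using W_pos[OF \<tau>] by (simp add: mult_le_cancel_left)
  then have "E \<tau> (\<lambda>\<sigma>. (?F \<sigma>)\<^sup>2) \<le> (\<Sum>i\<in>missing \<tau>. (1 + g) * E \<tau> (\<lambda>\<sigma>. (\<psi> (crd i \<sigma>))\<^sup>2))"
    by (simp add: sum_distrib_left sum.distrib algebra_simps)
  then show "Var \<tau> ?F \<le> (\<Sum>i\<in>missing \<tau>. (1 + g) * E \<tau> (\<lambda>\<sigma>. (\<psi> (crd i \<sigma>))\<^sup>2))"
    by (rule order_trans[OF Var_le_square])
qed

text \<open>The top eigenpair of the covariance operator minus the diagonal \<open>K\<close>. With
  \<open>K = 1 + g\<close>, the last clause reduces a variance bound to
  \<open>\<mu> \<le> 0\<close>. The third clause expresses conditional means of the site sum by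
  \<psi> itself, which is what makes the law of total variance close up.\<close>

lemma top_eigenfunction:
  assumes \<tau>: "\<tau> \<in> X" and ne: "missing \<tau> \<noteq> {}"
  shows "\<exists>\<mu> \<psi>.
    0 < (\<Sum>i\<in>missing \<tau>. E \<tau> (\<lambda>\<sigma>. (\<psi> (crd i \<sigma>))\<^sup>2)) \<and>
    (\<exists>x\<in>N \<tau>. \<psi> x \<noteq> 0) \<and>
    (\<forall>i\<in>missing \<tau>. \<forall>\<sigma>\<in>ev \<tau>.
      E (insert (crd i \<sigma>) \<tau>) (site_sum (missing \<tau>) (\<lambda>_. \<psi>)) - E \<tau> (site_sum (missing \<tau>) (\<lambda>_. \<psi>))
        = (\<mu> + K i) * \<psi> (crd i \<sigma>)) \<and>
    (\<forall>\<theta>. Var \<tau> (site_sum (missing \<tau>) (\<lambda>_. \<theta>))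
      \<le> (\<Sum>i\<in>missing \<tau>. (\<mu> + K i) * E \<tau> (\<lambda>\<sigma>. (\<theta> (crd i \<sigma>))\<^sup>2)))"
proof -
  define B where "B x y = W (insert y (insert x \<tau>)) / W (insert x \<tau>) - W (insert y \<tau>) / W \<tau>
    - (if x = y then K (ty x) else 0)" for x y
  have pos: "0 < W (insert x \<tau>)" if "x \<in> N \<tau>" for x using W_pos[OF N_face[OF that]] .
  interpret B: reversible_kernel "N \<tau>" "\<lambda>x. W (insert x \<tau>)" B
  proof
    show "finite (N \<tau>)" by (rule finite_N)
    show "0 < W (insert x \<tau>)" if "x \<in> N \<tau>" for x using pos[OF that] .
    show "W (insert x \<tau>) * B x y = W (insert y \<tau>) * B y x" if "x \<in> N \<tau>" "y \<in> N \<tau>" for x y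
      using pos[OF that(1)] pos[OF that(2)] unfolding B_def
      by (auto simp: insert_commute algebra_simps)
  qed
  have apply_B: "(\<Sum>y\<in>N \<tau>. B x y * \<theta> y)
      = E (insert x \<tau>) (site_sum (missing \<tau>) (\<lambda>_. \<theta>)) - E \<tau> (site_sum (missing \<tau>) (\<lambda>_. \<theta>)) - K (ty x) * \<theta> x"
    if x: "x \<in> N \<tau>" for x \<theta>
  proof -
    have "(\<Sum>y\<in>N \<tau>. B x y * \<theta> y) = (\<Sum>y\<in>N \<tau>. W (insert y (insert x \<tau>)) * \<theta> y) / W (insert x \<tau>)
        - (\<Sum>y\<in>N \<tau>. W (insert y \<tau>) * \<theta> y) / W \<tau> - (\<Sum>y\<in>N \<tau>. if y = x then K (ty x) * \<theta> x else 0)"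
      unfolding sum_divide_distrib sum_subtractf[symmetric]
      by (intro sum.cong refl) (auto simp: B_def algebra_simps)
    moreover have "(\<Sum>y\<in>N \<tau>. W (insert y (insert x \<tau>)) * \<theta> y)
        = W (insert x \<tau>) * E (insert x \<tau>) (site_sum (missing \<tau>) (\<lambda>_. \<theta>))"
      by (rule sum_N_W) blast
    moreover have "(\<Sum>y\<in>N \<tau>. W (insert y \<tau>) * \<theta> y) = W \<tau> * E \<tau> (site_sum (missing \<tau>) (\<lambda>_. \<theta>))"
      by (rule sum_N_W) blast
    ultimately show ?thesis using x finite_N pos[OF x] W_pos[OF \<tau>] by simp
  qed
  have K_sum: "(\<Sum>x\<in>N \<tau>. W (insert x \<tau>) * (K (ty x) * (\<theta> x)\<^sup>2))
      = W \<tau> * (\<Sum>i\<in>missing \<tau>. K i * E \<tau> (\<lambda>\<sigma>. (\<theta> (crd i \<sigma>))\<^sup>2))" for \<theta>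
  proof -
    have "(\<Sum>x\<in>N \<tau>. W (insert x \<tau>) * (K (ty x) * (\<theta> x)\<^sup>2))
        = W \<tau> * (\<Sum>i\<in>missing \<tau>. E \<tau> (\<lambda>\<sigma>. K (ty (crd i \<sigma>)) * (\<theta> (crd i \<sigma>))\<^sup>2))"
      using sum_N_W[of \<tau> \<tau> "\<lambda>x. K (ty x) * (\<theta> x)\<^sup>2"] by (simp add: E_sum)
    also have "(\<Sum>i\<in>missing \<tau>. E \<tau> (\<lambda>\<sigma>. K (ty (crd i \<sigma>)) * (\<theta> (crd i \<sigma>))\<^sup>2))
        = (\<Sum>i\<in>missing \<tau>. K i * E \<tau> (\<lambda>\<sigma>. (\<theta> (crd i \<sigma>))\<^sup>2))"
      unfolding E_cmult[symmetric]
      by (intro sum.cong refl E_cong) (simp add: ty_crd[OF ev_facet missing_le])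
    finally show ?thesis .
  qed
  have form: "(\<Sum>x\<in>N \<tau>. W (insert x \<tau>) * \<theta> x * (\<Sum>y\<in>N \<tau>. B x y * \<theta> y))
      = W \<tau> * (Var \<tau> (site_sum (missing \<tau>) (\<lambda>_. \<theta>)) - (\<Sum>i\<in>missing \<tau>. K i * E \<tau> (\<lambda>\<sigma>. (\<theta> (crd i \<sigma>))\<^sup>2)))"
    for \<theta>
  proof -
    let ?F = "site_sum (missing \<tau>) (\<lambda>_. \<theta>)"
    have "(\<Sum>x\<in>N \<tau>. W (insert x \<tau>) * \<theta> x * (\<Sum>y\<in>N \<tau>. B x y * \<theta> y))
      = (\<Sum>x\<in>N \<tau>. W (insert x \<tau>) * \<theta> x * E (insert x \<tau>) ?F - W (insert x \<tau>) * \<theta> x * E \<tau> ?F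
          - W (insert x \<tau>) * (K (ty x) * (\<theta> x)\<^sup>2))"
      by (intro sum.cong refl, subst apply_B) (auto simp: power2_eq_square algebra_simps)
    also have "\<dots> = W \<tau> * E \<tau> (\<lambda>\<sigma>. ?F \<sigma> * ?F \<sigma>) - W \<tau> * E \<tau> ?F * E \<tau> ?F
        - W \<tau> * (\<Sum>i\<in>missing \<tau>. K i * E \<tau> (\<lambda>\<sigma>. (\<theta> (crd i \<sigma>))\<^sup>2))"
      unfolding sum_subtractf sum_N_E K_sum unfolding sum_distrib_right[symmetric] sum_N_W[OF subset_refl] ..
    finally show ?thesis unfolding Var_def by (simp add: power2_eq_square algebra_simps)
  qed
  have "N \<tau> \<noteq> {}"
    using card_N[OF \<tau>] ne finite_missing card_gt_0_iff by fastforce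
  then obtain \<mu> \<psi> where
    \<psi>: "\<exists>x\<in>N \<tau>. \<psi> x \<noteq> 0" and eig: "\<And>x. x \<in> N \<tau> \<Longrightarrow> (\<Sum>y\<in>N \<tau>. B x y * \<psi> y) = \<mu> * \<psi> x"
    and top: "\<And>\<theta>. (\<Sum>x\<in>N \<tau>. W (insert x \<tau>) * \<theta> x * (\<Sum>y\<in>N \<tau>. B x y * \<theta> y))
      \<le> \<mu> * (\<Sum>x\<in>N \<tau>. W (insert x \<tau>) * (\<theta> x)\<^sup>2)"
    using B.top_eigenpair by blast
  show ?thesis
  proof (intro exI[of _ \<mu>] exI[of _ \<psi>] conjI ballI allI)
    have "0 < (\<Sum>x\<in>N \<tau>. W (insert x \<tau>) * (\<psi> x)\<^sup>2)"
      using \<psi> pos by (auto intro!: sum_pos2[OF finite_N] simp: W_nonneg)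
    then show "0 < (\<Sum>i\<in>missing \<tau>. E \<tau> (\<lambda>\<sigma>. (\<psi> (crd i \<sigma>))\<^sup>2))"
      unfolding sum_N_square using W_pos[OF \<tau>] by (simp add: zero_less_mult_iff)
    show "\<exists>x\<in>N \<tau>. \<psi> x \<noteq> 0" by fact
    show "E (insert (crd i \<sigma>) \<tau>) (site_sum (missing \<tau>) (\<lambda>_. \<psi>)) - E \<tau> (site_sum (missing \<tau>) (\<lambda>_. \<psi>))
        = (\<mu> + K i) * \<psi> (crd i \<sigma>)" if "i \<in> missing \<tau>" "\<sigma> \<in> ev \<tau>" for i \<sigma>
      using eig[OF crd_N[OF that(2,1)]] unfolding apply_B[OF crd_N[OF that(2,1)]]
        ty_crd[OF ev_facet[OF that(2)] missing_le[OF that(1)]]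
      by (simp add: algebra_simps)
    show "Var \<tau> (site_sum (missing \<tau>) (\<lambda>_. \<theta>))
      \<le> (\<Sum>i\<in>missing \<tau>. (\<mu> + K i) * E \<tau> (\<lambda>\<sigma>. (\<theta> (crd i \<sigma>))\<^sup>2))" for \<theta>
    proof -
      have "W \<tau> * (Var \<tau> (site_sum (missing \<tau>) (\<lambda>_. \<theta>)) - (\<Sum>i\<in>missing \<tau>. K i * E \<tau> (\<lambda>\<sigma>. (\<theta> (crd i \<sigma>))\<^sup>2)))
        \<le> W \<tau> * (\<mu> * (\<Sum>i\<in>missing \<tau>. E \<tau> (\<lambda>\<sigma>. (\<theta> (crd i \<sigma>))\<^sup>2)))"
        using top[of \<theta>] unfolding form sum_N_square by (simp add: algebra_simps)
      then have "Var \<tau> (site_sum (missing \<tau>) (\<lambda>_. \<theta>)) - (\<Sum>i\<in>missing \<tau>. K i * E \<tau> (\<lambda>\<sigma>. (\<theta> (crd i \<sigma>))\<^sup>2))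
        \<le> \<mu> * (\<Sum>i\<in>missing \<tau>. E \<tau> (\<lambda>\<sigma>. (\<theta> (crd i \<sigma>))\<^sup>2))"
        using W_pos[OF \<tau>] by (simp add: mult_le_cancel_left)
      then show ?thesis by (simp add: sum_distrib_left sum.distrib algebra_simps)
    qed
  qed
qed

end

section \<open>Trickling down\<close>

lemma sum_square_le_card:
  fixes f :: "'a \<Rightarrow> real"
  assumes "finite A"
  shows "(\<Sum>i\<in>A. f i)\<^sup>2 \<le> real (card A) * (\<Sum>i\<in>A. (f i)\<^sup>2)"
proof (cases "A = {}")
  case False
  define n where "n = real (card A)"
  have n: "n > 0" using False assms by (simp add: n_def card_gt_0_iff)
  have "0 \<le> (\<Sum>i\<in>A. (f i - sum f A / n)\<^sup>2)" by (simp add: sum_nonneg)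
  also have "\<dots> = (\<Sum>i\<in>A. (f i)\<^sup>2 - 2 * (sum f A / n) * f i + (sum f A / n)\<^sup>2)"
    by (intro sum.cong) (auto simp: power2_eq_square algebra_simps)
  also have "\<dots> = (\<Sum>i\<in>A. (f i)\<^sup>2) - 2 * (sum f A / n) * sum f A + n * (sum f A / n)\<^sup>2"
    by (simp add: sum.distrib sum_subtractf sum_distrib_left n_def)
  also have "\<dots> = (\<Sum>i\<in>A. (f i)\<^sup>2) - (sum f A)\<^sup>2 / n"
    using n by (simp add: power2_eq_square field_simps)
  finally show ?thesis using n by (simp add: n_def field_simps)
qed simp

text \<open>With \<open>\<lambda> = (h - 1) / (k - 1)\<close> the hypothesis reads \<open>(k - 2) \<lambda> (1 - \<lambda>) \<le> g (1 - \<lambda>\<^sup>2)\<close>, and \<open>1 - \<lambda> > 0\<close>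
  can be cancelled.\<close>

lemma trickle_arith:
  fixes k g h :: real
  assumes k: "3 \<le> k" and g: "0 \<le> g" "g \<le> (k - 2) / 5" and h: "h < k"
    and le: "k * h \<le> (1 + g) * ((k - 1) - (h - 1)\<^sup>2 / (k - 1)) + h\<^sup>2"
  shows "h \<le> 1 + (k - 1) / 4"
proof (rule ccontr)
  assume neg: "\<not> ?thesis"
  define m l where "m = k - 1" and "l = (h - 1) / (k - 1)"
  have m: "2 \<le> m" "k = m + 1" and hl: "h = 1 + m * l" using k by (auto simp: m_def l_def)
  have l: "l < 1" "l > 1 / 4" using neg h m unfolding m hl
    by (auto simp: field_simps)
  have "(h - 1)\<^sup>2 / (k - 1) = m * l\<^sup>2" unfolding hl using m by (simp add: power2_eq_square)
  then have "(m + 1) * (1 + m * l) \<le> (1 + g) * (m - m * l\<^sup>2) + (1 + m * l)\<^sup>2"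
    using le unfolding hl by (simp add: m(2))
  then have "(m * (1 - l)) * ((m - 1) * l) \<le> (m * (1 - l)) * (g * (1 + l))"
    by (simp add: power2_eq_square algebra_simps)
  then have "(m - 1) * l \<le> g * (1 + l)" using m l by (simp add: mult_le_cancel_left)
  \<comment> \<open>From 1/5 follows \<open>l \<le> 1 / 4\<close>: the trickling-down map t / (1 -
    t) at t = 1/5.\<close>
  also have "\<dots> \<le> (m - 1) / 5 * (1 + l)" using g l m by (intro mult_right_mono) auto
  finally have "(m - 1) * (4 * l) \<le> (m - 1) * 1" by (simp add: algebra_simps)
  then show False using m l by (simp add: mult_le_cancel_left)
qed

context weighted_partite
begin

lemma eigenfunction_centred:
  assumes \<tau>: "\<tau> \<in> X" and i: "i \<in> missing \<tau>" and c: "c \<noteq> 0"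
    and eig: "\<And>\<sigma>. \<sigma> \<in> ev \<tau> \<Longrightarrow> E (insert (crd i \<sigma>) \<tau>) F - E \<tau> F = c * \<psi> (crd i \<sigma>)"
  shows "E \<tau> (\<lambda>\<sigma>. \<psi> (crd i \<sigma>)) = 0"
proof -
  have "c * E \<tau> (\<lambda>\<sigma>. \<psi> (crd i \<sigma>)) = E \<tau> (\<lambda>\<sigma>. E (insert (crd i \<sigma>) \<tau>) F - E \<tau> F)"
    unfolding E_cmult[symmetric] using eig by (intro E_cong) simp
  also have "\<dots> = 0"
    unfolding E_diff tower[OF missing_le[OF i], of \<tau> F, symmetric] E_const[OF \<tau>] by simp
  finally show ?thesis using c by simp
qed

text \<open>In the link of a vertex of type \<open>l\<close> the summand of type \<open>l\<close> is
  a constant and drops out.\<close>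

lemma Var_link_le:
  assumes \<sigma>: "\<sigma> \<in> ev \<tau>" and l: "l \<in> missing \<tau>" and bound: "var_bound (insert (crd l \<sigma>) \<tau>) g"
  shows "Var (insert (crd l \<sigma>) \<tau>) (site_sum (missing \<tau>) \<phi>)
    \<le> (\<Sum>i\<in>missing \<tau> - {l}. (1 + g i) * Var (insert (crd l \<sigma>) \<tau>) (\<lambda>\<sigma>. \<phi> i (crd i \<sigma>)))"
proof -
  let ?x = "crd l \<sigma>"
  have ld: "l \<le> d" and xT: "?x \<in> T l" and xX: "insert ?x \<tau> \<in> X"
    using missing_le[OF l] crd_type[OF ev_facet[OF \<sigma>]] insert_crd_face[OF \<sigma>] by auto
  have "Var (insert ?x \<tau>) (site_sum (missing \<tau>) \<phi>)
      = Var (insert ?x \<tau>) (\<lambda>\<sigma>. site_sum (missing \<tau> - {l}) \<phi> \<sigma> + \<phi> l ?x)"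
    using l finite_missing ev_insert[OF xT ld] by (intro Var_cong) (auto simp: sum.remove[of _ l])
  also have "\<dots> = Var (insert ?x \<tau>) (site_sum (missing \<tau> - {l}) \<phi>)" by (rule Var_shift[OF xX])
  finally show ?thesis using var_boundD[OF bound, of \<phi>] unfolding missing_insert[OF ld xT] by simp
qed

lemma E_link_square: "i \<le> d \<Longrightarrow> E \<tau> (\<lambda>\<sigma>. E (insert (crd i \<sigma>) \<tau>) (\<lambda>\<sigma>. (f \<sigma>)\<^sup>2)) = E \<tau> (\<lambda>\<sigma>. (f \<sigma>)\<^sup>2)"
  using tower[of i \<tau> "\<lambda>\<sigma>. (f \<sigma>)\<^sup>2"] by simp

text \<open>Pairing \<psi> with the site sum by the tower rule gives the third claim, the law of
  total variance at one type the fourth. Summing the fourth over all types and comparing with the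
  third is the trickling-down argument.\<close>

lemma centred_eigenfunction_variance:
  assumes \<tau>: "\<tau> \<in> X"
    and centred: "\<forall>i\<in>missing \<tau>. E \<tau> (\<lambda>\<sigma>. \<psi> (crd i \<sigma>)) = 0"
    and eig: "\<forall>i\<in>missing \<tau>. \<forall>\<sigma>\<in>ev \<tau>.
      E (insert (crd i \<sigma>) \<tau>) (site_sum (missing \<tau>) (\<lambda>_. \<psi>)) - E \<tau> (site_sum (missing \<tau>) (\<lambda>_. \<psi>))
        = c i * \<psi> (crd i \<sigma>)"
  shows "E \<tau> (site_sum (missing \<tau>) (\<lambda>_. \<psi>)) = 0"
    and "i \<in> missing \<tau> \<Longrightarrow> \<sigma> \<in> ev \<tau> \<Longrightarrow>
      E (insert (crd i \<sigma>) \<tau>) (site_sum (missing \<tau>) (\<lambda>_. \<psi>)) = c i * \<psi> (crd i \<sigma>)"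
    and "Var \<tau> (site_sum (missing \<tau>) (\<lambda>_. \<psi>))
      = (\<Sum>i\<in>missing \<tau>. c i * E \<tau> (\<lambda>\<sigma>. (\<psi> (crd i \<sigma>))\<^sup>2))"
    and "i \<in> missing \<tau> \<Longrightarrow> Var \<tau> (site_sum (missing \<tau>) (\<lambda>_. \<psi>))
      = E \<tau> (\<lambda>\<sigma>. Var (insert (crd i \<sigma>) \<tau>) (site_sum (missing \<tau>) (\<lambda>_. \<psi>)))
        + (c i)\<^sup>2 * E \<tau> (\<lambda>\<sigma>. (\<psi> (crd i \<sigma>))\<^sup>2)"
proof -
  let ?F = "site_sum (missing \<tau>) (\<lambda>_. \<psi>)"
  show E0: "E \<tau> ?F = 0" using centred by (simp add: E_sum)
  show cond: "E (insert (crd i \<sigma>) \<tau>) ?F = c i * \<psi> (crd i \<sigma>)"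
    if "i \<in> missing \<tau>" "\<sigma> \<in> ev \<tau>" for i \<sigma>
    using eig that E0 by simp
  have "Var \<tau> ?F = (\<Sum>i\<in>missing \<tau>. E \<tau> (\<lambda>\<sigma>. \<psi> (crd i \<sigma>) * ?F \<sigma>))"
    unfolding Var_def E0 E_sum[symmetric] sum_distrib_right[symmetric] by (simp add: power2_eq_square)
  also have "\<dots> = (\<Sum>i\<in>missing \<tau>. c i * E \<tau> (\<lambda>\<sigma>. (\<psi> (crd i \<sigma>))\<^sup>2))"
  proof (intro sum.cong refl)
    fix i assume i: "i \<in> missing \<tau>"
    have "E \<tau> (\<lambda>\<sigma>. \<psi> (crd i \<sigma>) * ?F \<sigma>) = E \<tau> (\<lambda>\<sigma>. \<psi> (crd i \<sigma>) * E (insert (crd i \<sigma>) \<tau>) ?F)"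
      by (rule tower_mult[OF missing_le[OF i]])
    also have "\<dots> = E \<tau> (\<lambda>\<sigma>. c i * (\<psi> (crd i \<sigma>))\<^sup>2)"
      by (rule E_cong) (simp add: cond[OF i] power2_eq_square)
    finally show "E \<tau> (\<lambda>\<sigma>. \<psi> (crd i \<sigma>) * ?F \<sigma>) = c i * E \<tau> (\<lambda>\<sigma>. (\<psi> (crd i \<sigma>))\<^sup>2)"
      unfolding E_cmult .
  qed
  finally show "Var \<tau> ?F = (\<Sum>i\<in>missing \<tau>. c i * E \<tau> (\<lambda>\<sigma>. (\<psi> (crd i \<sigma>))\<^sup>2))" .
  assume i: "i \<in> missing \<tau>"
  have "Var \<tau> (\<lambda>\<sigma>. E (insert (crd i \<sigma>) \<tau>) ?F) = E \<tau> (\<lambda>\<sigma>. (E (insert (crd i \<sigma>) \<tau>) ?F)\<^sup>2)"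
    unfolding Var_def tower[OF missing_le[OF i], of \<tau> ?F, symmetric] E0 by simp
  also have "\<dots> = (c i)\<^sup>2 * E \<tau> (\<lambda>\<sigma>. (\<psi> (crd i \<sigma>))\<^sup>2)"
    unfolding E_cmult[symmetric] by (rule E_cong) (simp add: cond[OF i] power_mult_distrib)
  finally show "Var \<tau> ?F = E \<tau> (\<lambda>\<sigma>. Var (insert (crd i \<sigma>) \<tau>) ?F) + (c i)\<^sup>2 * E \<tau> (\<lambda>\<sigma>. (\<psi> (crd i \<sigma>))\<^sup>2)"
    using total_variance[OF missing_le[OF i], of \<tau> ?F] by simp
qed

lemma sum_missing_remove:
  "(\<Sum>l\<in>missing \<tau>. \<Sum>i\<in>missing \<tau> - {l}. f l i) = (\<Sum>i\<in>missing \<tau>. \<Sum>l\<in>missing \<tau> - {i}. f l i)"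
proof -
  have "(\<Sum>l\<in>missing \<tau>. \<Sum>i\<in>missing \<tau> - {l}. f l i) = (\<Sum>l\<in>missing \<tau>. \<Sum>i\<in>missing \<tau>. if i = l then 0 else f l i)"
    by (intro sum.cong refl sum.mono_neutral_cong_left) (auto simp: finite_missing)
  also have "\<dots> = (\<Sum>i\<in>missing \<tau>. \<Sum>l\<in>missing \<tau>. if i = l then 0 else f l i)" by (rule sum.swap)
  also have "\<dots> = (\<Sum>i\<in>missing \<tau>. \<Sum>l\<in>missing \<tau> - {i}. f l i)"
    by (intro sum.cong refl sum.mono_neutral_cong_right) (auto simp: finite_missing)
  finally show ?thesis .
qed

lemma skeleton_connected_const:
  assumes conn: "skeleton_connected (link X \<tau>)"
    and edge: "\<And>x y. x \<in> N \<tau> \<Longrightarrow> y \<in> N \<tau> \<Longrightarrow> x \<noteq> y \<Longrightarrow> insert y (insert x \<tau>) \<in> X \<Longrightarrow> f x = f y"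
    and "x \<in> N \<tau>" "y \<in> N \<tau>"
  shows "f x = f y"
proof -
  have "(skeleton_edge (link X \<tau>))\<^sup>*\<^sup>* x y"
    using conn assms(3,4) unfolding skeleton_connected_def vertices_link by blast
  then have "y \<in> N \<tau> \<and> f x = f y" using assms(3)
  proof (induct rule: rtranclp_induct)
    case (step y z)
    have "{y, z} \<in> link X \<tau>" using step(2) by (simp add: skeleton_edge_def)
    then obtain \<rho> where "\<rho> \<in> X" "\<tau> \<subseteq> \<rho>" "{y, z} = \<rho> - \<tau>" unfolding link_def by blast
    then have z: "z \<in> N \<tau>" using down_closed[of \<rho> "insert z \<tau>"] unfolding N_def by auto
    then show ?case using step edge[of y z] skeleton_edge_link[of y \<tau> z] by auto
  qed simp
  then show ?thesis by simp
qed

text \<open>An eigenfunction attaining the trivial bound \<open>Var F \<le> k (\<Sum>i. Var F\<^sub>i)\<close> takes equal values on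
  adjacent vertices.\<close>

lemma eigenvalue_less_codim:
  assumes \<tau>: "\<tau> \<in> X" and conn: "skeleton_connected (link X \<tau>)" and ne: "missing \<tau> \<noteq> {}"
    and nz: "\<exists>x\<in>N \<tau>. \<psi> x \<noteq> 0"
    and centred: "\<And>i. i \<in> missing \<tau> \<Longrightarrow> E \<tau> (\<lambda>\<sigma>. \<psi> (crd i \<sigma>)) = 0"
    and var: "Var \<tau> (site_sum (missing \<tau>) (\<lambda>_. \<psi>)) = h * (\<Sum>i\<in>missing \<tau>. E \<tau> (\<lambda>\<sigma>. (\<psi> (crd i \<sigma>))\<^sup>2))"
  shows "h < real (card (missing \<tau>))"
proof (rule ccontr)
  assume neg: "\<not> ?thesis"
  define k where "k = real (card (missing \<tau>))"
  have k: "0 < k" using ne finite_missing by (simp add: k_def card_gt_0_iff)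
  let ?F = "site_sum (missing \<tau>) (\<lambda>_. \<psi>)"
  let ?b = "\<Sum>i\<in>missing \<tau>. E \<tau> (\<lambda>\<sigma>. (\<psi> (crd i \<sigma>))\<^sup>2)"
  have b: "0 \<le> ?b" by (intro sum_nonneg E_nonneg) simp
  have "E \<tau> ?F = 0" using centred by (simp add: E_sum)
  then have "E \<tau> (\<lambda>\<sigma>. (?F \<sigma>)\<^sup>2) = h * ?b" using var unfolding Var_def by simp
  moreover have "k * ?b \<le> h * ?b" using neg b by (intro mult_right_mono) (auto simp: k_def)
  ultimately have le: "?b \<le> E \<tau> (\<lambda>\<sigma>. (?F \<sigma>)\<^sup>2) / k" using k by (simp add: field_simps)
  define D where "D \<sigma> = (\<Sum>i\<in>missing \<tau>. (\<psi> (crd i \<sigma>) - ?F \<sigma> / k)\<^sup>2)" for \<sigma>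
  have D: "D \<sigma> = (\<Sum>i\<in>missing \<tau>. (\<psi> (crd i \<sigma>))\<^sup>2) - (1 / k) * (?F \<sigma>)\<^sup>2" for \<sigma>
  proof -
    have "D \<sigma> = (\<Sum>i\<in>missing \<tau>. (\<psi> (crd i \<sigma>))\<^sup>2 - 2 * (?F \<sigma> / k) * \<psi> (crd i \<sigma>) + (?F \<sigma> / k)\<^sup>2)"
      unfolding D_def by (intro sum.cong) (auto simp: power2_eq_square algebra_simps)
    also have "\<dots> = (\<Sum>i\<in>missing \<tau>. (\<psi> (crd i \<sigma>))\<^sup>2) - 2 * (?F \<sigma> / k) * ?F \<sigma> + k * (?F \<sigma> / k)\<^sup>2"
      by (simp add: sum.distrib sum_subtractf sum_distrib_left k_def)
    finally show ?thesis using k by (simp add: power2_eq_square field_simps)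
  qed
  have D0: "E \<tau> D \<le> 0"
    unfolding D E_diff E_sum E_cmult using le by simp
  have eq: "\<psi> (crd i \<sigma>) = ?F \<sigma> / k" if "i \<in> missing \<tau>" "\<sigma> \<in> ev \<tau>" for i \<sigma>
  proof -
    have "D \<sigma> = 0" by (rule E_eq_0_D[OF _ D0 that(2)]) (auto simp: D_def intro: sum_nonneg)
    then have "(\<psi> (crd i \<sigma>) - ?F \<sigma> / k)\<^sup>2 = 0"
      unfolding D_def using sum_nonneg_0[OF finite_missing, of \<tau> "\<lambda>i. (\<psi> (crd i \<sigma>) - ?F \<sigma> / k)\<^sup>2" i] that
      by auto
    then show ?thesis by simp
  qed
  have edge: "\<psi> x = \<psi> y" if xy: "x \<in> N \<tau>" "y \<in> N \<tau>" "insert y (insert x \<tau>) \<in> X" for x y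
  proof -
    obtain \<sigma> where "\<sigma> \<in> ev (insert y (insert x \<tau>))" using xy(3) ev_nonempty by blast
    then have \<sigma>: "\<sigma> \<in> ev \<tau>" "x \<in> \<sigma> - \<tau>" "y \<in> \<sigma> - \<tau>" using xy(1,2) unfolding ev_def N_def by auto
    obtain i j where ij: "i \<in> missing \<tau>" "x = crd i \<sigma>" "j \<in> missing \<tau>" "y = crd j \<sigma>"
      using \<sigma>(2,3) unfolding facet_minus_face[OF \<sigma>(1)] by blast
    show ?thesis unfolding ij(2,4)
      by (rule trans[OF eq[OF ij(1) \<sigma>(1)] eq[OF ij(3) \<sigma>(1), symmetric]])
  qed
  obtain x where x: "x \<in> N \<tau>" "\<psi> x \<noteq> 0" using nz by blast
  have const: "\<psi> y = \<psi> x" if "y \<in> N \<tau>" for y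
    by (rule skeleton_connected_const[OF conn edge that x(1)])
  obtain i where i: "i \<in> missing \<tau>" using ne by blast
  have "E \<tau> (\<lambda>\<sigma>. \<psi> (crd i \<sigma>)) = E \<tau> (\<lambda>_. \<psi> x)"
    using const crd_N i by (intro E_cong) blast
  then show False using centred[OF i] E_const[OF \<tau>] x by simp
qed

text \<open>This crude bound only serves to exclude the large solutions of the quadratic inequality in
  \<open>trickle_down\<close>.\<close>

lemma trickle_down_scalar:
  assumes \<tau>: "\<tau> \<in> X" and k3: "3 \<le> card (missing \<tau>)" and conn: "skeleton_connected (link X \<tau>)"
    and g: "0 \<le> g" "g \<le> (real (card (missing \<tau>)) - 2) / 5"
    and links: "\<And>x. x \<in> N \<tau> \<Longrightarrow> var_bound (insert x \<tau>) (\<lambda>_. g)"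
  shows "var_bound \<tau> (\<lambda>_. (real (card (missing \<tau>)) - 1) / 4)"
proof (rule var_boundI_centred[OF \<tau>])
  define k where "k = real (card (missing \<tau>))"
  have k: "3 \<le> k" using k3 by (simp add: k_def)
  have ne: "missing \<tau> \<noteq> {}" using k3 by auto
  obtain h \<psi> where b: "0 < (\<Sum>i\<in>missing \<tau>. E \<tau> (\<lambda>\<sigma>. (\<psi> (crd i \<sigma>))\<^sup>2))"
    and nz: "\<exists>x\<in>N \<tau>. \<psi> x \<noteq> 0"
    and eig: "\<And>i \<sigma>. i \<in> missing \<tau> \<Longrightarrow> \<sigma> \<in> ev \<tau> \<Longrightarrow>
      E (insert (crd i \<sigma>) \<tau>) (site_sum (missing \<tau>) (\<lambda>_. \<psi>)) - E \<tau> (site_sum (missing \<tau>) (\<lambda>_. \<psi>))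
        = (h + 0) * \<psi> (crd i \<sigma>)"
    and top: "\<And>\<theta>. Var \<tau> (site_sum (missing \<tau>) (\<lambda>_. \<theta>))
      \<le> (\<Sum>i\<in>missing \<tau>. (h + 0) * E \<tau> (\<lambda>\<sigma>. (\<theta> (crd i \<sigma>))\<^sup>2))"
    using top_eigenfunction[OF \<tau> ne, of "\<lambda>_. 0"] by blast
  let ?F = "site_sum (missing \<tau>) (\<lambda>_. \<psi>)"
  define e where "e i = E \<tau> (\<lambda>\<sigma>. (\<psi> (crd i \<sigma>))\<^sup>2)" for i
  define b where "b = (\<Sum>i\<in>missing \<tau>. e i)"
  have b0: "0 < b" using b by (simp add: b_def e_def)
  have "h \<le> 1 + (k - 1) / 4"
  proof (cases "h = 0")
    case True
    then show ?thesis using k by simp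
  next
    case False
    have centred: "E \<tau> (\<lambda>\<sigma>. \<psi> (crd i \<sigma>)) = 0" if "i \<in> missing \<tau>" for i
      using eigenfunction_centred[OF \<tau> that, of "h + 0" ?F \<psi>] eig[OF that] False by simp
    have "\<forall>i\<in>missing \<tau>. E \<tau> (\<lambda>\<sigma>. \<psi> (crd i \<sigma>)) = 0"
      "\<forall>i\<in>missing \<tau>. \<forall>\<sigma>\<in>ev \<tau>. E (insert (crd i \<sigma>) \<tau>) ?F - E \<tau> ?F = h * \<psi> (crd i \<sigma>)"
      using centred eig by auto
    note var = centred_eigenfunction_variance[OF \<tau> this]
    have Var_b: "Var \<tau> ?F = h * b" using var(3) by (simp add: b_def e_def sum_distrib_left)
    have hk: "h < k"
      unfolding k_def by (rule eigenvalue_less_codim[OF \<tau> conn ne nz centred])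
        (use Var_b in \<open>auto simp: b_def e_def\<close>)
    have link: "E \<tau> (\<lambda>\<sigma>. Var (insert (crd l \<sigma>) \<tau>) ?F)
        \<le> (1 + g) * ((\<Sum>i\<in>missing \<tau> - {l}. e i) - (h - 1)\<^sup>2 / (k - 1) * e l)"
      if l: "l \<in> missing \<tau>" for l
    proof -
      have "Var (insert (crd l \<sigma>) \<tau>) ?F \<le> (1 + g) *
          ((\<Sum>i\<in>missing \<tau> - {l}. E (insert (crd l \<sigma>) \<tau>) (\<lambda>\<sigma>. (\<psi> (crd i \<sigma>))\<^sup>2))
            - (h - 1)\<^sup>2 / (k - 1) * (\<psi> (crd l \<sigma>))\<^sup>2)" if \<sigma>: "\<sigma> \<in> ev \<tau>" for \<sigma>
      proof -
        let ?x = "crd l \<sigma>"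
        have ld: "l \<le> d" and xT: "?x \<in> T l" and xX: "insert ?x \<tau> \<in> X"
          using missing_le[OF l] crd_type[OF ev_facet[OF \<sigma>]] insert_crd_face[OF \<sigma>] by auto
        let ?E = "\<lambda>i. E (insert ?x \<tau>) (\<lambda>\<sigma>. \<psi> (crd i \<sigma>))"
        have "h * \<psi> ?x = (\<Sum>i\<in>missing \<tau>. ?E i)"
          using var(2)[OF l \<sigma>] by (simp add: E_sum)
        also have "\<dots> = \<psi> ?x + (\<Sum>i\<in>missing \<tau> - {l}. ?E i)"
          using l finite_missing E_insert_crd[OF xX xT ld, of \<psi>] by (simp add: sum.remove)
        \<comment> \<open>By Cauchy-Schwarz the squares of these \<open>k - 1\<close> conditional
          means add up to at least \<open>(h - 1)\<^sup>2 / (k - 1) * (\<psi> ?x)\<^sup>2\<close>.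
          Subtracting them in the link produces the negative term on which
          \<open>trickle_arith\<close> relies.\<close>
        finally have E_sum_l: "(\<Sum>i\<in>missing \<tau> - {l}. ?E i) = (h - 1) * \<psi> ?x" by (simp add: algebra_simps)
        have "(\<Sum>i\<in>missing \<tau> - {l}. ?E i)\<^sup>2
            \<le> real (card (missing \<tau> - {l})) * (\<Sum>i\<in>missing \<tau> - {l}. (?E i)\<^sup>2)"
          by (rule sum_square_le_card) (use finite_missing in auto)
        moreover have "real (card (missing \<tau> - {l})) = k - 1"
          using l finite_missing k3 by (simp add: k_def)
        ultimately have "(h - 1)\<^sup>2 * (\<psi> ?x)\<^sup>2 \<le> (k - 1) * (\<Sum>i\<in>missing \<tau> - {l}. (?E i)\<^sup>2)"
          unfolding E_sum_l by (simp only: power_mult_distrib)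
        then have sq: "(h - 1)\<^sup>2 / (k - 1) * (\<psi> ?x)\<^sup>2 \<le> (\<Sum>i\<in>missing \<tau> - {l}. (?E i)\<^sup>2)"
          using k by (simp add: pos_divide_le_eq mult.commute)
        have "Var (insert ?x \<tau>) ?F
            \<le> (\<Sum>i\<in>missing \<tau> - {l}. (1 + g) * Var (insert ?x \<tau>) (\<lambda>\<sigma>. \<psi> (crd i \<sigma>)))"
          by (rule Var_link_le[OF \<sigma> l links[OF crd_N[OF \<sigma> l]]])
        also have "\<dots> = (1 + g) * ((\<Sum>i\<in>missing \<tau> - {l}. E (insert ?x \<tau>) (\<lambda>\<sigma>. (\<psi> (crd i \<sigma>))\<^sup>2))
            - (\<Sum>i\<in>missing \<tau> - {l}. (?E i)\<^sup>2))"
          unfolding Var_def by (simp add: sum_distrib_left[symmetric] sum_subtractf)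
        also have "\<dots> \<le> (1 + g) * ((\<Sum>i\<in>missing \<tau> - {l}. E (insert ?x \<tau>) (\<lambda>\<sigma>. (\<psi> (crd i \<sigma>))\<^sup>2))
            - (h - 1)\<^sup>2 / (k - 1) * (\<psi> ?x)\<^sup>2)"
          using sq g by (intro mult_left_mono) auto
        finally show ?thesis .
      qed
      then have "E \<tau> (\<lambda>\<sigma>. Var (insert (crd l \<sigma>) \<tau>) ?F) \<le> E \<tau> (\<lambda>\<sigma>. (1 + g) *
          ((\<Sum>i\<in>missing \<tau> - {l}. E (insert (crd l \<sigma>) \<tau>) (\<lambda>\<sigma>. (\<psi> (crd i \<sigma>))\<^sup>2))
            - (h - 1)\<^sup>2 / (k - 1) * (\<psi> (crd l \<sigma>))\<^sup>2))"
        by (rule E_mono)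
      also have "\<dots> = (1 + g) * ((\<Sum>i\<in>missing \<tau> - {l}. e i) - (h - 1)\<^sup>2 / (k - 1) * e l)"
        unfolding E_cmult E_diff E_sum E_link_square[OF missing_le[OF l]] e_def ..
      finally show ?thesis .
    qed
    have "k * (h * b) = (\<Sum>l\<in>missing \<tau>. Var \<tau> ?F)" by (simp add: Var_b k_def)
    also have "\<dots> = (\<Sum>l\<in>missing \<tau>. E \<tau> (\<lambda>\<sigma>. Var (insert (crd l \<sigma>) \<tau>) ?F) + h\<^sup>2 * e l)"
      using var(4) by (intro sum.cong refl) (simp add: e_def)
    also have "\<dots> \<le> (\<Sum>l\<in>missing \<tau>. (1 + g) * ((\<Sum>i\<in>missing \<tau> - {l}. e i) - (h - 1)\<^sup>2 / (k - 1) * e l)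
        + h\<^sup>2 * e l)"
      using link by (intro sum_mono add_right_mono) auto
    also have "\<dots> = (1 + g) * ((\<Sum>l\<in>missing \<tau>. \<Sum>i\<in>missing \<tau> - {l}. e i) - (h - 1)\<^sup>2 / (k - 1) * b) + h\<^sup>2 * b"
      unfolding b_def
      by (simp add: sum.distrib sum_distrib_left[symmetric] sum_subtractf sum_divide_distrib[symmetric])
    also have "(\<Sum>l\<in>missing \<tau>. \<Sum>i\<in>missing \<tau> - {l}. e i) = (k - 1) * b"
      unfolding b_def sum_distrib_left using finite_missing k3
      by (subst sum_missing_remove, intro sum.cong refl) (simp add: k_def)
    finally have "b * (k * h) \<le> b * ((1 + g) * ((k - 1) - (h - 1)\<^sup>2 / (k - 1)) + h\<^sup>2)"
      by (simp add: algebra_simps)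
    then have "k * h \<le> (1 + g) * ((k - 1) - (h - 1)\<^sup>2 / (k - 1)) + h\<^sup>2"
      using b0 by (simp add: mult_le_cancel_left)
    then show ?thesis using trickle_arith k g hk unfolding k_def by blast
  qed
  then have "Var \<tau> (site_sum (missing \<tau>) (\<lambda>_. \<theta>))
      \<le> (\<Sum>i\<in>missing \<tau>. (1 + (k - 1) / 4) * E \<tau> (\<lambda>\<sigma>. (\<theta> (crd i \<sigma>))\<^sup>2))" for \<theta>
    using top[of \<theta>] by (rule_tac order_trans[OF top]) (auto intro!: sum_mono mult_right_mono E_nonneg)
  then show "Var \<tau> (site_sum (missing \<tau>) (\<lambda>_. \<theta>))
      \<le> (\<Sum>i\<in>missing \<tau>. (1 + (real (card (missing \<tau>)) - 1) / 4) * E \<tau> (\<lambda>\<sigma>. (\<theta> (crd i \<sigma>))\<^sup>2))" for \<theta>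
    unfolding k_def .
qed

text \<open>For a top eigenfunction of the covariance operator minus \<open>1 + g\<close> with eigenvalue \<open>\<mu> > 0\<close>, the terms quadratic in
  \<open>1 + g\<close> cancel, which leaves \<open>k b\<^sub>0 \<le> 2 b\<^sub>1 + \<mu> b\<^sub>0\<close>; the a priori bound contradicts this.\<close>

lemma trickle_down:
  assumes \<tau>: "\<tau> \<in> X" and k3: "3 \<le> card (missing \<tau>)" and conn: "skeleton_connected (link X \<tau>)"
    and links: "\<And>l x. l \<in> missing \<tau> \<Longrightarrow> x \<in> T l \<Longrightarrow> insert x \<tau> \<in> X \<Longrightarrow> var_bound (insert x \<tau>) (g' l)"
    and g': "\<And>l i. l \<in> missing \<tau> \<Longrightarrow> i \<in> missing \<tau> - {l} \<Longrightarrow>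
      g' l i \<le> (real (card (missing \<tau>)) - 2) / 5"
    and g'0: "\<And>l i. l \<in> missing \<tau> \<Longrightarrow> i \<in> missing \<tau> - {l} \<Longrightarrow> 0 \<le> g' l i"
    and g: "\<And>i. i \<in> missing \<tau> \<Longrightarrow> 0 \<le> g i \<and> g i \<le> (real (card (missing \<tau>)) - 1) / 5"
    and rec: "\<And>i. i \<in> missing \<tau> \<Longrightarrow>
      (\<Sum>l\<in>missing \<tau> - {i}. g' l i) \<le> (real (card (missing \<tau>)) - 2) * g i - (g i)\<^sup>2"
  shows "var_bound \<tau> g"
proof (rule var_boundI_centred[OF \<tau>])
  define k where "k = real (card (missing \<tau>))"
  have k: "3 \<le> k" using k3 by (simp add: k_def)
  have ne: "missing \<tau> \<noteq> {}" using k3 by auto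
  have apriori: "var_bound \<tau> (\<lambda>_. (k - 1) / 4)"
    unfolding k_def
  proof (rule trickle_down_scalar[OF \<tau> k3 conn])
    show "var_bound (insert x \<tau>) (\<lambda>_. (real (card (missing \<tau>)) - 2) / 5)" if x: "x \<in> N \<tau>" for x
    proof -
      obtain l where l: "l \<in> missing \<tau>" "l \<le> d" "x \<in> T l" using N_type[OF x] .
      show ?thesis
        by (rule var_bound_mono[OF N_face[OF x] links[OF l(1,3) N_face[OF x]]])
          (use g' l missing_insert[OF l(2,3)] in auto)
    qed
  qed (use k in \<open>auto simp: k_def\<close>)
  obtain \<mu> \<psi> where b: "0 < (\<Sum>i\<in>missing \<tau>. E \<tau> (\<lambda>\<sigma>. (\<psi> (crd i \<sigma>))\<^sup>2))"
    and nz: "\<exists>x\<in>N \<tau>. \<psi> x \<noteq> 0"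
    and eig: "\<And>i \<sigma>. i \<in> missing \<tau> \<Longrightarrow> \<sigma> \<in> ev \<tau> \<Longrightarrow>
      E (insert (crd i \<sigma>) \<tau>) (site_sum (missing \<tau>) (\<lambda>_. \<psi>)) - E \<tau> (site_sum (missing \<tau>) (\<lambda>_. \<psi>))
        = (\<mu> + (1 + g i)) * \<psi> (crd i \<sigma>)"
    and top: "\<And>\<theta>. Var \<tau> (site_sum (missing \<tau>) (\<lambda>_. \<theta>))
      \<le> (\<Sum>i\<in>missing \<tau>. (\<mu> + (1 + g i)) * E \<tau> (\<lambda>\<sigma>. (\<theta> (crd i \<sigma>))\<^sup>2))"
    using top_eigenfunction[OF \<tau> ne, of "\<lambda>i. 1 + g i"] by blast
  let ?F = "site_sum (missing \<tau>) (\<lambda>_. \<psi>)"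
  define e where "e i = E \<tau> (\<lambda>\<sigma>. (\<psi> (crd i \<sigma>))\<^sup>2)" for i
  have e: "0 \<le> e i" for i unfolding e_def by (rule E_nonneg) simp
  define b0 b1 where "b0 = (\<Sum>i\<in>missing \<tau>. e i)" and "b1 = (\<Sum>i\<in>missing \<tau>. (1 + g i) * e i)"
  have b0: "0 < b0" using b by (simp add: b0_def e_def)
  have "\<mu> \<le> 0"
  proof (rule ccontr)
    assume "\<not> \<mu> \<le> 0"
    then have \<mu>: "0 < \<mu>" by simp
    have nonzero: "\<mu> + (1 + g i) \<noteq> 0" if "i \<in> missing \<tau>" for i using \<mu> g[OF that] by simp
    have centred: "E \<tau> (\<lambda>\<sigma>. \<psi> (crd i \<sigma>)) = 0" if "i \<in> missing \<tau>" for i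
      by (rule eigenfunction_centred[OF \<tau> that nonzero[OF that] eig[OF that]])
    have "\<forall>i\<in>missing \<tau>. E \<tau> (\<lambda>\<sigma>. \<psi> (crd i \<sigma>)) = 0"
      "\<forall>i\<in>missing \<tau>. \<forall>\<sigma>\<in>ev \<tau>. E (insert (crd i \<sigma>) \<tau>) ?F - E \<tau> ?F
        = (\<mu> + (1 + g i)) * \<psi> (crd i \<sigma>)"
      using centred eig by auto
    note var = centred_eigenfunction_variance[OF \<tau> this]
    have Var_b: "Var \<tau> ?F = \<mu> * b0 + b1"
      using var(3) by (simp add: b0_def b1_def e_def sum_distrib_left sum.distrib algebra_simps)
    have link: "E \<tau> (\<lambda>\<sigma>. Var (insert (crd l \<sigma>) \<tau>) ?F) \<le> (\<Sum>i\<in>missing \<tau> - {l}. (1 + g' l i) * e i)"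
      if l: "l \<in> missing \<tau>" for l
    proof -
      have "Var (insert (crd l \<sigma>) \<tau>) ?F
          \<le> (\<Sum>i\<in>missing \<tau> - {l}. (1 + g' l i) * E (insert (crd l \<sigma>) \<tau>) (\<lambda>\<sigma>. (\<psi> (crd i \<sigma>))\<^sup>2))"
        if \<sigma>: "\<sigma> \<in> ev \<tau>" for \<sigma>
      proof -
        have "var_bound (insert (crd l \<sigma>) \<tau>) (g' l)"
          using links[OF l] crd_type[OF ev_facet[OF \<sigma>]] insert_crd_face[OF \<sigma>] missing_le[OF l] by blast
        from Var_link_le[OF \<sigma> l this]
        have "Var (insert (crd l \<sigma>) \<tau>) ?F
            \<le> (\<Sum>i\<in>missing \<tau> - {l}. (1 + g' l i) * Var (insert (crd l \<sigma>) \<tau>) (\<lambda>\<sigma>. \<psi> (crd i \<sigma>)))" .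
        also have "\<dots> \<le> (\<Sum>i\<in>missing \<tau> - {l}. (1 + g' l i) * E (insert (crd l \<sigma>) \<tau>) (\<lambda>\<sigma>. (\<psi> (crd i \<sigma>))\<^sup>2))"
          using g'0[OF l] by (intro sum_mono mult_left_mono Var_le_square) auto
        finally show ?thesis .
      qed
      then have "E \<tau> (\<lambda>\<sigma>. Var (insert (crd l \<sigma>) \<tau>) ?F) \<le> E \<tau> (\<lambda>\<sigma>. \<Sum>i\<in>missing \<tau> - {l}.
          (1 + g' l i) * E (insert (crd l \<sigma>) \<tau>) (\<lambda>\<sigma>. (\<psi> (crd i \<sigma>))\<^sup>2))"
        by (rule E_mono)
      also have "\<dots> = (\<Sum>i\<in>missing \<tau> - {l}. (1 + g' l i) * e i)"
        unfolding E_sum E_cmult E_link_square[OF missing_le[OF l]] e_def ..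
      finally show ?thesis .
    qed
    have "k * (\<mu> * b0 + b1) = (\<Sum>l\<in>missing \<tau>. Var \<tau> ?F)" by (simp add: Var_b k_def)
    also have "\<dots> = (\<Sum>l\<in>missing \<tau>. E \<tau> (\<lambda>\<sigma>. Var (insert (crd l \<sigma>) \<tau>) ?F) + (\<mu> + (1 + g l))\<^sup>2 * e l)"
      using var(4) by (intro sum.cong refl) (simp add: e_def)
    also have "\<dots> \<le> (\<Sum>l\<in>missing \<tau>. (\<Sum>i\<in>missing \<tau> - {l}. (1 + g' l i) * e i) + (\<mu> + (1 + g l))\<^sup>2 * e l)"
      using link by (intro sum_mono add_right_mono) auto
    also have "\<dots> = (\<Sum>i\<in>missing \<tau>. (\<Sum>l\<in>missing \<tau> - {i}. (1 + g' l i)) * e i + (\<mu> + (1 + g i))\<^sup>2 * e i)"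
    proof -
      have "(\<Sum>l\<in>missing \<tau>. \<Sum>i\<in>missing \<tau> - {l}. (1 + g' l i) * e i)
          = (\<Sum>i\<in>missing \<tau>. (\<Sum>l\<in>missing \<tau> - {i}. (1 + g' l i)) * e i)"
        by (subst sum_missing_remove) (simp only: sum_distrib_right)
      then show ?thesis by (subst (1 2) sum.distrib) simp
    qed
    also have "\<dots> \<le> (\<Sum>i\<in>missing \<tau>. (k * (1 + g i) - (1 + g i)\<^sup>2 + (\<mu> + (1 + g i))\<^sup>2) * e i)"
    proof (intro sum_mono)
      fix i assume i: "i \<in> missing \<tau>"
      have "(\<Sum>l\<in>missing \<tau> - {i}. (1 + g' l i)) = (k - 1) + (\<Sum>l\<in>missing \<tau> - {i}. g' l i)"
        using i finite_missing k3 by (simp add: sum.distrib k_def)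
      \<comment> \<open>The recursion rewritten for G = 1 + g: the values G of the links sum to at
        most k G - G^2, and this G^2 cancels the one in \<open>(\<mu> + G)\<^sup>2\<close>.\<close>
      also have "\<dots> \<le> k * (1 + g i) - (1 + g i)\<^sup>2"
        using rec[OF i] unfolding k_def[symmetric] by (simp add: power2_eq_square algebra_simps)
      finally have "(\<Sum>l\<in>missing \<tau> - {i}. (1 + g' l i)) * e i \<le> (k * (1 + g i) - (1 + g i)\<^sup>2) * e i"
        using e by (rule mult_right_mono)
      then show "(\<Sum>l\<in>missing \<tau> - {i}. (1 + g' l i)) * e i + (\<mu> + (1 + g i))\<^sup>2 * e i
          \<le> (k * (1 + g i) - (1 + g i)\<^sup>2 + (\<mu> + (1 + g i))\<^sup>2) * e i"
        by (simp add: algebra_simps)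
    qed
    also have "\<dots> = (\<Sum>i\<in>missing \<tau>. \<mu>\<^sup>2 * e i + (k + 2 * \<mu>) * ((1 + g i) * e i))"
      by (intro sum.cong refl) (simp add: power2_eq_square algebra_simps)
    also have "\<dots> = \<mu>\<^sup>2 * b0 + (k + 2 * \<mu>) * b1"
      by (simp only: sum.distrib sum_distrib_left[symmetric] b0_def b1_def)
    finally have "\<mu> * (k * b0) \<le> \<mu> * (\<mu> * b0 + 2 * b1)"
      by (simp add: power2_eq_square algebra_simps)
    then have kb: "k * b0 \<le> (\<mu> * b0 + b1) + b1" using \<mu> by (simp add: mult_le_cancel_left)
    have "\<mu> * b0 + b1 \<le> (\<Sum>i\<in>missing \<tau>. (1 + (k - 1) / 4) * Var \<tau> (\<lambda>\<sigma>. \<psi> (crd i \<sigma>)))"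
      unfolding Var_b[symmetric] by (rule var_boundD[OF apriori])
    also have "\<dots> \<le> (\<Sum>i\<in>missing \<tau>. (1 + (k - 1) / 4) * e i)"
      unfolding e_def using k by (intro sum_mono mult_left_mono Var_le_square) auto
    also have "\<dots> = (1 + (k - 1) / 4) * b0" by (simp add: b0_def sum_distrib_left)
    finally have 1: "\<mu> * b0 + b1 \<le> (1 + (k - 1) / 4) * b0" .
    have "b1 \<le> (\<Sum>i\<in>missing \<tau>. (1 + (k - 1) / 5) * e i)"
      unfolding b1_def using g e by (intro sum_mono mult_right_mono) (auto simp: k_def)
    also have "\<dots> = (1 + (k - 1) / 5) * b0" by (simp add: b0_def sum_distrib_left)
    finally have "k * b0 \<le> (1 + (k - 1) / 4) * b0 + (1 + (k - 1) / 5) * b0" using kb 1 by linarith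
    \<comment> \<open>The fractions 1/4 and 1/5 are small enough: k \<le> 2 + 9/20 (k - 1) means 11
      k \<le> 31, false from k = 3 on.\<close>
    then have "b0 * (k * 11) \<le> b0 * 31" by (simp add: field_simps)
    then show False using b0 k by (simp add: mult_le_cancel_left)
  qed
  then show "Var \<tau> (site_sum (missing \<tau>) (\<lambda>_. \<theta>))
      \<le> (\<Sum>i\<in>missing \<tau>. (1 + g i) * E \<tau> (\<lambda>\<sigma>. (\<theta> (crd i \<sigma>))\<^sup>2))" for \<theta>
    by (rule_tac order_trans[OF top]) (auto intro!: sum_mono mult_right_mono E_nonneg)
qed


section \<open>Independence of types without edges\<close>

text \<open>Extend \<open>r\<close> to a vertex \<open>v\<close> of a type outside \<open>A\<close> by the value which, by induction, it takes on all vertices of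
  the link of \<open>v\<close> with types in \<open>A\<close>. The extension is constant along all edges of the link.\<close>

lemma constant_across_types:
  assumes tc: "totally_connected d X"
    and "\<tau> \<in> X" "A \<subseteq> missing \<tau>" "2 \<le> card A"
    and "\<And>l l' a a'. l \<in> A \<Longrightarrow> l' \<in> A \<Longrightarrow> l \<noteq> l' \<Longrightarrow> a \<in> T l \<Longrightarrow> a' \<in> T l' \<Longrightarrow>
      insert a' (insert a \<tau>) \<in> X \<Longrightarrow> r a = r a'"
    and "l \<in> A" "l' \<in> A" "a \<in> T l" "a' \<in> T l'" "insert a \<tau> \<in> X" "insert a' \<tau> \<in> X"
  shows "(r a :: real) = r a'"
  using assms(2-)
proof (induct "card (missing \<tau>)" arbitrary: \<tau> l l' a a' rule: less_induct)
  case less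
  note \<tau> = less(2) and A = less(3) and card_A = less(4) and edge = less(5)
  have A_le: "l \<le> d" if "l \<in> A" for l using A missing_le that by blast
  obtain l0 where l0: "l0 \<in> A" using less(6) by blast
  have link_const: "r b = r b'"
    if v: "v \<in> N \<tau>" "ty v \<notin> A" and b: "l \<in> A" "l' \<in> A" "b \<in> T l" "b' \<in> T l'"
      "insert b (insert v \<tau>) \<in> X" "insert b' (insert v \<tau>) \<in> X" for v b b' l l'
  proof -
    obtain m where m: "m \<in> missing \<tau>" "m \<le> d" "v \<in> T m" using N_type[OF v(1)] .
    then have mA: "m \<notin> A" using v(2) ty_eq by auto
    have mis: "missing (insert v \<tau>) = missing \<tau> - {m}" by (rule missing_insert[OF m(2,3)])
    show ?thesis
    proof (rule less(1)[OF _ N_face[OF v(1)] _ card_A _ b])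
      show "card (missing (insert v \<tau>)) < card (missing \<tau>)"
        unfolding mis using m(1) finite_missing by (intro psubset_card_mono) auto
      show "A \<subseteq> missing (insert v \<tau>)" unfolding mis using A mA by blast
      fix l l' a a' assume *: "l \<in> A" "l' \<in> A" "l \<noteq> l'" "a \<in> T l" "a' \<in> T l'"
        "insert a' (insert a (insert v \<tau>)) \<in> X"
      then have "insert a' (insert a \<tau>) \<in> X" by (elim down_closed) blast
      then show "r a = r a'" using edge * by blast
    qed
  qed
  define R where "R v = (if ty v \<in> A then r v
    else r (crd l0 (SOME \<sigma>. \<sigma> \<in> ev (insert v \<tau>))))" for v
  have R_eq: "R v = r b" if v: "v \<in> N \<tau>" "ty v \<notin> A" and b: "l \<in> A" "b \<in> T l" "insert b (insert v \<tau>) \<in> X"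
    for v b l
  proof -
    define \<sigma> where "\<sigma> = (SOME \<sigma>. \<sigma> \<in> ev (insert v \<tau>))"
    have \<sigma>: "\<sigma> \<in> ev (insert v \<tau>)" unfolding \<sigma>_def
      using ev_nonempty[of "insert v \<tau>"] N_face[OF v(1)] by (simp add: some_in_eq)
    have "r (crd l0 \<sigma>) = r b"
      by (rule link_const[OF v l0 b(1) crd_type[OF ev_facet[OF \<sigma>] A_le[OF l0]] b(2)
          insert_crd_face[OF \<sigma> A_le[OF l0]] b(3)])
    then show ?thesis using v(2) by (simp add: R_def \<sigma>_def)
  qed
  have "R x = R y" if xy: "x \<in> N \<tau>" "y \<in> N \<tau>" "x \<noteq> y" "insert y (insert x \<tau>) \<in> X" for x y
  proof -
    obtain m where m: "m \<in> missing \<tau>" "m \<le> d" "x \<in> T m" using N_type[OF xy(1)] .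
    obtain n where n: "n \<in> missing \<tau>" "n \<le> d" "y \<in> T n" using N_type[OF xy(2)] .
    have ty: "ty x = m" "ty y = n" using ty_eq m n by auto
    obtain \<sigma> where \<sigma>: "\<sigma> \<in> ev (insert y (insert x \<tau>))" using xy(4) ev_nonempty by blast
    then have \<sigma>x: "\<sigma> \<in> ev (insert x \<tau>)" and \<sigma>y: "\<sigma> \<in> ev (insert y \<tau>)"
      and mem: "x \<in> \<sigma>" "y \<in> \<sigma>" unfolding ev_def by auto
    have "m \<noteq> n"
      using crd_eqI[OF ev_facet[OF \<sigma>] m(2) mem(1) m(3)] crd_eqI[OF ev_facet[OF \<sigma>] n(2) mem(2) n(3)]
        xy(3) by auto
    have xy': "insert x (insert y \<tau>) \<in> X" using xy(4) by (simp add: insert_commute)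
    show ?thesis
    proof (cases "m \<in> A")
      case mA: True
      show ?thesis
      proof (cases "n \<in> A")
        case True
        then show ?thesis using edge[OF mA True \<open>m \<noteq> n\<close> m(3) n(3) xy(4)] mA ty by (simp add: R_def)
      next
        case False
        then have "R y = r x" using R_eq[OF xy(2) _ mA m(3) xy'] ty by simp
        then show ?thesis using mA ty by (simp add: R_def)
      qed
    next
      case mA: False
      show ?thesis
      proof (cases "n \<in> A")
        case True
        then have "R x = r y" using R_eq[OF xy(1) _ True n(3) xy(4)] mA ty by simp
        then show ?thesis using True ty by (simp add: R_def)
      next
        case False
        \<comment> \<open>A facet through both ends of the edge supplies one vertex of type
          \<open>l0\<close> lying in both links.\<close>
        have "R x = r (crd l0 \<sigma>)"
          by (rule R_eq[OF xy(1) _ l0 crd_type[OF ev_facet[OF \<sigma>] A_le[OF l0]]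
              insert_crd_face[OF \<sigma>x A_le[OF l0]]]) (use mA ty in simp)
        moreover have "R y = r (crd l0 \<sigma>)"
          by (rule R_eq[OF xy(2) _ l0 crd_type[OF ev_facet[OF \<sigma>] A_le[OF l0]]
              insert_crd_face[OF \<sigma>y A_le[OF l0]]]) (use False ty in simp)
        ultimately show ?thesis by simp
      qed
    qed
  qed
  moreover have "skeleton_connected (link X \<tau>)"
  proof -
    have "2 \<le> card (missing \<tau>)" using card_A card_mono[OF finite_missing A] by simp
    then show ?thesis using tc \<tau> card_missing[OF \<tau>] unfolding totally_connected_def by simp
  qed
  moreover have "a \<in> N \<tau>" "a' \<in> N \<tau>" using less(6-11) A N_iff by blast+
  ultimately have "R a = R a'" using skeleton_connected_const[of \<tau> R a a'] by blast
  moreover have "ty a = l" "ty a' = l'" using less(6-9) ty_eq A_le by auto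
  ultimately show ?case using less(6,7) by (simp add: R_def)
qed

lemma W_partition: "i \<le> d \<Longrightarrow> W \<tau> = (\<Sum>x\<in>T i. W (insert x \<tau>))"
  unfolding W_def by (rule sum_ev_partition)

section \<open>Pairwise independence of types\<close>

text \<open>Multiplied out, so that it makes sense also for vertices which do not extend \<tau> to a
  face.\<close>

definition indep :: "'v set \<Rightarrow> nat \<Rightarrow> nat \<Rightarrow> bool" where
  "indep \<tau> i j \<longleftrightarrow>
    (\<forall>x\<in>T i. \<forall>y\<in>T j. W \<tau> * W (insert y (insert x \<tau>)) = W (insert x \<tau>) * W (insert y \<tau>))"

lemma indepD: "indep \<tau> i j \<Longrightarrow> x \<in> T i \<Longrightarrow> y \<in> T j \<Longrightarrow>
    W \<tau> * W (insert y (insert x \<tau>)) = W (insert x \<tau>) * W (insert y \<tau>)"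
  unfolding indep_def by blast

lemma indep_sym:
  assumes "indep \<tau> i j"
  shows "indep \<tau> j i"
  unfolding indep_def
proof (intro ballI)
  fix x y assume "x \<in> T j" "y \<in> T i"
  then show "W \<tau> * W (insert y (insert x \<tau>)) = W (insert x \<tau>) * W (insert y \<tau>)"
    using indepD[OF assms, of y x] by (simp add: insert_commute[of x y])
qed

lemma W_insert_zero: "insert x \<tau> \<notin> X \<Longrightarrow> W (insert y (insert x \<tau>)) = 0"
proof -
  assume "insert x \<tau> \<notin> X"
  then have "insert y (insert x \<tau>) \<notin> X" using down_closed by blast
  then show ?thesis by (rule W_zero)
qed

lemma W_indicator:
  assumes "i \<le> d" "x \<in> T i"
  shows "W \<tau> * E \<tau> (\<lambda>\<sigma>. if crd i \<sigma> = x then 1 else 0) = W (insert x \<tau>)"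
proof -
  have "W \<tau> * E \<tau> (\<lambda>\<sigma>. if crd i \<sigma> = x then 1 else 0)
      = (\<Sum>z\<in>T i. W (insert z \<tau>) * (if z = x then 1 else 0))"
    by (rule W_E_crd[OF assms(1)])
  also have "\<dots> = (\<Sum>z\<in>T i. if z = x then W (insert x \<tau>) else 0)" by (intro sum.cong) auto
  also have "\<dots> = W (insert x \<tau>)" using assms finite_type by simp
  finally show ?thesis .
qed

lemma Var_add: "Var \<tau> (\<lambda>\<sigma>. f \<sigma> + h \<sigma>) = Var \<tau> f + Var \<tau> h + 2 * (E \<tau> (\<lambda>\<sigma>. f \<sigma> * h \<sigma>) - E \<tau> f * E \<tau> h)"
proof -
  have "E \<tau> (\<lambda>\<sigma>. (f \<sigma> + h \<sigma>)\<^sup>2) = E \<tau> (\<lambda>\<sigma>. (f \<sigma>)\<^sup>2 + ((h \<sigma>)\<^sup>2 + 2 * (f \<sigma> * h \<sigma>)))"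
    by (rule E_cong) (simp add: power2_eq_square algebra_simps)
  then show ?thesis unfolding Var_def E_add E_cmult by (simp add: power2_eq_square algebra_simps)
qed

text \<open>A variance bound with excess 0, applied to an indicator and to its negative, bounds the
  covariance with the other indicator from both sides by 0.\<close>

lemma indep_of_lambda2:
  assumes \<tau>: "\<tau> \<in> X" and mis: "missing \<tau> = {i, j}" and ij: "i \<noteq> j" and le: "lambda2 X w \<tau> \<le> 0"
  shows "indep \<tau> i j"
  unfolding indep_def
proof (intro ballI)
  fix x y assume x: "x \<in> T i" and y: "y \<in> T j"
  have id: "i \<le> d" and jd: "j \<le> d" using missing_le mis by auto
  have bound: "var_bound \<tau> (\<lambda>_. 0)"
    by (rule var_bound_of_lambda2[OF \<tau> _ le]) (use mis ij in auto)
  let ?f = "\<lambda>\<sigma>. if crd i \<sigma> = x then 1 else (0 :: real)"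
  let ?h = "\<lambda>\<sigma>. if crd j \<sigma> = y then 1 else (0 :: real)"
  have cov: "s * (E \<tau> (\<lambda>\<sigma>. ?f \<sigma> * ?h \<sigma>) - E \<tau> ?f * E \<tau> ?h) \<le> 0" for s
  proof -
    let ?\<phi> = "\<lambda>l z. if l = i then s * (if z = x then 1 else 0) else if z = y then 1 else 0"
    have \<phi>: "?\<phi> i (crd i \<sigma>) = s * ?f \<sigma>" "?\<phi> j (crd j \<sigma>) = ?h \<sigma>" for \<sigma>
      using ij by auto
    have sum2: "(\<Sum>l\<in>{i, j}. a l) = a i + a j" for a :: "nat \<Rightarrow> real" using ij by simp
    have "Var \<tau> (\<lambda>\<sigma>. s * ?f \<sigma> + ?h \<sigma>) \<le> Var \<tau> (\<lambda>\<sigma>. s * ?f \<sigma>) + Var \<tau> ?h"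
      using var_boundD[OF bound, of ?\<phi>] unfolding mis sum2 \<phi> by simp
    then show ?thesis unfolding Var_add E_cmult mult.assoc by (simp add: algebra_simps)
  qed
  have fh: "E \<tau> (\<lambda>\<sigma>. ?f \<sigma> * ?h \<sigma>) = E \<tau> ?f * E \<tau> ?h" using cov[of 1] cov[of "-1"] by simp
  have W2: "W \<tau> * E \<tau> (\<lambda>\<sigma>. ?f \<sigma> * ?h \<sigma>) = W (insert y (insert x \<tau>))"
  proof -
    have "W \<tau> * E \<tau> (\<lambda>\<sigma>. ?f \<sigma> * ?h \<sigma>)
        = (\<Sum>z\<in>T i. W (insert z \<tau>) * E (insert z \<tau>) (\<lambda>\<sigma>. ?f \<sigma> * ?h \<sigma>))"
      by (rule tower_sum[OF id])
    also have "\<dots> = (\<Sum>z\<in>T i. if z = x then W (insert x \<tau>) * E (insert x \<tau>) ?h else 0)"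
    proof (intro sum.cong refl)
      fix z assume "z \<in> T i"
      then show "W (insert z \<tau>) * E (insert z \<tau>) (\<lambda>\<sigma>. ?f \<sigma> * ?h \<sigma>)
          = (if z = x then W (insert x \<tau>) * E (insert x \<tau>) ?h else 0)"
        using E_insert_mult[OF _ id, of z \<tau> "\<lambda>z. if z = x then 1 else 0" ?h] by auto
    qed
    also have "\<dots> = W (insert y (insert x \<tau>))"
      using x finite_type[OF id] W_indicator[OF jd y, of "insert x \<tau>"] by simp
    finally show ?thesis .
  qed
  have "W \<tau> * W (insert y (insert x \<tau>)) = (W \<tau> * E \<tau> ?f) * (W \<tau> * E \<tau> ?h)"
    unfolding W2[symmetric] fh by (simp only: ac_simps)
  then show "W \<tau> * W (insert y (insert x \<tau>)) = W (insert x \<tau>) * W (insert y \<tau>)"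
    unfolding W_indicator[OF id x] W_indicator[OF jd y] .
qed

text \<open>Two vertices \<open>a\<close>, \<open>a'\<close> of distinct types in \<open>A\<close> which form an edge give the same conditional weight to \<open>y\<close>:
  by independence in the links of \<open>a\<close> and of \<open>a'\<close>, both are the conditional weight given the edge.\<close>

lemma indep_across_aux:
  assumes tc: "totally_connected d X" and \<tau>: "\<tau> \<in> X"
    and AB: "A \<inter> B = {}" "A \<union> B = missing \<tau>" and card_A: "2 \<le> card A"
    and links: "\<And>l a i j. l \<in> A \<Longrightarrow> a \<in> T l \<Longrightarrow> insert a \<tau> \<in> X \<Longrightarrow> i \<in> A - {l} \<Longrightarrow> j \<in> B \<Longrightarrow>
      indep (insert a \<tau>) i j"
    and i: "i \<in> A" and j: "j \<in> B"
  shows "indep \<tau> i j"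
  unfolding indep_def
proof (intro ballI)
  fix x y assume x: "x \<in> T i" and y: "y \<in> T j"
  have id: "i \<le> d" using i AB missing_le by blast
  define r where "r a = W (insert y (insert a \<tau>)) / W (insert a \<tau>)" for a
  have edge: "r a = r a'" if *: "l \<in> A" "l' \<in> A" "l \<noteq> l'" "a \<in> T l" "a' \<in> T l'" "insert a' (insert a \<tau>) \<in> X"
    for l l' a a'
  proof -
    have a: "insert a \<tau> \<in> X" "insert a' \<tau> \<in> X" using *(6) by (auto elim: down_closed)
    let ?W2 = "W (insert a' (insert a \<tau>))" and ?W3 = "W (insert y (insert a' (insert a \<tau>)))"
    have "W (insert a \<tau>) * ?W3 = ?W2 * W (insert y (insert a \<tau>))"
      using indepD[OF links[OF *(1,4) a(1) _ j] *(5) y] * by simp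
    moreover have "W (insert a' \<tau>) * ?W3 = ?W2 * W (insert y (insert a' \<tau>))"
      using indepD[OF links[OF *(2,5) a(2) _ j] *(4) y] * by (simp add: insert_commute)
    moreover have "0 < W (insert a \<tau>)" "0 < W (insert a' \<tau>)" "0 < ?W2" using W_pos a *(6) by auto
    ultimately have "r a = ?W3 / ?W2" "r a' = ?W3 / ?W2" unfolding r_def by (auto simp: field_simps)
    then show ?thesis by simp
  qed
  have const: "r a = r a'" if "a \<in> T i" "a' \<in> T i" "insert a \<tau> \<in> X" "insert a' \<tau> \<in> X" for a a'
    by (rule constant_across_types[OF tc \<tau> _ card_A _ i i that]) (use AB edge in auto)
  show "W \<tau> * W (insert y (insert x \<tau>)) = W (insert x \<tau>) * W (insert y \<tau>)"
  proof (cases "insert x \<tau> \<in> X")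
    case True
    have "W (insert y (insert z \<tau>)) = r x * W (insert z \<tau>)" if z: "z \<in> T i" for z
    proof (cases "insert z \<tau> \<in> X")
      case zX: True
      then show ?thesis using const[OF z x zX True] W_pos[OF zX] by (simp add: r_def field_simps)
    qed (simp add: W_zero W_insert_zero)
    note W_eq = this
    \<comment> \<open>Summing the proportionality over type \<open>i\<close> identifies the constant
      \<open>r x\<close> as \<open>W (insert y \<tau>) / W \<tau>\<close>.\<close>
    have "W (insert y \<tau>) = (\<Sum>z\<in>T i. W (insert z (insert y \<tau>)))"
      by (rule W_partition[OF id])
    also have "\<dots> = (\<Sum>z\<in>T i. r x * W (insert z \<tau>))"
      using W_eq by (intro sum.cong refl) (simp add: insert_commute)
    also have "\<dots> = r x * W \<tau>"
      by (simp add: W_partition[OF id, of \<tau>] sum_distrib_left)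
    finally show ?thesis using W_eq[OF x] by simp
  qed (simp add: W_zero W_insert_zero)
qed

text \<open>As long as one group contains two types, independence in the links lifts to \<tau>, with
  the groups exchanged if necessary. Two singletons mean co-dimension 2, where
  \<open>non_adj\<close> applies.\<close>

lemma indep_across:
  assumes tc: "totally_connected d X"
    and non_adj: "\<And>\<rho> i j. \<rho> \<in> X \<Longrightarrow> missing \<rho> = {i, j} \<Longrightarrow> i \<noteq> j \<Longrightarrow> \<not> adj i j \<Longrightarrow> lambda2 X w \<rho> \<le> 0"
    and "\<tau> \<in> X" "A \<inter> B = {}" "A \<union> B = missing \<tau>"
    and "\<And>i j. i \<in> A \<Longrightarrow> j \<in> B \<Longrightarrow> \<not> adj i j"
    and "i \<in> A" "j \<in> B"
  shows "indep \<tau> i j"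
  using assms(3-)
proof (induct "card (missing \<tau>)" arbitrary: \<tau> A B i j rule: less_induct)
  case less
  note \<tau> = less(2) and AB = less(3,4) and nadj = less(5) and ij = less(6,7)
  have fin: "finite A" "finite B" using AB finite_missing[of \<tau>] by (metis finite_Un)+
  have IH: "indep (insert a \<tau>) i j"
    if l: "l \<in> missing \<tau>" "a \<in> T l" "insert a \<tau> \<in> X" and ij: "i \<in> A - {l}" "j \<in> B - {l}" for l a i j
  proof (rule less(1)[of _ "A - {l}" "B - {l}"])
    have mis: "missing (insert a \<tau>) = missing \<tau> - {l}" by (rule missing_insert[OF missing_le[OF l(1)] l(2)])
    show "card (missing (insert a \<tau>)) < card (missing \<tau>)"
      unfolding mis using l(1) finite_missing by (intro psubset_card_mono) auto
    show "A - {l} \<union> (B - {l}) = missing (insert a \<tau>)" unfolding mis using AB by blast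
  qed (use l ij AB nadj in auto)
  consider "2 \<le> card A" | "2 \<le> card B" | "A = {i}" "B = {j}"
  proof -
    have "A = {i}" if "\<not> 2 \<le> card A" using that ij(1) fin(1) card_le_Suc0_iff_eq[of A] by auto
    moreover have "B = {j}" if "\<not> 2 \<le> card B" using that ij(2) fin(2) card_le_Suc0_iff_eq[of B] by auto
    ultimately show ?thesis using that by blast
  qed
  then show ?case
  proof cases
    case 1
    show ?thesis
      by (rule indep_across_aux[OF tc \<tau> AB 1 _ ij]) (use IH AB in blast)
  next
    case 2
    have "indep \<tau> j i"
      by (rule indep_across_aux[OF tc \<tau> _ _ 2 _ ij(2,1)]) (use IH AB in \<open>blast intro: indep_sym\<close>)+
    then show ?thesis by (rule indep_sym)
  next
    case 3
    then have "missing \<tau> = {i, j}" "i \<noteq> j" using AB by auto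
    then show ?thesis using indep_of_lambda2[OF \<tau>] non_adj[OF \<tau>] nadj[OF ij] by blast
  qed
qed

section \<open>Variance bounds for independent groups of types\<close>

lemma E_indep:
  assumes \<tau>: "\<tau> \<in> X" and ind: "indep \<tau> i j" and j: "j \<le> d" and x: "x \<in> T i" "insert x \<tau> \<in> X"
  shows "E (insert x \<tau>) (\<lambda>\<sigma>. h (crd j \<sigma>)) = E \<tau> (\<lambda>\<sigma>. h (crd j \<sigma>))"
proof -
  have "W \<tau> * (W (insert x \<tau>) * E (insert x \<tau>) (\<lambda>\<sigma>. h (crd j \<sigma>)))
      = (\<Sum>y\<in>T j. (W \<tau> * W (insert y (insert x \<tau>))) * h y)"
    unfolding W_E_crd[OF j] by (simp add: sum_distrib_left mult.assoc)
  also have "\<dots> = (\<Sum>y\<in>T j. W (insert x \<tau>) * (W (insert y \<tau>) * h y))"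
    using indepD[OF ind x(1)] by (intro sum.cong refl) simp
  also have "\<dots> = W (insert x \<tau>) * (W \<tau> * E \<tau> (\<lambda>\<sigma>. h (crd j \<sigma>)))"
    unfolding W_E_crd[OF j] by (simp add: sum_distrib_left)
  finally show ?thesis using W_pos[OF \<tau>] W_pos[OF x(2)] by simp
qed

text \<open>Conditioning on the vertex of type \<open>b\<close> leaves the mean of each summand
  unchanged, so all of the variance is found inside the links. Pairwise independence suffices
  because each summand depends on a single vertex.\<close>

lemma Var_part_le:
  assumes \<tau>: "\<tau> \<in> X" and b: "b \<in> missing \<tau>" and A: "A \<subseteq> missing \<tau> - {b}"
    and ind: "\<And>i. i \<in> A \<Longrightarrow> indep \<tau> b i"
    and links: "\<And>x. x \<in> T b \<Longrightarrow> insert x \<tau> \<in> X \<Longrightarrow> var_bound (insert x \<tau>) g'"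
    and g': "\<And>i. i \<in> A \<Longrightarrow> 0 \<le> g' i \<and> g' i \<le> g i"
  shows "Var \<tau> (site_sum A \<phi>) \<le> (\<Sum>i\<in>A. (1 + g i) * Var \<tau> (\<lambda>\<sigma>. \<phi> i (crd i \<sigma>)))"
proof -
  have bd: "b \<le> d" using missing_le[OF b] .
  have Ad: "i \<le> d" if "i \<in> A" for i using A missing_le that by blast
  have cond: "E (insert (crd b \<sigma>) \<tau>) (\<lambda>\<sigma>. \<phi> i (crd i \<sigma>)) = E \<tau> (\<lambda>\<sigma>. \<phi> i (crd i \<sigma>))"
    if "\<sigma> \<in> ev \<tau>" "i \<in> A" for \<sigma> i
    by (rule E_indep[OF \<tau> ind[OF that(2)] Ad[OF that(2)] crd_type[OF ev_facet[OF that(1)] bd]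
        insert_crd_face[OF that(1) bd]])
  have "Var \<tau> (\<lambda>\<sigma>. E (insert (crd b \<sigma>) \<tau>) (site_sum A \<phi>)) = Var \<tau> (\<lambda>_. \<Sum>i\<in>A. E \<tau> (\<lambda>\<sigma>. \<phi> i (crd i \<sigma>)))"
    by (rule Var_cong) (simp add: E_sum cond)
  also have "\<dots> = 0" unfolding Var_def E_const[OF \<tau>] by simp
  finally have "Var \<tau> (site_sum A \<phi>) = E \<tau> (\<lambda>\<sigma>. Var (insert (crd b \<sigma>) \<tau>) (site_sum A \<phi>))"
    using total_variance[OF bd, of \<tau> "site_sum A \<phi>"] by simp
  also have "\<dots> \<le> E \<tau> (\<lambda>\<sigma>. \<Sum>i\<in>A. (1 + g' i) * Var (insert (crd b \<sigma>) \<tau>) (\<lambda>\<sigma>. \<phi> i (crd i \<sigma>)))"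
  proof (rule E_mono)
    fix \<sigma> assume \<sigma>: "\<sigma> \<in> ev \<tau>"
    let ?\<tau> = "insert (crd b \<sigma>) \<tau>"
    let ?\<phi> = "\<lambda>i. if i \<in> A then \<phi> i else (\<lambda>_. 0)"
    have bT: "crd b \<sigma> \<in> T b" and bX: "?\<tau> \<in> X"
      using crd_type[OF ev_facet[OF \<sigma>] bd] insert_crd_face[OF \<sigma> bd] by auto
    have mis: "missing ?\<tau> = missing \<tau> - {b}" by (rule missing_insert[OF bd bT])
    have sub: "(\<Sum>i\<in>missing ?\<tau>. f i) = (\<Sum>i\<in>A. f i)" if "\<And>i. i \<notin> A \<Longrightarrow> f i = 0" for f :: "nat \<Rightarrow> real"
      unfolding mis by (rule sum.mono_neutral_right) (use A that finite_missing in auto)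
    have V0: "Var ?\<tau> (\<lambda>_. 0) = 0" unfolding Var_def E_const[OF bX] by simp
    have "Var ?\<tau> (site_sum (missing ?\<tau>) ?\<phi>)
        \<le> (\<Sum>i\<in>missing ?\<tau>. (1 + g' i) * Var ?\<tau> (\<lambda>\<sigma>. ?\<phi> i (crd i \<sigma>)))"
      by (rule var_boundD[OF links[OF bT bX]])
    also have "(\<lambda>\<sigma>. site_sum (missing ?\<tau>) ?\<phi> \<sigma>) = site_sum A \<phi>"
      by (rule ext, subst sub) auto
    also have "(\<Sum>i\<in>missing ?\<tau>. (1 + g' i) * Var ?\<tau> (\<lambda>\<sigma>. ?\<phi> i (crd i \<sigma>)))
        = (\<Sum>i\<in>A. (1 + g' i) * Var ?\<tau> (\<lambda>\<sigma>. \<phi> i (crd i \<sigma>)))"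
      by (subst sub) (auto simp: V0)
    finally show "Var ?\<tau> (site_sum A \<phi>) \<le> (\<Sum>i\<in>A. (1 + g' i) * Var ?\<tau> (\<lambda>\<sigma>. \<phi> i (crd i \<sigma>)))" .
  qed
  also have "\<dots> = (\<Sum>i\<in>A. (1 + g' i) * E \<tau> (\<lambda>\<sigma>. Var (insert (crd b \<sigma>) \<tau>) (\<lambda>\<sigma>. \<phi> i (crd i \<sigma>))))"
    unfolding E_sum E_cmult ..
  also have "\<dots> \<le> (\<Sum>i\<in>A. (1 + g i) * Var \<tau> (\<lambda>\<sigma>. \<phi> i (crd i \<sigma>)))"
  proof (intro sum_mono mult_mono)
    fix i assume i: "i \<in> A"
    show "E \<tau> (\<lambda>\<sigma>. Var (insert (crd b \<sigma>) \<tau>) (\<lambda>\<sigma>. \<phi> i (crd i \<sigma>))) \<le> Var \<tau> (\<lambda>\<sigma>. \<phi> i (crd i \<sigma>))"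
      using total_variance[OF bd, of \<tau> "\<lambda>\<sigma>. \<phi> i (crd i \<sigma>)"]
        Var_nonneg[OF \<tau>, of "\<lambda>\<sigma>. E (insert (crd b \<sigma>) \<tau>) (\<lambda>\<sigma>. \<phi> i (crd i \<sigma>))"] by simp
    show "0 \<le> E \<tau> (\<lambda>\<sigma>. Var (insert (crd b \<sigma>) \<tau>) (\<lambda>\<sigma>. \<phi> i (crd i \<sigma>)))"
      by (rule E_nonneg) (use Var_nonneg insert_crd_face bd in blast)
    show "1 + g' i \<le> 1 + g i" "0 \<le> 1 + g i" using g'[OF i] by auto
  qed
  finally show ?thesis .
qed

text \<open>The covariance of the two partial sums vanishes, so their bounds add up; each part is
  conditioned on one type of the other part.\<close>

lemma var_bound_split:
  assumes \<tau>: "\<tau> \<in> X" and AB: "A \<inter> B = {}" "A \<union> B = missing \<tau>" and a: "a \<in> A" and b: "b \<in> B"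
    and ind: "\<And>i j. i \<in> A \<Longrightarrow> j \<in> B \<Longrightarrow> indep \<tau> i j"
    and links: "\<And>l x. l \<in> missing \<tau> \<Longrightarrow> x \<in> T l \<Longrightarrow> insert x \<tau> \<in> X \<Longrightarrow> var_bound (insert x \<tau>) (g' l)"
    and gA: "\<And>i. i \<in> A \<Longrightarrow> 0 \<le> g' b i \<and> g' b i \<le> g i"
    and gB: "\<And>i. i \<in> B \<Longrightarrow> 0 \<le> g' a i \<and> g' a i \<le> g i"
  shows "var_bound \<tau> g"
  unfolding var_bound_def
proof
  fix \<phi> :: "nat \<Rightarrow> 'v \<Rightarrow> real"
  have fin: "finite A" "finite B" using AB finite_missing[of \<tau>] by (metis finite_Un)+
  have ab: "a \<in> missing \<tau>" "b \<in> missing \<tau>" using AB a b by auto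
  have le: "i \<le> d" if "i \<in> A \<union> B" for i using AB missing_le that by blast
  have cov: "E \<tau> (\<lambda>\<sigma>. \<phi> i (crd i \<sigma>) * \<phi> j (crd j \<sigma>)) = E \<tau> (\<lambda>\<sigma>. \<phi> i (crd i \<sigma>)) * E \<tau> (\<lambda>\<sigma>. \<phi> j (crd j \<sigma>))"
    if "i \<in> A" "j \<in> B" for i j
  proof -
    have id: "i \<le> d" "j \<le> d" using le that by auto
    have "E \<tau> (\<lambda>\<sigma>. \<phi> i (crd i \<sigma>) * \<phi> j (crd j \<sigma>))
        = E \<tau> (\<lambda>\<sigma>. \<phi> i (crd i \<sigma>) * E (insert (crd i \<sigma>) \<tau>) (\<lambda>\<sigma>. \<phi> j (crd j \<sigma>)))"
      by (rule tower_mult[OF id(1)])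
    also have "\<dots> = E \<tau> (\<lambda>\<sigma>. E \<tau> (\<lambda>\<sigma>. \<phi> j (crd j \<sigma>)) * \<phi> i (crd i \<sigma>))"
    proof (rule E_cong)
      fix \<sigma> assume \<sigma>: "\<sigma> \<in> ev \<tau>"
      show "\<phi> i (crd i \<sigma>) * E (insert (crd i \<sigma>) \<tau>) (\<lambda>\<sigma>. \<phi> j (crd j \<sigma>))
          = E \<tau> (\<lambda>\<sigma>. \<phi> j (crd j \<sigma>)) * \<phi> i (crd i \<sigma>)"
        using E_indep[OF \<tau> ind[OF that] id(2) crd_type[OF ev_facet[OF \<sigma>] id(1)] insert_crd_face[OF \<sigma> id(1)]]
        by simp
    qed
    finally show ?thesis unfolding E_cmult by simp
  qed
  have "E \<tau> (\<lambda>\<sigma>. site_sum A \<phi> \<sigma> * site_sum B \<phi> \<sigma>) = E \<tau> (site_sum A \<phi>) * E \<tau> (site_sum B \<phi>)"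
    unfolding sum_product E_sum by (intro sum.cong refl) (simp add: cov)
  then have "Var \<tau> (\<lambda>\<sigma>. site_sum A \<phi> \<sigma> + site_sum B \<phi> \<sigma>) = Var \<tau> (site_sum A \<phi>) + Var \<tau> (site_sum B \<phi>)"
    unfolding Var_add by simp
  also have "(\<lambda>\<sigma>. site_sum A \<phi> \<sigma> + site_sum B \<phi> \<sigma>) = site_sum (missing \<tau>) \<phi>"
    unfolding AB(2)[symmetric] sum.union_disjoint[OF fin AB(1)] ..
  also have "Var \<tau> (site_sum A \<phi>) \<le> (\<Sum>i\<in>A. (1 + g i) * Var \<tau> (\<lambda>\<sigma>. \<phi> i (crd i \<sigma>)))"
    by (rule Var_part_le[OF \<tau>, where b = b and g' = "g' b"])
      (use AB b ab ind links gA in \<open>auto intro: indep_sym\<close>)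
  also have "Var \<tau> (site_sum B \<phi>) \<le> (\<Sum>i\<in>B. (1 + g i) * Var \<tau> (\<lambda>\<sigma>. \<phi> i (crd i \<sigma>)))"
    by (rule Var_part_le[OF \<tau>, where b = a and g' = "g' a"]) (use AB a ab ind links gB in auto)
  finally show "Var \<tau> (site_sum (missing \<tau>) \<phi>)
      \<le> (\<Sum>i\<in>missing \<tau>. (1 + g i) * Var \<tau> (\<lambda>\<sigma>. \<phi> i (crd i \<sigma>)))"
    unfolding AB(2)[symmetric] sum.union_disjoint[OF fin AB(1)] by simp
qed

section \<open>Induction on the co-dimension\<close>

text \<open>Adjacency of \<open>a\<close> and \<open>b\<close> is left open, so two isolated types
  also qualify; in either case the pair is cut off from the rest of \<open>S\<close>.\<close>

definition isolated_edge :: "(nat \<Rightarrow> nat \<Rightarrow> bool) \<Rightarrow> nat set \<Rightarrow> nat \<Rightarrow> nat \<Rightarrow> bool" where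
  "isolated_edge adj S a b \<longleftrightarrow> a \<in> S \<and> b \<in> S \<and> a \<noteq> b \<and>
    (\<forall>c\<in>S - {a, b}. \<not> adj a c \<and> \<not> adj b c)"

text \<open>The family \<open>g\<close> stays abstract because two instances occur:
  \<open>weight\<close>, and 0 when no two types are dependent.\<close>

lemma var_bound_induct:
  assumes tc: "totally_connected d X"
    and non_adj: "\<And>\<rho> i j. \<rho> \<in> X \<Longrightarrow> missing \<rho> = {i, j} \<Longrightarrow> i \<noteq> j \<Longrightarrow> \<not> adj i j \<Longrightarrow> lambda2 X w \<rho> \<le> 0"
    and lam: "\<And>\<rho>. \<rho> \<in> X \<Longrightarrow> card (missing \<rho>) = 2 \<Longrightarrow> lambda2 X w \<rho> \<le> \<gamma>" and \<gamma>: "\<gamma> < 1"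
    and base: "\<And>i j. i \<noteq> j \<Longrightarrow> adj i j \<Longrightarrow> \<gamma> \<le> g {i, j} i \<and> \<gamma> \<le> g {i, j} j"
    and range: "\<And>S i. S \<subseteq> {..d} \<Longrightarrow> 2 \<le> card S \<Longrightarrow> i \<in> S \<Longrightarrow> 0 \<le> g S i \<and> g S i \<le> (real (card S) - 1) / 5"
    and rec: "\<And>S i. S \<subseteq> {..d} \<Longrightarrow> 3 \<le> card S \<Longrightarrow> (\<And>a b. \<not> isolated_edge adj S a b) \<Longrightarrow> i \<in> S \<Longrightarrow>
      (\<Sum>l\<in>S - {i}. g (S - {l}) i) \<le> (real (card S) - 2) * g S i - (g S i)\<^sup>2"
    and iso: "\<And>S a b c. S \<subseteq> {..d} \<Longrightarrow> isolated_edge adj S a b \<Longrightarrow> c \<in> S - {a, b} \<Longrightarrow>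
      g (S - {c}) a \<le> g S a \<and> g (S - {c}) b \<le> g S b \<and> g (S - {a}) c \<le> g S c"
    and "\<tau> \<in> X" "2 \<le> card (missing \<tau>)"
  shows "var_bound \<tau> (g (missing \<tau>))"
  using assms(9-)
proof (induct "card (missing \<tau>)" arbitrary: \<tau> rule: less_induct)
  case less
  note \<tau> = less(2) and card2 = less(3)
  let ?S = "missing \<tau>"
  have Sd: "?S \<subseteq> {..d}" using missing_le by auto
  show ?case
  proof (cases "card ?S = 2")
    case True
    then obtain i j where ij: "?S = {i, j}" "i \<noteq> j" using card_2_iff by metis
    show ?thesis
    proof (cases "adj i j")
      case adj: True
      show ?thesis
        by (rule var_bound_mono[OF \<tau> var_bound_of_lambda2[OF \<tau> True lam[OF \<tau> True] \<gamma>]])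
          (use base[OF ij(2) adj] ij in auto)
    next
      case False
      have "lambda2 X w \<tau> \<le> 0" by (rule non_adj[OF \<tau> ij False])
      then show ?thesis
        by (intro var_bound_mono[OF \<tau> var_bound_of_lambda2[OF \<tau> True, of 0]])
          (use range[OF Sd card2] in auto)
    qed
  next
    case False
    then have card3: "3 \<le> card ?S" using card2 by simp
    have links: "var_bound (insert x \<tau>) (g (?S - {l}))"
      if l: "l \<in> ?S" "x \<in> T l" "insert x \<tau> \<in> X" for l x
    proof -
      have mis: "missing (insert x \<tau>) = ?S - {l}" by (rule missing_insert[OF missing_le[OF l(1)] l(2)])
      have "card (?S - {l}) = card ?S - 1" using l finite_missing by simp
      then show ?thesis using less(1)[of "insert x \<tau>"] l(3) card3 unfolding mis by simp
    qed
    have range': "0 \<le> g (?S - {l}) i \<and> g (?S - {l}) i \<le> (real (card ?S) - 2) / 5"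
      if "l \<in> ?S" "i \<in> ?S - {l}" for l i
    proof -
      have "card (?S - {l}) = card ?S - 1" using that finite_missing by simp
      moreover have "?S - {l} \<subseteq> {..d}" using Sd by blast
      ultimately show ?thesis using range[of "?S - {l}" i] that card3 by (simp add: of_nat_diff)
    qed
    show ?thesis
    proof (cases "\<exists>a b. isolated_edge adj ?S a b")
      case True
      then obtain a b where ab: "isolated_edge adj ?S a b" by blast
      then have ab': "a \<in> ?S" "b \<in> ?S" "a \<noteq> b" unfolding isolated_edge_def by auto
      have "?S - {a, b} \<noteq> {}"
      proof
        assume "?S - {a, b} = {}"
        then have "card ?S \<le> card {a, b}" by (intro card_mono) auto
        also have "\<dots> \<le> 2" by (simp add: card_insert_if)
        finally show False using card3 by simp
      qed
      then obtain c where c: "c \<in> ?S - {a, b}" by blast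
      show ?thesis
      proof (rule var_bound_split[OF \<tau>, of "{a, b}" "?S - {a, b}" a c "\<lambda>l. g (?S - {l})"])
        show "indep \<tau> i j" if "i \<in> {a, b}" "j \<in> ?S - {a, b}" for i j
          by (rule indep_across[OF tc non_adj \<tau>, where A = "{a, b}" and B = "?S - {a, b}"])
            (use ab that in \<open>auto simp: isolated_edge_def\<close>)
      next
        fix i assume "i \<in> {a, b}"
        then show "0 \<le> g (?S - {c}) i \<and> g (?S - {c}) i \<le> g ?S i"
          using iso[OF Sd ab c] range'[of c i] c ab' by auto
      next
        fix i assume "i \<in> ?S - {a, b}"
        then show "0 \<le> g (?S - {a}) i \<and> g (?S - {a}) i \<le> g ?S i"
          using iso[OF Sd ab, of i] range'[of a i] ab' by auto
      qed (use ab' c links in auto)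
    next
      case False
      have "skeleton_connected (link X \<tau>)"
        using tc \<tau> card_missing[OF \<tau>] card2 unfolding totally_connected_def by simp
      then show ?thesis
        by (rule trickle_down[OF \<tau> card3 _ links]) (use range' range[OF Sd card2] rec[OF Sd card3] False in auto)
    qed
  qed
qed


section \<open>Expansion of the links\<close>

definition dependent :: "nat \<Rightarrow> nat \<Rightarrow> bool" where
  "dependent i j \<longleftrightarrow> i \<noteq> j \<and> i \<le> d \<and> j \<le> d \<and>
    (\<exists>\<tau>\<in>X. face_type d T \<tau> = {..d} - {i, j} \<and> lambda2 X w \<tau> > 0)"

lemma dependent_sym: "dependent i j \<Longrightarrow> dependent j i"
  unfolding dependent_def by (auto simp: insert_commute)

lemma face_type_eq_iff:
  assumes "\<tau> \<in> X" "i \<le> d" "j \<le> d"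
  shows "face_type d T \<tau> = {..d} - {i, j} \<longleftrightarrow> missing \<tau> = {i, j}"
  unfolding face_type_missing[OF assms(1)] using assms(2,3) missing_le[of _ \<tau>] by auto

lemma degree_le_Delta:
  assumes "i \<in> {..d}"
  shows "card {j \<in> {..d}. dependent i j} \<le> Delta d T X w"
proof -
  have "{j \<in> {..d}. dependent i j}
      = {j\<in>{..d} - {i}. \<exists>\<tau>\<in>X. face_type d T \<tau> = {..d} - {i, j} \<and> lambda2 X w \<tau> > 0}"
    using assms by (auto simp: dependent_def)
  then have "card {j \<in> {..d}. dependent i j} = Delta_at d T X w i" by (simp add: Delta_at_def)
  also have "\<dots> \<le> Delta d T X w" unfolding Delta_def using assms by (intro Max_ge) auto
  finally show ?thesis .
qed

lemma lambda2_le_gamma2: "\<tau> \<in> X \<Longrightarrow> card (missing \<tau>) = 2 \<Longrightarrow> lambda2 X w \<tau> \<le> gamma2 d X w"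
  unfolding gamma2_def using finite_complex card_missing[of \<tau>] by (intro Max_ge) auto

lemma lambda2_nonpos:
  assumes "\<tau> \<in> X" "missing \<tau> = {i, j}" "i \<noteq> j" "\<not> dependent i j"
  shows "lambda2 X w \<tau> \<le> 0"
proof -
  have "i \<le> d" "j \<le> d" using missing_le assms(2) by auto
  then show ?thesis using assms face_type_eq_iff[OF assms(1), of i j]
    unfolding dependent_def by (meson not_le)
qed

lemma link_expansion:
  assumes tc: "totally_connected d X" and \<delta>: "0 < \<delta>" "\<delta> < 1"
    and \<gamma>_log: "gamma2 d X w \<le> \<delta>\<^sup>2 / (10 * (1 + ln (real (Delta d T X w))))"
    and \<gamma>_lin: "gamma2 d X w \<le> (1 - \<delta>) / (real (Delta d T X w) + ln (real (Delta d T X w)))"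
    and \<tau>: "\<tau> \<in> X" and k: "2 \<le> card (missing \<tau>)"
  shows "lambda2 X w \<tau> \<le> expansion_bound 2 \<delta> (Delta d T X w) (card (missing \<tau>))"
proof -
  define D where "D = Delta d T X w"
  define k where "k = card (missing \<tau>)"
  have k2: "2 \<le> k" using k by (simp add: k_def)
  have Sd: "missing \<tau> \<subseteq> {..d}" using missing_le by auto
  have "gamma2 d X w < 1"
  proof -
    \<comment> \<open>For \<open>D = 0\<close> this rests on the convention
      \<open>ln 0 = 0\<close>.\<close>
    have "1 \<le> 1 + ln (real D)" by (cases "D = 0") auto
    then have "\<delta>\<^sup>2 / (10 * (1 + ln (real D))) \<le> \<delta>\<^sup>2 / 1" using \<delta> by (intro divide_left_mono) auto
    also have "\<dots> < 1" using \<delta> by (simp add: abs_square_less_1)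
    finally show ?thesis using \<gamma>_log unfolding D_def by linarith
  qed
  have "\<exists>g. var_bound \<tau> g \<and> (\<forall>i\<in>missing \<tau>. g i \<le> (real k - 1) * expansion_bound 2 \<delta> D k)
      \<and> 0 \<le> expansion_bound 2 \<delta> D k"
  \<comment> \<open>A dependent pair supplies \<open>1 \<le> D\<close> and a positive \<gamma>, as
    \<open>degree_bound\<close> requires. With no such pair \<Delta> is 0 and all excesses
    vanish.\<close>
  proof (cases "\<exists>i j. dependent i j")
    case True
    then obtain i j where ij: "dependent i j" by blast
    then obtain \<rho> where \<rho>: "\<rho> \<in> X" "missing \<rho> = {i, j}" "i \<noteq> j" "lambda2 X w \<rho> > 0"
      unfolding dependent_def using face_type_eq_iff by auto
    have \<gamma>: "0 < gamma2 d X w" using lambda2_le_gamma2[OF \<rho>(1)] \<rho> by simp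
    have "j \<in> {j \<in> {..d}. dependent i j}" using ij by (simp add: dependent_def)
    then have "0 < card {j \<in> {..d}. dependent i j}" by (auto simp: card_gt_0_iff)
    then have D: "1 \<le> D" using degree_le_Delta[of i] ij by (simp add: D_def dependent_def)
    interpret degree_bound \<delta> "gamma2 d X w" D "{..d}" dependent
      by unfold_locales
        (use \<delta> \<gamma> D \<gamma>_log \<gamma>_lin dependent_sym degree_le_Delta in \<open>auto simp: D_def dependent_def\<close>)
    have "var_bound \<tau> (weight (missing \<tau>))"
    proof (rule var_bound_induct[OF tc lambda2_nonpos lambda2_le_gamma2 \<open>gamma2 d X w < 1\<close> _ _ _ _ \<tau> k])
      show "gamma2 d X w \<le> weight {i, j} i \<and> gamma2 d X w \<le> weight {i, j} j"
        if "i \<noteq> j" "dependent i j" for i j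
        using weight_edge[OF that] weight_edge[of j i] dependent_sym[OF that(2)] that(1)
        by (simp add: insert_commute)
      show "0 \<le> weight S i \<and> weight S i \<le> (real (card S) - 1) / 5"
        if "S \<subseteq> {..d}" "2 \<le> card S" "i \<in> S" for S i
        using weight_range that by blast
      show "(\<Sum>l\<in>S - {i}. weight (S - {l}) i) \<le> (real (card S) - 2) * weight S i - (weight S i)\<^sup>2"
        if S: "S \<subseteq> {..d}" "3 \<le> card S" "\<And>a b. \<not> isolated_edge dependent S a b" "i \<in> S" for S i
      proof (rule weight_rec[OF S(1,2,4)])
        fix l assume l: "l \<in> S" "nbs S i = {l}"
        show "nbs S l \<noteq> {i}"
        proof
          assume "nbs S l = {i}"
          then have "isolated_edge dependent S i l"
            using l S(4) adj_irrefl unfolding isolated_edge_def nbs_def by blast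
          then show False using S(3) by blast
        qed
      qed
      show "weight (S - {c}) a \<le> weight S a \<and> weight (S - {c}) b \<le> weight S b \<and> weight (S - {a}) c \<le> weight S c"
        if iso: "isolated_edge dependent S a b" and c: "c \<in> S - {a, b}" for S a b c
      proof -
        have nadj: "\<not> dependent a c" "\<not> dependent b c" "\<not> dependent c a" "\<not> dependent c b"
          using iso c adj_sym unfolding isolated_edge_def by blast+
        have "nbs S a \<subseteq> {b}" "nbs S b \<subseteq> {a}"
          using iso adj_irrefl unfolding isolated_edge_def nbs_def by auto
        then have "weight (S - {c}) a = weight S a" "weight (S - {c}) b = weight S b"
          using nadj by (intro weight_remove_far; auto)+
        moreover have "weight (S - {a}) c = weight S c"
        proof (rule weight_remove_far[OF nadj(3)])
          fix j assume j: "j \<in> nbs S c"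
          then have "j \<in> S - {a, b}" using nadj by (auto simp: nbs_def)
          then show "\<not> dependent j a" using iso adj_sym unfolding isolated_edge_def by blast
        qed
        ultimately show ?thesis by simp
      qed
    qed
    moreover have bound: "weight (missing \<tau>) i \<le> (real k - 1) * expansion_bound 2 \<delta> D k"
      if "i \<in> missing \<tau>" for i
      unfolding k_def by (rule weight_le_expansion_bound[OF Sd that k])
    moreover have "0 \<le> expansion_bound 2 \<delta> D k"
    proof -
      obtain i where i: "i \<in> missing \<tau>" using k by fastforce
      have "0 \<le> (real k - 1) * expansion_bound 2 \<delta> D k"
        using weight_nonneg[OF Sd i] bound[OF i] by linarith
      then show ?thesis using k2 by (simp add: zero_le_mult_iff)
    qed
    ultimately show ?thesis by blast
  next
    case False
    then have "Delta_at d T X w i = 0" if "i \<le> d" for i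
      using that unfolding Delta_at_def dependent_def by auto
    then have "Delta_at d T X w ` {..d} = {0}" by auto
    then have D: "D = 0" by (simp add: D_def Delta_def)
    have "var_bound \<tau> ((\<lambda>_ _. 0) (missing \<tau>))"
      by (rule var_bound_induct[OF tc lambda2_nonpos lambda2_le_gamma2 \<open>gamma2 d X w < 1\<close> _ _ _ _ \<tau> k])
        (use False in auto)
    moreover have B: "0 \<le> expansion_bound 2 \<delta> D k" using \<delta> by (simp add: D expansion_bound_def)
    moreover then have "0 \<le> (real k - 1) * expansion_bound 2 \<delta> D k"
      using k2 by (intro mult_nonneg_nonneg) auto
    ultimately show ?thesis by (intro exI[of _ "\<lambda>_. 0"]) auto
  qed
  then obtain g where g: "var_bound \<tau> g" "\<And>i. i \<in> missing \<tau> \<Longrightarrow> g i \<le> (real k - 1) * expansion_bound 2 \<delta> D k"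
    and B: "0 \<le> expansion_bound 2 \<delta> D k" by blast
  have "var_bound \<tau> (\<lambda>_. (real k - 1) * expansion_bound 2 \<delta> D k)"
    by (rule var_bound_mono[OF \<tau> g])
  from lambda2_le[OF \<tau> k this] B k2 show ?thesis by (simp add: k_def D_def)
qed

end

theorem theorem1p4:
  fixes \<delta> :: real
  assumes "0 < \<delta>" and "\<delta> < 1"
  shows "\<exists>c::real. c \<le> 2 \<and>
    (\<forall>(d::nat) (T :: nat \<Rightarrow> 'v set) (X :: 'v set set) (w :: 'v set \<Rightarrow> real).
       weighted_partite_complex d T X w \<longrightarrow>
       totally_connected d X \<longrightarrow>
       gamma2 d X w \<le> \<delta>\<^sup>2 / (10 * (1 + ln (real (Delta d T X w)))) \<longrightarrow>
       gamma2 d X w \<le> (1 - \<delta>) / (real (Delta d T X w) + ln (real (Delta d T X w))) \<longrightarrow>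
       (\<forall>(k::nat) \<tau>. k \<ge> 2 \<longrightarrow> \<tau> \<in> X \<longrightarrow> codim d \<tau> = k \<longrightarrow>
          link_spectral_expander X w \<tau> (expansion_bound c \<delta> (Delta d T X w) k)))"
proof (intro exI[of _ 2] conjI allI impI)
  fix d :: nat and T :: "nat \<Rightarrow> 'v set" and X :: "'v set set" and w :: "'v set \<Rightarrow> real" and k :: nat and \<tau>
  assume "weighted_partite_complex d T X w"
  then interpret weighted_partite d T X w by unfold_locales
  assume *: "totally_connected d X"
    "gamma2 d X w \<le> \<delta>\<^sup>2 / (10 * (1 + ln (real (Delta d T X w))))"
    "gamma2 d X w \<le> (1 - \<delta>) / (real (Delta d T X w) + ln (real (Delta d T X w)))"
    and \<tau>: "2 \<le> k" "\<tau> \<in> X" "codim d \<tau> = k"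
  then show "link_spectral_expander X w \<tau> (expansion_bound 2 \<delta> (Delta d T X w) k)"
    using link_expansion[OF *(1) assms *(2,3) \<tau>(2)] card_missing[OF \<tau>(2)]
    unfolding link_spectral_expander_def by simp
qed simp

end
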